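(* Let $\mathcal D\in\mathrm{TIC}_\infty(U,Y)$. If $\mathcal D$ has a stabilizing dynamic feedback controller (without an internal loop), i.e., if there is $\mathcal T\in\mathrm{TIC}_\infty(Y,U)$ such that $\begin{bmatrix}I&-\mathcal T\\ -\mathcal D&I\end{bmatrix}$ is invertible in $\mathrm{TIC}_\infty(U\times Y)$ with $\begin{bmatrix}I&-\mathcal T\\ -\mathcal D&I\end{bmatrix}^{-1}\in\mathrm{TIC}(U\times Y)$, then $\mathcal D$ has a doubly coprime factorization.
   Context: $U,Y$ are complex Hilbert spaces of arbitrary dimension; $\mathrm{BL}$ = bounded linear operators. $L^2_\omega(\mathbb R;X)=\{f:e^{-\omega\cdot}f\in L^2(\mathbb R;X)\}$, $(\tau^tu)(s)=u(t+s)$, $\pi_+,\pi_-$ = multiplication by the characteristic functions of $[0,\infty)$, $(-\infty,0)$. $\mathrm{TIC}_\omega(U,Y)$ = all $\mathcal D\in\mathrm{BL}(L^2_\omega(\mathbb R;U),L^2_\omega(\mathbb R;Y))$ with $\tau^t\mathcal D=\mathcal D\tau^t$ ($t\in\mathbb R$) and $\pi_-\mathcal D\pi_+=0$; $\mathrm{TIC}=\mathrm{TIC}_0$; $\mathrm{TIC}_\infty=\bigcup_{\omega\in\mathbb R}\mathrm{TIC}_\omega$ (maps agreeing on common domains are identified). Equivalently (via transfer functions) $\mathrm{TIC}_\omega(U,Y)$ is isometrically isomorphic to the bounded holomorphic functions $\{\mathrm{Re}\,s>\omega\}\to\mathrm{BL}(U,Y)$. $\mathcal G\mathrm{TIC}$,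 $\mathcal G\mathrm{TIC}_\infty$ denote the elements having an inverse in the same class; $\mathrm{TIC}(U)=\mathrm{TIC}(U,U)$ etc. A doubly coprime factorization (d.c.f.) of $\mathcal D\in\mathrm{TIC}_\infty(U,Y)$: $\mathcal D=\mathcal N\mathcal M^{-1}=\tilde{\mathcal M}^{-1}\tilde{\mathcal N}$ where $\mathcal M\in\mathcal G\mathrm{TIC}_\infty(U)$ and $$\begin{bmatrix}\mathcal M&\mathcal Y\\ \mathcal N&\mathcal X\end{bmatrix}^{-1}=\begin{bmatrix}\tilde{\mathcal X}&-\tilde{\mathcal Y}\\ -\tilde{\mathcal N}&\tilde{\mathcal M}\end{bmatrix}\in\mathcal G\mathrm{TIC}(U\times Y)$$ for some $\mathcal Y,\mathcal X,\tilde{\mathcal Y},\tilde{\mathcal X}\in\mathrm{TIC}$. *)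

theory Defs
  imports "HOL-Analysis.Analysis"
begin

section \<open>Complex Hilbert spaces\<close>

text \<open>The real inner product of the underlying real Hilbert space is the real part of the complex
  one, so norm, topology and completeness are those of the library classes.\<close>

class scaleC =
  fixes scaleC :: "complex \<Rightarrow> 'a \<Rightarrow> 'a"  (infixr \<open>*\<^sub>C\<close> 75)

class complex_hilbert = scaleC + real_inner + banach +
  fixes cinner :: "'a \<Rightarrow> 'a \<Rightarrow> complex"
  assumes scaleC_add_right: "a *\<^sub>C (x + y) = a *\<^sub>C x + a *\<^sub>C y"
    and scaleC_add_left: "(a + b) *\<^sub>C x = a *\<^sub>C x + b *\<^sub>C x"
    and scaleC_scaleC: "a *\<^sub>C (b *\<^sub>C x) = (a * b) *\<^sub>C x"
    and scaleC_of_real: "complex_of_real r *\<^sub>C x = r *\<^sub>R x"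
    and cinner_add_left: "cinner (x + y) z = cinner x z + cinner y z"
    and cinner_scaleC_left: "cinner (a *\<^sub>C x) y = a * cinner x y"
    and cinner_commute: "cinner x y = cnj (cinner y x)"
    and Re_cinner: "Re (cinner x y) = inner x y"

instantiation prod :: (complex_hilbert, complex_hilbert) complex_hilbert
begin

definition scaleC_prod :: "complex \<Rightarrow> 'a \<times> 'b \<Rightarrow> 'a \<times> 'b" where
  "scaleC_prod a x = (a *\<^sub>C fst x, a *\<^sub>C snd x)"

definition cinner_prod :: "'a \<times> 'b \<Rightarrow> 'a \<times> 'b \<Rightarrow> complex" where
  "cinner_prod x y = cinner (fst x) (fst y) + cinner (snd x) (snd y)"

instance
proof
  fix a b :: complex and r :: real and x y z :: "'a \<times> 'b"
  show "a *\<^sub>C (x + y) = a *\<^sub>C x + a *\<^sub>C y"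
    by (simp add: scaleC_prod_def scaleC_add_right)
  show "(a + b) *\<^sub>C x = a *\<^sub>C x + b *\<^sub>C x"
    by (simp add: scaleC_prod_def scaleC_add_left)
  show "a *\<^sub>C (b *\<^sub>C x) = (a * b) *\<^sub>C x"
    by (simp add: scaleC_prod_def scaleC_scaleC)
  show "complex_of_real r *\<^sub>C x = r *\<^sub>R x"
    by (simp add: scaleC_prod_def scaleC_of_real prod_eq_iff)
  show "cinner (x + y) z = cinner x z + cinner y z"
    by (simp add: cinner_prod_def cinner_add_left)
  show "cinner (a *\<^sub>C x) y = a * cinner x y"
    by (simp add: cinner_prod_def scaleC_prod_def cinner_scaleC_left distrib_left)
  show "cinner x y = cnj (cinner y x)"
    using cinner_commute[of "fst x" "fst y"] cinner_commute[of "snd x" "snd y"]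
    by (simp add: cinner_prod_def)
  show "Re (cinner x y) = inner x y"
    by (simp add: cinner_prod_def Re_cinner inner_prod_def)
qed

end

section \<open>Functions on the real line modulo null sets\<close>

quotient_type 'a aefun = "real \<Rightarrow> 'a" / "\<lambda>f g. AE t in lebesgue. f t = g t"
proof (rule equivpI)
  show "reflp (\<lambda>f g :: real \<Rightarrow> 'a. AE t in lebesgue. f t = g t)"
    by (simp add: reflp_def)
  show "symp (\<lambda>f g :: real \<Rightarrow> 'a. AE t in lebesgue. f t = g t)"
    by (auto simp: symp_def elim: eventually_mono)
  show "transp (\<lambda>f g :: real \<Rightarrow> 'a. AE t in lebesgue. f t = g t)"
    by (rule transpI, erule (1) eventually_elim2, simp)
qed

lift_definition ae_map :: "('a \<Rightarrow> 'b) \<Rightarrow> 'a aefun \<Rightarrow> 'b aefun" is "\<lambda>h f t. h (f t)"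
  by (auto elim: eventually_mono)

lift_definition ae_pair :: "'a aefun \<Rightarrow> 'b aefun \<Rightarrow> ('a \<times> 'b) aefun" is "\<lambda>f g t. (f t, g t)"
  by (erule (1) eventually_elim2, simp)

instantiation aefun :: (ab_group_add) ab_group_add
begin

lift_definition zero_aefun :: "'a aefun" is "\<lambda>t. 0" .

lift_definition plus_aefun :: "'a aefun \<Rightarrow> 'a aefun \<Rightarrow> 'a aefun" is "\<lambda>f g t. f t + g t"
  by (erule (1) eventually_elim2, simp)

lift_definition uminus_aefun :: "'a aefun \<Rightarrow> 'a aefun" is "\<lambda>f t. - f t"
  by (auto elim: eventually_mono)

lift_definition minus_aefun :: "'a aefun \<Rightarrow> 'a aefun \<Rightarrow> 'a aefun" is "\<lambda>f g t. f t - g t"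
  by (erule (1) eventually_elim2, simp)

instance
  by standard (transfer; simp add: algebra_simps)+

end

instantiation aefun :: (scaleC) scaleC
begin

lift_definition scaleC_aefun :: "complex \<Rightarrow> 'a aefun \<Rightarrow> 'a aefun" is "\<lambda>c f t. c *\<^sub>C f t"
  by (auto elim: eventually_mono)

instance ..

end

lemma AE_lebesgue_translation:
  fixes t :: real
  assumes "AE s in lebesgue. P s"
  shows "AE s in lebesgue. P (t + s)"
proof -
  obtain N where N: "{s. \<not> P s} \<subseteq> N" "N \<in> null_sets lebesgue"
    using assms by (auto simp: eventually_ae_filter)
  have "negligible ((+) (- t) ` N)"
    using N(2) by (intro negligible_translation) (simp add: negligible_iff_null_sets)
  then have "(+) (- t) ` N \<in> null_sets lebesgue"
    by (simp add: negligible_iff_null_sets)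
  moreover have "{s. \<not> P (t + s)} \<subseteq> (+) (- t) ` N"
  proof
    fix s assume "s \<in> {s. \<not> P (t + s)}"
    then have "t + s \<in> N" using N(1) by auto
    then show "s \<in> (+) (- t) ` N" by (auto intro: image_eqI[where x = "t + s"])
  qed
  ultimately show ?thesis by (auto simp: eventually_ae_filter)
qed

lift_definition shift :: "real \<Rightarrow> 'a aefun \<Rightarrow> 'a aefun" is "\<lambda>t u s. u (t + s)"
  by (rule AE_lebesgue_translation)

lift_definition cut :: "real set \<Rightarrow> 'a::real_vector aefun \<Rightarrow> 'a aefun"
  is "\<lambda>S u s. indicator S s *\<^sub>R u s"
  by (auto elim: eventually_mono)

definition pi_plus :: "'a::real_vector aefun \<Rightarrow> 'a aefun" where
  "pi_plus = cut {0..}"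

definition pi_minus :: "'a::real_vector aefun \<Rightarrow> 'a aefun" where
  "pi_minus = cut {..<0}"

section \<open>Weighted square-integrable functions\<close>

text \<open>Bochner measurability, spelled out because the library's Bochner integral requires a
  second countable codomain, whereas the Hilbert spaces here may be nonseparable.\<close>

definition strongly_measurable :: "(real \<Rightarrow> 'a::topological_space) \<Rightarrow> bool" where
  "strongly_measurable f \<longleftrightarrow>
     (\<exists>s. (\<forall>n::nat. simple_function lebesgue (s n)) \<and>
          (AE t in lebesgue. (\<lambda>n. s n t) \<longlonglongrightarrow> f t))"

lemma strongly_measurable_cong_AE:
  assumes "AE t in lebesgue. f t = g t"
  shows "strongly_measurable f \<longleftrightarrow> strongly_measurable g"
proof -
  have "(AE t in lebesgue. (\<lambda>n. s n t) \<longlonglongrightarrow> f t) \<longleftrightarrow>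
        (AE t in lebesgue. (\<lambda>n. s n t) \<longlonglongrightarrow> g t)" for s :: "nat \<Rightarrow> real \<Rightarrow> 'a"
    by (rule eventually_subst) (use assms in \<open>auto elim: eventually_mono\<close>)
  then show ?thesis by (simp add: strongly_measurable_def)
qed

lemma nn_integral_norm_cong_AE:
  assumes "AE t in lebesgue. f t = g t"
  shows "(\<integral>\<^sup>+ t. ennreal ((norm (f t))\<^sup>2) \<partial>lebesgue) = (\<integral>\<^sup>+ t. ennreal ((norm (g t))\<^sup>2) \<partial>lebesgue)"
  by (rule nn_integral_cong_AE) (use assms in \<open>auto elim: eventually_mono\<close>)

lift_definition in_L2 :: "'a::real_normed_vector aefun \<Rightarrow> bool"
  is "\<lambda>f. strongly_measurable f \<and> (\<integral>\<^sup>+ t. ennreal ((norm (f t))\<^sup>2) \<partial>lebesgue) < \<infinity>"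
  subgoal for f g
    using strongly_measurable_cong_AE[of f g] nn_integral_norm_cong_AE[of f g] by simp
  done

lift_definition norm_L2 :: "'a::real_normed_vector aefun \<Rightarrow> real"
  is "\<lambda>f. sqrt (enn2real (\<integral>\<^sup>+ t. ennreal ((norm (f t))\<^sup>2) \<partial>lebesgue))"
  subgoal for f g
    using nn_integral_norm_cong_AE[of f g] by simp
  done

lift_definition weight :: "real \<Rightarrow> 'a::real_vector aefun \<Rightarrow> 'a aefun"
  is "\<lambda>\<omega> f t. exp (- \<omega> * t) *\<^sub>R f t"
  by (auto elim: eventually_mono)

definition L2w :: "real \<Rightarrow> 'a::real_normed_vector aefun set" where
  "L2w \<omega> = {f. in_L2 (weight \<omega> f)}"

definition norm_L2w :: "real \<Rightarrow> 'a::real_normed_vector aefun \<Rightarrow> real" where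
  "norm_L2w \<omega> f = norm_L2 (weight \<omega> f)"

section \<open>Time-invariant causal operators\<close>

text \<open>Operators on \<open>L2w \<omega>\<close> are given by total functions whose values outside \<open>L2w \<omega>\<close> are
  irrelevant; \<open>TIC_rel\<close> below disregards them.\<close>

definition BL_L2w ::
  "real \<Rightarrow> ('u::complex_hilbert aefun \<Rightarrow> 'y::complex_hilbert aefun) set" where
  "BL_L2w \<omega> = {D.
     (\<forall>f\<in>L2w \<omega>. D f \<in> L2w \<omega>) \<and>
     (\<forall>f\<in>L2w \<omega>. \<forall>g\<in>L2w \<omega>. D (f + g) = D f + D g) \<and>
     (\<forall>c. \<forall>f\<in>L2w \<omega>. D (c *\<^sub>C f) = c *\<^sub>C D f) \<and>
     (\<exists>K. \<forall>f\<in>L2w \<omega>. norm_L2w \<omega> (D f) \<le> K * norm_L2w \<omega> f)}"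

definition TIC_op ::
  "real \<Rightarrow> ('u::complex_hilbert aefun \<Rightarrow> 'y::complex_hilbert aefun) set" where
  "TIC_op \<omega> = {D \<in> BL_L2w \<omega>.
     (\<forall>t. \<forall>f\<in>L2w \<omega>. shift t (D f) = D (shift t f)) \<and>
     (\<forall>f\<in>L2w \<omega>. pi_minus (D (pi_plus f)) = 0)}"

text \<open>An element of \<open>TIC_inf\<close> is a class of pairs \<open>(\<omega>, D)\<close> with \<open>D\<close> in \<open>TIC_op \<omega>\<close>, where two such
  pairs are identified if the operators agree on their common domain.\<close>

type_synonym ('u, 'y) tic = "(real \<times> ('u aefun \<Rightarrow> 'y aefun)) set"

definition TIC_rel ::
  "((real \<times> ('u::complex_hilbert aefun \<Rightarrow> 'y::complex_hilbert aefun)) \<times>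
    (real \<times> ('u aefun \<Rightarrow> 'y aefun))) set" where
  "TIC_rel = {((\<omega>, D), (\<omega>', D')). D \<in> TIC_op \<omega> \<and> D' \<in> TIC_op \<omega>' \<and>
     (\<forall>f \<in> L2w \<omega> \<inter> L2w \<omega>'. D f = D' f)}"

definition TIC_inf :: "('u::complex_hilbert, 'y::complex_hilbert) tic set" where
  "TIC_inf = (SIGMA \<omega>:UNIV. TIC_op \<omega>) // TIC_rel"

definition TIC :: "real \<Rightarrow> ('u::complex_hilbert, 'y::complex_hilbert) tic set" where
  "TIC \<omega> = {A \<in> TIC_inf. \<exists>D. (\<omega>, D) \<in> A}"

text \<open>Any finitely many elements have representatives at a common \<open>\<omega>\<close> (every sufficiently large
  one), so the algebraic operations are performed there; the result is the union of the classes,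
  all equal, that the possible choices of such representatives give.\<close>

definition tic_one :: "('u::complex_hilbert, 'u) tic" where
  "tic_one = TIC_rel `` {(0, \<lambda>f. f)}"

definition tic_uminus ::
  "('u::complex_hilbert, 'y::complex_hilbert) tic \<Rightarrow> ('u, 'y) tic" where
  "tic_uminus A = (\<Union>(\<omega>, D)\<in>A. TIC_rel `` {(\<omega>, \<lambda>f. - D f)})"

definition tic_comp ::
  "('v::complex_hilbert, 'y::complex_hilbert) tic \<Rightarrow> ('u::complex_hilbert, 'v) tic \<Rightarrow> ('u, 'y) tic"
  (infixl \<open>\<odot>\<close> 70) where
  "A \<odot> B = \<Union>{TIC_rel `` {(\<omega>, \<lambda>f. D (E f))} | \<omega> D E. (\<omega>, D) \<in> A \<and> (\<omega>, E) \<in> B}"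

text \<open>\<open>tic_block A B C D\<close> is the block operator with rows \<open>A\<close>, \<open>B\<close> and \<open>C\<close>, \<open>D\<close>.\<close>

definition tic_block ::
  "('u::complex_hilbert, 'v::complex_hilbert) tic \<Rightarrow> ('y::complex_hilbert, 'v) tic \<Rightarrow>
   ('u, 'w::complex_hilbert) tic \<Rightarrow> ('y, 'w) tic \<Rightarrow> ('u \<times> 'y, 'v \<times> 'w) tic" where
  "tic_block A B C D = \<Union>{TIC_rel `` {(\<omega>, \<lambda>f.
       ae_pair (a (ae_map fst f) + b (ae_map snd f)) (c (ae_map fst f) + d (ae_map snd f)))} |
     \<omega> a b c d. (\<omega>, a) \<in> A \<and> (\<omega>, b) \<in> B \<and> (\<omega>, c) \<in> C \<and> (\<omega>, d) \<in> D}"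

definition is_tic_inverse ::
  "('u::complex_hilbert, 'y::complex_hilbert) tic \<Rightarrow> ('y, 'u) tic \<Rightarrow> bool" where
  "is_tic_inverse A B \<longleftrightarrow> A \<odot> B = tic_one \<and> B \<odot> A = tic_one"

definition GTIC_inf :: "('u::complex_hilbert, 'u) tic set" where
  "GTIC_inf = {A \<in> TIC_inf. \<exists>B \<in> TIC_inf. is_tic_inverse A B}"

definition GTIC :: "('u::complex_hilbert, 'u) tic set" where
  "GTIC = {A \<in> TIC 0. \<exists>B \<in> TIC 0. is_tic_inverse A B}"

definition tic_inv :: "('u::complex_hilbert, 'u) tic \<Rightarrow> ('u, 'u) tic" where
  "tic_inv A = (THE B. B \<in> TIC_inf \<and> is_tic_inverse A B)"

section \<open>Stabilizing controllers and doubly coprime factorizations\<close>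

definition stabilizing_controller ::
  "('u::complex_hilbert, 'y::complex_hilbert) tic \<Rightarrow> ('y, 'u) tic \<Rightarrow> bool" where
  "stabilizing_controller D T \<longleftrightarrow> T \<in> TIC_inf \<and>
     tic_block tic_one (tic_uminus T) (tic_uminus D) tic_one \<in> GTIC_inf \<and>
     tic_inv (tic_block tic_one (tic_uminus T) (tic_uminus D) tic_one) \<in> TIC 0"

text \<open>In the names below, a trailing \<open>t\<close> stands for a tilde.\<close>

definition has_dcf :: "('u::complex_hilbert, 'y::complex_hilbert) tic \<Rightarrow> bool" where
  "has_dcf D \<longleftrightarrow>
     (\<exists>(M :: ('u, 'u) tic) \<in> TIC 0. \<exists>(N :: ('u, 'y) tic) \<in> TIC 0.
      \<exists>(Y :: ('y, 'u) tic) \<in> TIC 0. \<exists>(X :: ('y, 'y) tic) \<in> TIC 0.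
      \<exists>(Mt :: ('y, 'y) tic) \<in> TIC 0. \<exists>(Nt :: ('u, 'y) tic) \<in> TIC 0.
      \<exists>(Yt :: ('y, 'u) tic) \<in> TIC 0. \<exists>(Xt :: ('u, 'u) tic) \<in> TIC 0.
        M \<in> GTIC_inf \<and> Mt \<in> GTIC_inf \<and>
        D = N \<odot> tic_inv M \<and> D = tic_inv Mt \<odot> Nt \<and>
        tic_block M Y N X \<in> GTIC \<and>
        tic_inv (tic_block M Y N X) = tic_block Xt (tic_uminus Yt) (tic_uminus Nt) Mt \<and>
        tic_block Xt (tic_uminus Yt) (tic_uminus Nt) Mt \<in> GTIC)"

end

theory Submission
  imports Defs
begin

text \<open>Write \<open>E v\<close> for the function \<open>exp (- lam t) v\<close> on \<open>[0, \<infinity>)\<close>. With \<open>D\<close> acting with the weight \<open>exp (- w t)\<close>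
  for some \<open>w\<close> in \<open>[0, lam)\<close>, the graph of \<open>D\<close> in the unweighted \<open>L\<^sup>2\<close> over \<open>[0, \<infinity>)\<close> is a closed subspace
  \<open>G\<close>, invariant under right translation. Let \<open>k v\<close> be the orthogonal projection of \<open>(E v, 0)\<close> onto \<open>G\<close>.
  Left translates of \<open>E v\<close> are multiples of \<open>E v\<close> on \<open>[0, \<infinity>)\<close>, whence
  \<open>\<langle>\<tau>\<^sup>t k u, \<tau>\<^sup>r k v\<rangle> = exp (- lam \<bar>t - r\<bar>) \<langle>k u, k v\<rangle>\<close>. This is the Gram matrix of the functions \<open>\<tau>\<^sup>t E v\<close>
  up to the form \<open>\<langle>k u, k v\<rangle>\<close>, so \<open>\<tau>\<^sup>t E v \<mapsto> \<tau>\<^sup>t k v\<close> extends to a bounded causal time-invariant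
  operator \<open>W = (M, N)\<close> with \<open>N = D M\<close>. The stable closed loop bounds \<open>k\<close>, hence \<open>W\<close>, from below, and
  \<open>W\<close> maps \<open>L\<^sup>2\<close> over \<open>[0, \<infinity>)\<close> onto \<open>G\<close>: the complement of its image in \<open>G\<close> is invariant under the
  resolvent of left translation, hence contains all left translates of a function supported in
  \<open>[0, \<infinity>)\<close>, which must vanish. Consequently every stable \<open>Q\<close> with \<open>D Q\<close> stable is \<open>M Q'\<close> with \<open>Q'\<close>
  stable.

  If \<open>[A, B; C, E]\<close> is the inverse of \<open>[I, - T; - D, I]\<close>, this yields \<open>A = M A2\<close> and \<open>B = M B2\<close>, and for
  the controller \<open>T\<close> in place of \<open>D\<close> similarly \<open>E = X E2\<close>, \<open>C = X C2\<close>. Then \<open>[M, T X; D M, X]\<close> and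
  \<open>[A2, - B2; - C2, E2]\<close> are stable and inverse to each other.\<close>

section \<open>Projections and contraction semigroups\<close>

text \<open>Pairing with \<open>E lam v\<close> evaluates a Laplace transform at the real point
  \<open>lam\<close>, so \<open>k v\<close> is the reproducing kernel at \<open>lam\<close> of the
  first components in \<open>G\<close>. Taking \<open>lam > w\<close> puts this point where the
  transfer function of \<open>D\<close> is known to be bounded; between the imaginary axis and
  \<open>Re s = w\<close> nothing is known about it. Up to an invertible constant operator,
  \<open>W\<close> is an inner function, normalised by its kernel at one point instead of by a
  wandering subspace. This makes \<open>U\<close> itself the input space, in every dimension, and
  the lower bound on \<open>k\<close> ensures that no direction of \<open>U\<close> is lost. The
  obstacle is surjectivity onto \<open>G\<close>, since left translation does not preserve
  \<open>G\<close>. For an element of \<open>G\<close> orthogonal to the image, the transform of the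
  first component vanishes at \<open>lam\<close>; division by \<open>lam - s\<close>, which is what
  the resolvent does, therefore keeps it analytic. Translations are then recovered from the
  resolvent by an implicit scheme. Finally, \<open>[M, T X; D M, X]\<close> is
  \<open>[I, T; D, I]\<close> times \<open>diag(M, X)\<close>, and \<open>[I, T; D, I]\<close> has
  the inverse \<open>[A, - B; - C, E]\<close> by a change of signs, so the two separate
  factorizations fit together.\<close>

lemma closed_subspace_projection:
  fixes S :: "'a::{real_inner,banach} set"
  assumes S: "subspace S" "closed S"
  shows "\<exists>p\<in>S. \<forall>s\<in>S. inner (x - p) s = 0"
proof -
  define d where "d = infdist x S"
  have ne: "S \<noteq> {}" using S(1) subspace_0 by auto
  have dle: "d \<le> norm (x - s)" if "s \<in> S" for s
    using infdist_le[OF that, of x] by (simp add: d_def dist_norm)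
  have d0: "d \<ge> 0" by (simp add: d_def infdist_nonneg)
  have "\<exists>s\<in>S. norm (x - s) < d + 1 / real (Suc n)" for n
  proof (rule ccontr)
    assume "\<not> ?thesis"
    then have "d + 1 / real (Suc n) \<le> dist x s" if "s \<in> S" for s
      using that by (auto simp: dist_norm not_less)
    then have "d + 1 / real (Suc n) \<le> d"
      unfolding d_def infdist_notempty[OF ne] using ne by (intro cINF_greatest) auto
    then show False by simp
  qed
  then obtain s where s: "\<And>n. s n \<in> S" "\<And>n. norm (x - s n) < d + 1 / real (Suc n)"
    by metis
  have lim: "(\<lambda>n. norm (x - s n)) \<longlonglongrightarrow> d"
  proof (rule tendsto_sandwich[of "\<lambda>_. d" _ _ "\<lambda>n. d + 1 / real (Suc n)"])
    show "(\<lambda>n. d + 1 / real (Suc n)) \<longlonglongrightarrow> d"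
      using tendsto_add[OF tendsto_const[of d] LIMSEQ_inverse_real_of_nat]
      by (simp add: inverse_eq_divide)
    show "\<forall>\<^sub>F n in sequentially. norm (x - s n) \<le> d + 1 / real (Suc n)"
      by (intro always_eventually allI less_imp_le s(2))
  qed (use s dle in auto)
  have par: "(norm (s m - s n))\<^sup>2 \<le> 2 * (norm (x - s m))\<^sup>2 + 2 * (norm (x - s n))\<^sup>2 - 4 * d\<^sup>2" for m n
  proof -
    have "(1/2) *\<^sub>R (s m + s n) \<in> S"
      using S(1) s(1) by (intro subspace_scale subspace_add)
    from dle[OF this] have "d\<^sup>2 \<le> (norm (x - (1/2) *\<^sub>R (s m + s n)))\<^sup>2"
      using d0 by (simp add: power_mono)
    moreover have "(norm (s m - s n))\<^sup>2 + 4 * (norm (x - (1/2) *\<^sub>R (s m + s n)))\<^sup>2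
       = 2 * (norm (x - s m))\<^sup>2 + 2 * (norm (x - s n))\<^sup>2"
      unfolding power2_norm_eq_inner
      by (simp add: inner_diff_left inner_diff_right inner_add_left inner_add_right inner_commute algebra_simps)
    ultimately show ?thesis by linarith
  qed
  have "Cauchy s"
  proof (rule CauchyI)
    fix e :: real assume "e > 0"
    have "(\<lambda>n. (norm (x - s n))\<^sup>2) \<longlonglongrightarrow> d\<^sup>2" by (intro tendsto_power lim)
    moreover have "e\<^sup>2 / 4 > 0" using \<open>e > 0\<close> by simp
    ultimately obtain N where N: "\<And>n. n \<ge> N \<Longrightarrow> \<bar>(norm (x - s n))\<^sup>2 - d\<^sup>2\<bar> < e\<^sup>2 / 4"
      unfolding LIMSEQ_iff real_norm_def by metis
    have "norm (s m - s n) < e" if "m \<ge> N" "n \<ge> N" for m n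
    proof -
      have "(norm (s m - s n))\<^sup>2 < e\<^sup>2"
        using par[of m n] N[OF that(1)] N[OF that(2)] by linarith
      then show ?thesis using \<open>e > 0\<close> by (simp add: power2_less_imp_less)
    qed
    then show "\<exists>M. \<forall>m\<ge>M. \<forall>n\<ge>M. norm (s m - s n) < e" by blast
  qed
  then obtain p where p: "s \<longlonglongrightarrow> p" using Cauchy_convergent convergent_def by blast
  have pS: "p \<in> S" using closed_sequentially[OF S(2)] s(1) p by blast
  have "(\<lambda>n. norm (x - s n)) \<longlonglongrightarrow> norm (x - p)" by (intro tendsto_intros p)
  then have nd: "norm (x - p) = d" using lim LIMSEQ_unique by blast
  have "inner (x - p) u = 0" if u: "u \<in> S" for u
  proof (cases "u = 0")
    case False
    \<comment> \<open>This \<open>t\<close> minimises the distance from \<open>x\<close> to the line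
      \<open>p + t *\<^sub>R u\<close>.\<close>
    define t where "t = inner (x - p) u / (norm u)\<^sup>2"
    have "p + t *\<^sub>R u \<in> S" using S(1) pS u by (intro subspace_scale subspace_add)
    from dle[OF this] have "d\<^sup>2 \<le> (norm (x - (p + t *\<^sub>R u)))\<^sup>2"
      using d0 by (simp add: power_mono)
    also have "\<dots> = (norm (x - p))\<^sup>2 - 2 * t * inner (x - p) u + t\<^sup>2 * (norm u)\<^sup>2"
      unfolding power2_norm_eq_inner
      by (simp add: inner_diff_left inner_diff_right inner_add_left inner_add_right inner_commute
        power2_eq_square algebra_simps)
    also have "\<dots> = d\<^sup>2 - (inner (x - p) u)\<^sup>2 / (norm u)\<^sup>2"
      using False nd by (simp add: t_def power2_eq_square field_simps)
    finally have "(inner (x - p) u)\<^sup>2 / (norm u)\<^sup>2 \<le> 0" by simp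
    then show ?thesis using False by (simp add: divide_le_0_iff)
  qed simp
  then show ?thesis using pS by blast
qed

lemma closure_sequentialI:
  fixes x :: "nat \<Rightarrow> 'a::first_countable_topology"
  shows "(\<And>n. x n \<in> S) \<Longrightarrow> x \<longlonglongrightarrow> l \<Longrightarrow> l \<in> closure S"
  by (metis closed_closure closed_sequentially closure_subset subsetD)

lemma closure_sequentialE:
  fixes l :: "'a::real_normed_vector"
  assumes "l \<in> closure S"
  obtains x where "\<And>n. x n \<in> S" "x \<longlonglongrightarrow> l"
  using assms unfolding closure_sequential by auto

lemma subspace_closure:
  fixes S :: "'a::real_normed_vector set"
  assumes S: "subspace S"
  shows "subspace (closure S)"
proof (rule subspaceI)
  show "0 \<in> closure S" using subspace_0[OF S] closure_subset by blast
next
  fix a b assume "a \<in> closure S" "b \<in> closure S"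
  then obtain x y where x: "\<And>n. x n \<in> S" "x \<longlonglongrightarrow> a" and y: "\<And>n. y n \<in> S" "y \<longlonglongrightarrow> b"
    by (auto elim!: closure_sequentialE)
  show "a + b \<in> closure S"
    by (rule closure_sequentialI[OF subspace_add[OF S x(1) y(1)] tendsto_add[OF x(2) y(2)]])
next
  fix c and a assume "a \<in> closure S"
  then obtain x where x: "\<And>n. x n \<in> S" "x \<longlonglongrightarrow> a"
    by (auto elim!: closure_sequentialE)
  show "c *\<^sub>R a \<in> closure S"
    by (rule closure_sequentialI[OF subspace_scale[OF S x(1)] tendsto_scaleR[OF tendsto_const x(2)]])
qed

lemma subspace_dense_if_orthogonal_trivial:
  fixes S :: "'a::{real_inner,banach} set"
  assumes S: "subspace S" and triv: "\<And>x. (\<And>s. s \<in> S \<Longrightarrow> inner x s = 0) \<Longrightarrow> x = 0"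
  shows "closure S = UNIV"
proof -
  have "x \<in> closure S" for x
  proof -
    obtain p where p: "p \<in> closure S" "\<forall>s\<in>closure S. inner (x - p) s = 0"
      using closed_subspace_projection[OF subspace_closure[OF S] closed_closure] by blast
    have "x - p = 0"
      by (rule triv) (use p(2) closure_subset in blast)
    then show ?thesis using p(1) by simp
  qed
  then show ?thesis by blast
qed

lemma bounded_linear_eqI_dense:
  assumes f: "bounded_linear f" and g: "bounded_linear g"
    and D: "closure (span B) = UNIV" and eq: "\<And>x. x \<in> B \<Longrightarrow> f x = g x"
  shows "f x = g x"
proof -
  have lin: "linear f" "linear g" using f g bounded_linear.linear by auto
  have "f y = g y" if "y \<in> span B" for y
    by (rule linear_eq_on_span[OF lin eq that])
  moreover have "closed {y. f y = g y}"
    by (intro closed_Collect_eq) (use f g linear_continuous_on in blast)+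
  ultimately have "closure (span B) \<subseteq> {y. f y = g y}"
    by (intro closure_minimal) auto
  then show ?thesis using D by auto
qed

text \<open>Operators will be prescribed on families that span a dense subspace and may be linearly
  dependent. Starting from a linear relation, the norm bound alone makes it single-valued, and its
  closure is the graph of the extension.\<close>

lemma bounded_linear_relation_extension:
  fixes R :: "('a::real_normed_vector \<times> 'b::banach) set"
  assumes R: "subspace R" and bd: "\<And>x y. (x, y) \<in> R \<Longrightarrow> norm y \<le> K * norm x"
    and D: "closure (fst ` R) = UNIV"
  shows "\<exists>f. bounded_linear f \<and> (\<forall>x y. (x, y) \<in> R \<longrightarrow> f x = y)"
proof -
  let ?C = "closure R"
  have sC: "subspace ?C" using R by (rule subspace_closure)
  have bdC: "norm y \<le> K * norm x" if "(x, y) \<in> ?C" for x y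
  proof -
    have "closed {z::'a\<times>'b. norm (snd z) \<le> K * norm (fst z)}"
      by (intro closed_Collect_le continuous_intros)
    moreover have "R \<subseteq> {z. norm (snd z) \<le> K * norm (fst z)}" using bd by auto
    ultimately have "?C \<subseteq> {z. norm (snd z) \<le> K * norm (fst z)}" by (rule closure_minimal[rotated])
    then show ?thesis using that by auto
  qed
  have ex: "\<exists>y. (x, y) \<in> ?C" for x
  proof -
    have "x \<in> closure (fst ` R)" using D by simp
    then obtain a where a: "\<And>n. a n \<in> fst ` R" "a \<longlonglongrightarrow> x"
      using closure_sequentialE by blast
    then have "\<forall>n. \<exists>y. (a n, y) \<in> R" by force
    then obtain b where b: "\<And>n. (a n, b n) \<in> R" by metis
    have diff: "norm (b m - b n) \<le> K * norm (a m - a n)" for m n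
      using bd[of "a m - a n" "b m - b n"] subspace_diff[OF R b[of m] b[of n]] by simp
    have "Cauchy b"
    proof (rule CauchyI)
      fix e :: real assume e: "e > 0"
      have "Cauchy a" using a(2) LIMSEQ_imp_Cauchy by blast
      then obtain M where M: "\<And>m n. m \<ge> M \<Longrightarrow> n \<ge> M \<Longrightarrow> norm (a m - a n) < e / (\<bar>K\<bar> + 1)"
        using CauchyD[of a "e / (\<bar>K\<bar> + 1)"] e
        by (metis add_pos_nonneg add.commute abs_ge_zero divide_pos_pos zero_less_one)
      have "norm (b m - b n) < e" if "m \<ge> M" "n \<ge> M" for m n
      proof -
        have "norm (b m - b n) \<le> K * norm (a m - a n)" by (rule diff)
        also have "\<dots> \<le> (\<bar>K\<bar> + 1) * norm (a m - a n)" by (intro mult_right_mono) auto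
        also have "\<dots> < (\<bar>K\<bar> + 1) * (e / (\<bar>K\<bar> + 1))"
          using M[OF that] by (intro mult_strict_left_mono) auto
        also have "\<dots> = e" by (simp add: field_simps add_nonneg_eq_0_iff)
        finally show ?thesis .
      qed
      then show "\<exists>M. \<forall>m\<ge>M. \<forall>n\<ge>M. norm (b m - b n) < e" by blast
    qed
    then obtain y where "b \<longlonglongrightarrow> y" using Cauchy_convergent convergent_def by blast
    with a(2) have "(\<lambda>n. (a n, b n)) \<longlonglongrightarrow> (x, y)" by (rule tendsto_Pair)
    with b have "(x, y) \<in> ?C" by (rule closure_sequentialI)
    then show ?thesis ..
  qed
  have un: "y = y'" if "(x, y) \<in> ?C" "(x, y') \<in> ?C" for x y y'
    using bdC[of 0 "y - y'"] subspace_diff[OF sC that] by simp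
  obtain f where f: "\<And>x. (x, f x) \<in> ?C" using ex by metis
  have "bounded_linear f"
  proof (rule bounded_linear_intro[where K = K])
    show "f (x + y) = f x + f y" for x y
      using subspace_add[OF sC f[of x] f[of y]] f[of "x + y"] un by simp
    show "f (r *\<^sub>R x) = r *\<^sub>R f x" for r x
      using subspace_scale[OF sC f[of x], of r] f[of "r *\<^sub>R x"] un by simp
    show "norm (f x) \<le> norm x * K" for x
      using bdC[OF f[of x]] by (simp add: mult.commute)
  qed
  moreover have "f x = y" if "(x, y) \<in> R" for x y
    using that closure_subset un[OF f] by blast
  ultimately show ?thesis by blast
qed

section \<open>Decaying semigroups, their resolvents and Taylor expansions of orbits\<close>

locale contraction_semigroup =
  fixes U :: "real \<Rightarrow> 'a::banach \<Rightarrow> 'a" and lam :: real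
  assumes lam_pos: "lam > 0"
    and bounded_linear_U: "bounded_linear (U t)"
    and U_0: "U 0 x = x"
    and U_add: "0 \<le> s \<Longrightarrow> 0 \<le> t \<Longrightarrow> U (s + t) x = U s (U t x)"
    and norm_U_le: "0 \<le> t \<Longrightarrow> norm (U t x) \<le> exp (- lam * t) * norm x"
    and continuous_on_U: "continuous_on {0..} (\<lambda>t. U t x)"
begin

definition J :: "real \<Rightarrow> 'a \<Rightarrow> 'a" where "J T x = integral {0..T} (\<lambda>r. U r x)"

text \<open>The integral of \<open>U r x\<close> over all \<open>r \<ge> 0\<close>, that is, minus
  the inverse of the generator. The factor \<open>exp (- lam * r)\<close> of a Laplace integral is
  already part of \<open>U\<close>.\<close>

definition resolvent :: "'a \<Rightarrow> 'a" where "resolvent x = lim (\<lambda>n. J (real n) x)"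

lemma norm_U_le_norm: "0 \<le> t \<Longrightarrow> norm (U t x) \<le> norm x"
  using norm_U_le[of t x] mult_right_mono[of "exp (- lam * t)" 1 "norm x"] lam_pos by auto

lemma U_integrable: "0 \<le> a \<Longrightarrow> (\<lambda>r. U r x) integrable_on {a..b}"
  by (intro integrable_continuous_real continuous_on_subset[OF continuous_on_U]) auto

lemma U_scaleR: "U t (c *\<^sub>R x) = c *\<^sub>R U t x"
  using bounded_linear.linear[OF bounded_linear_U] linear_scale by blast

lemma J_bounded_linear_image:
  assumes "bounded_linear Q"
  shows "Q (J T x) = integral {0..T} (\<lambda>r. Q (U r x))"
  using integral_linear[OF U_integrable assms, of 0 T x] by (simp add: J_def o_def)

lemma J_add: "J T (x + y) = J T x + J T y"
  by (simp add: J_def linear_add[OF bounded_linear.linear[OF bounded_linear_U]] integral_add U_integrable)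

lemma J_scaleR: "J T (c *\<^sub>R x) = c *\<^sub>R J T x"
  by (simp add: J_def U_scaleR)

lemma norm_J_le: "0 \<le> T \<Longrightarrow> norm (J T x) \<le> T * norm x"
  using integral_bound[of 0 T "\<lambda>r. U r x" "norm x"] norm_U_le_norm
    continuous_on_subset[OF continuous_on_U, of "{0..T}" x]
  by (auto simp: J_def mult.commute)

lemma U_J:
  assumes "0 \<le> h" "0 \<le> T"
  shows "U h (J T x) = J (T + h) x - J h x"
proof -
  have "U h (J T x) = integral {0..T} (\<lambda>r. U h (U r x))"
    by (rule J_bounded_linear_image[OF bounded_linear_U])
  also have "\<dots> = integral {0..T} (\<lambda>r. U (r + h) x)"
    by (rule integral_cong) (use assms in \<open>auto simp: U_add add.commute[of _ h]\<close>)
  also have "\<dots> = integral {h..T + h} (\<lambda>r. U r x)"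
    using integral_shift_real_ivl[of h h "T + h" "\<lambda>r. U r x"]  by simp
  also have "\<dots> = J (T + h) x - J h x"
    using Henstock_Kurzweil_Integration.integral_combine[of 0 h "T + h" "\<lambda>r. U r x"] assms U_integrable[of 0 x "T + h"]
    by (simp add: J_def algebra_simps)
  finally show ?thesis .
qed

text \<open>Unit intervals reduce convergence of the improper integral to that of a geometric series
  with ratio \<open>exp (- lam)\<close>.\<close>

lemma J_nat: "J (real n) x = (\<Sum>k<n. U (real k) (J 1 x))"
proof (induction n)
  case (Suc n)
  have "J (real (Suc n)) x = J (1 + real n) x" by (simp add: add.commute)
  also have "\<dots> = U n (J 1 x) + J n x" using U_J[of n 1 x] by simp
  finally show ?case using Suc by simp
qed (simp add: J_def)

lemma norm_U_J1: "norm (U (real k) (J 1 x)) \<le> norm x * exp (- lam) ^ k"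
proof -
  have "norm (U (real k) (J 1 x)) \<le> exp (- lam * k) * norm (J 1 x)" by (rule norm_U_le) simp
  also have "\<dots> \<le> exp (- lam * k) * norm x" using norm_J_le[of 1 x] by simp
  also have "\<dots> = norm x * exp (- lam) ^ k" by (simp add: exp_of_nat_mult[symmetric] mult.commute)
  finally show ?thesis .
qed

lemma summable_geom: "summable (\<lambda>k. norm x * exp (- lam) ^ k)"
  using lam_pos by (intro summable_mult summable_geometric) simp

lemma J_sums: "(\<lambda>k. U (real k) (J 1 x)) sums resolvent x" "(\<lambda>n. J (real n) x) \<longlonglongrightarrow> resolvent x"
proof -
  have "summable (\<lambda>k. U (real k) (J 1 x))"
    by (rule summable_comparison_test'[OF summable_geom norm_U_J1])
  then obtain s where s: "(\<lambda>k. U (real k) (J 1 x)) sums s" by blast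
  then have "(\<lambda>n. J (real n) x) \<longlonglongrightarrow> s" by (simp add: sums_def J_nat)
  moreover from this have "resolvent x = s" by (simp add: resolvent_def limI)
  ultimately show "(\<lambda>k. U (real k) (J 1 x)) sums resolvent x" "(\<lambda>n. J (real n) x) \<longlonglongrightarrow> resolvent x"
    using s by auto
qed

lemma bounded_linear_resolvent: "bounded_linear resolvent"
proof (rule bounded_linear_intro[where K = "(\<Sum>k. exp (- lam) ^ k)"])
  show "resolvent (x + y) = resolvent x + resolvent y" for x y
    using LIMSEQ_unique[OF J_sums(2)[of "x + y"]] tendsto_add[OF J_sums(2)[of x] J_sums(2)[of y]]
    by (simp add: J_add)
  show "resolvent (r *\<^sub>R x) = r *\<^sub>R resolvent x" for r x
    using LIMSEQ_unique[OF J_sums(2)[of "r *\<^sub>R x"]] tendsto_scaleR[OF tendsto_const J_sums(2)[of x]]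
    by (simp add: J_scaleR)
  fix x
  have "norm (resolvent x) = norm (\<Sum>k. U (real k) (J 1 x))" using J_sums(1) sums_unique by metis
  also have "\<dots> \<le> (\<Sum>k. norm x * exp (- lam) ^ k)"
    by (rule norm_suminf_le[OF norm_U_J1 summable_geom])
  also have "\<dots> = norm x * (\<Sum>k. exp (- lam) ^ k)"
    by (rule suminf_mult) (use lam_pos in \<open>simp add: summable_geometric\<close>)
  finally show "norm (resolvent x) \<le> norm x * (\<Sum>k. exp (- lam) ^ k)" .
qed

text \<open>Integrated form of the fact that the orbit of \<open>resolvent x\<close> has derivative
  \<open>- U h x\<close>.\<close>

lemma U_resolvent:
  assumes h: "0 \<le> h"
  shows "U h (resolvent x) = resolvent x - J h x"
proof -
  have "(\<lambda>n. J (real n + h) x - J (real n) x) \<longlonglongrightarrow> 0"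
  proof (rule Lim_null_comparison)
    have "norm (J (real n + h) x - J (real n) x) \<le> h * norm x * exp (- lam) ^ n" for n
    proof -
      have "J (real n + h) x - J (real n) x = U n (J h x)"
        using U_J[of n h x] h by (simp add: add.commute)
      also have "norm \<dots> \<le> exp (- lam * n) * norm (J h x)"
        using norm_U_le[of "real n" "J h x"] by simp
      also have "\<dots> \<le> exp (- lam * n) * (h * norm x)" using norm_J_le[OF h, of x] by simp
      finally show ?thesis by (simp add: exp_of_nat_mult[symmetric] mult.commute)
    qed
    then show "\<forall>\<^sub>F n in sequentially. norm (J (real n + h) x - J (real n) x) \<le> h * norm x * exp (- lam) ^ n"
      by simp
    show "(\<lambda>n. h * norm x * exp (- lam) ^ n) \<longlonglongrightarrow> 0"
      using lam_pos by (intro tendsto_mult_right_zero LIMSEQ_power_zero) simp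
  qed
  from tendsto_add[OF this J_sums(2)[of x]]
  have 1: "(\<lambda>n. J (real n + h) x) \<longlonglongrightarrow> resolvent x" by simp
  have "(\<lambda>n. U h (J (real n) x)) \<longlonglongrightarrow> U h (resolvent x)"
    by (rule bounded_linear.tendsto[OF bounded_linear_U J_sums(2)])
  then have "(\<lambda>n. J (real n + h) x - J h x) \<longlonglongrightarrow> U h (resolvent x)"
    by (simp add: U_J h)
  moreover have "(\<lambda>n. J (real n + h) x - J h x) \<longlonglongrightarrow> resolvent x - J h x"
    by (intro tendsto_intros 1)
  ultimately show ?thesis by (rule LIMSEQ_unique)
qed

lemma bounded_linear_resolvent_eq_0:
  assumes Q: "bounded_linear Q" and z: "\<And>r. 0 \<le> r \<Longrightarrow> Q (U r x) = 0"
  shows "Q (resolvent x) = 0"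
proof -
  have "Q (J (real n) x) = integral {0..real n} (\<lambda>r. 0)" for n
    unfolding J_bounded_linear_image[OF Q] by (rule integral_cong) (use z in auto)
  then have "Q (J (real n) x) = 0" for n by simp
  moreover have "(\<lambda>n. Q (J (real n) x)) \<longlonglongrightarrow> Q (resolvent x)"
    by (rule bounded_linear.tendsto[OF Q J_sums(2)])
  ultimately show ?thesis by (simp add: LIMSEQ_const_iff)
qed

lemma resolvent_commute:
  assumes V: "contraction_semigroup V mu" and Q: "bounded_linear Q"
    and QU: "\<And>r. 0 \<le> r \<Longrightarrow> Q (U r x) = V r (Q x)"
  shows "Q (resolvent x) = contraction_semigroup.resolvent V (Q x)"
proof -
  interpret V: contraction_semigroup V mu by (rule V)
  have "Q (J (real n) x) = V.J (real n) (Q x)" for n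
    unfolding J_bounded_linear_image[OF Q] V.J_def by (rule integral_cong) (use QU in auto)
  moreover have "(\<lambda>n. Q (J (real n) x)) \<longlonglongrightarrow> Q (resolvent x)"
    by (rule bounded_linear.tendsto[OF Q J_sums(2)])
  ultimately show ?thesis using V.J_sums(2)[of "Q x"] LIMSEQ_unique by auto
qed

lemma norm_U_resolvent_diff:
  assumes "0 \<le> h" shows "norm (U h (resolvent x) - resolvent x) \<le> h * norm x"
  using U_resolvent[OF assms, of x] norm_J_le[OF assms, of x] by simp

text \<open>A second-order Taylor remainder: applying \<open>resolvent\<close> twice makes the orbit
  twice differentiable, and its derivative at 0 is \<open>- resolvent x\<close>.\<close>

lemma norm_U_resolvent2_diff:
  assumes h: "0 \<le> h"
  shows "norm (U h (resolvent (resolvent x)) - (resolvent (resolvent x) - h *\<^sub>R resolvent x)) \<le> h\<^sup>2 * norm x"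
proof -
  let ?y = "resolvent x"
  have "U h (resolvent ?y) - (resolvent ?y - h *\<^sub>R ?y) = h *\<^sub>R ?y - J h ?y"
    using U_resolvent[OF h, of ?y] by simp
  also have "\<dots> = integral {0..h} (\<lambda>r. ?y - U r ?y)"
    using h Henstock_Kurzweil_Integration.integral_diff[of "\<lambda>_. ?y" "{0..h}" "\<lambda>r. U r ?y"]
      by (simp add: J_def U_integrable integrable_const_ivl)
  finally have eq: "U h (resolvent ?y) - (resolvent ?y - h *\<^sub>R ?y) = integral {0..h} (\<lambda>r. ?y - U r ?y)" .
  have "norm (integral {0..h} (\<lambda>r. ?y - U r ?y)) \<le> (h * norm x) * (h - 0)"
  proof (rule integral_bound[OF h])
    show "continuous_on {0..h} (\<lambda>r. ?y - U r ?y)"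
      by (intro continuous_intros continuous_on_subset[OF continuous_on_U]) auto
    fix r assume r: "r \<in> {0..h}"
    have "norm (?y - U r ?y) \<le> r * norm x"
      using norm_U_resolvent_diff[of r x] r by (simp add: norm_minus_commute)
    also have "\<dots> \<le> h * norm x" using r by (intro mult_right_mono) auto
    finally show "norm (?y - U r ?y) \<le> h * norm x" .
  qed
  then show ?thesis using eq by (simp add: power2_eq_square mult_ac)
qed

text \<open>If \<open>resolvent x\<close> vanishes then so does every \<open>J h x\<close>, whose
  derivative at \<open>h = 0\<close> is \<open>x\<close>.\<close>

lemma resolvent_inj:
  assumes "resolvent x = 0" shows "x = 0"
proof -
  have J0: "J h x = 0" if "0 \<le> h" for h
    using U_resolvent[OF that, of x] assms linear_0[OF bounded_linear.linear[OF bounded_linear_U]] by simp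
  have "((\<lambda>h. integral {0..h} (\<lambda>r. U r x)) has_vector_derivative U 0 x) (at 0 within {0..1})"
    by (rule integral_has_vector_derivative) (use continuous_on_subset[OF continuous_on_U] in auto)
  then have "((\<lambda>h. 0) has_vector_derivative x) (at 0 within {0..1})"
    unfolding U_0 by (rule has_vector_derivative_transform[rotated 2]) (use J0 in \<open>auto simp: J_def\<close>)
  moreover have "((\<lambda>h::real. 0::'a) has_vector_derivative 0) (at 0 within {0..1})"
    by (rule has_vector_derivative_const)
  ultimately show ?thesis
    using vector_derivative_unique_within_closed_interval[of 0 1 0 "\<lambda>_. 0" x 0] by simp
qed

end

text \<open>An implicit scheme: with \<open>P\<close> the orthogonal projection onto \<open>S\<close>, the elements
  \<open>R\<^sup>2 (P U h)\<^sup>n x\<close> of \<open>S\<close> approximate \<open>U (n h) R\<^sup>2 x\<close> with local error of order \<open>h\<^sup>2\<close>.\<close>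

lemma (in contraction_semigroup) U_resolvent2_mem:
  fixes S and P :: "'a \<Rightarrow> 'a"
  assumes S: "closed S" "subspace S"
    and P: "\<And>x. P x \<in> S" "\<And>x. norm (P x) \<le> norm x"
    and Pmin: "\<And>x s. s \<in> S \<Longrightarrow> norm (x - P x) \<le> norm (x - s)"
    and RS: "\<And>x. x \<in> S \<Longrightarrow> resolvent x \<in> S"
    and PR: "\<And>x. P (resolvent x) = resolvent (P x)"
    and x: "x \<in> S" and t: "0 \<le> t"
  shows "U t (resolvent (resolvent x)) \<in> S"
proof -
  have com: "resolvent (U h y) = U h (resolvent y)" if "0 \<le> h" for h y
    by (rule resolvent_commute[symmetric, OF contraction_semigroup_axioms bounded_linear_U])
      (use that in \<open>simp add: U_add[symmetric] add.commute\<close>)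
  let ?R2 = "\<lambda>x. resolvent (resolvent x)"
  have lin: "linear (U s)" for s by (rule bounded_linear.linear[OF bounded_linear_U])
  \<comment> \<open>Each step ends with \<open>P\<close>, so the scheme cannot leave
    \<open>S\<close>; the smoothing by \<open>?R2\<close> is postponed and commutes with the
    step.\<close>
  define xs where "xs h n = ((\<lambda>y. P (U h y)) ^^ n) x" for h n
  have xsS: "xs h n \<in> S" for h n by (cases n) (auto simp: xs_def x P)
  have xsb: "norm (xs h n) \<le> norm x" if "0 \<le> h" for h n
  proof (induction n)
    case (Suc n)
    have "norm (xs h (Suc n)) \<le> norm (U h (xs h n))" by (simp add: xs_def P)
    also have "\<dots> \<le> norm (xs h n)" using that by (rule norm_U_le_norm)
    finally show ?case using Suc by simp
  qed (simp add: xs_def)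
  have err: "norm (U (real n * h) (?R2 x) - ?R2 (xs h n)) \<le> n * (h\<^sup>2 * norm x)" if h: "0 \<le> h" for h n
  proof (induction n)
    case 0 then show ?case by (simp add: xs_def U_0)
  next
    case (Suc n)
    have R2S: "?R2 (xs h (Suc n)) = P (U h (?R2 (xs h n)))"
      by (simp add: xs_def PR[symmetric] com h)
    \<comment> \<open>The Euler step \<open>?R2 (xs h n) - h *\<^sub>R resolvent (xs h n)\<close>
      lies in \<open>S\<close>, so the projection of \<open>U h (?R2 (xs h n))\<close> onto
      \<open>S\<close> is at least as close as it.\<close>
    have "norm (U h (?R2 (xs h n)) - P (U h (?R2 (xs h n))))
        \<le> norm (U h (?R2 (xs h n)) - (?R2 (xs h n) - h *\<^sub>R resolvent (xs h n)))"
      by (intro Pmin subspace_diff subspace_scale S RS xsS)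
    also have "\<dots> \<le> h\<^sup>2 * norm (xs h n)" by (rule norm_U_resolvent2_diff[OF h])
    also have "\<dots> \<le> h\<^sup>2 * norm x" using xsb[OF h] by (intro mult_left_mono) auto
    finally have 1: "norm (U h (?R2 (xs h n)) - ?R2 (xs h (Suc n))) \<le> h\<^sup>2 * norm x"
      by (simp add: R2S)
    have "U (real (Suc n) * h) (?R2 x) = U h (U (real n * h) (?R2 x))"
      using U_add[of h "real n * h"] h by (simp add: algebra_simps)
    then have "U (real (Suc n) * h) (?R2 x) - U h (?R2 (xs h n)) = U h (U (real n * h) (?R2 x) - ?R2 (xs h n))"
      by (simp add: linear_diff[OF lin])
    then have "norm (U (real (Suc n) * h) (?R2 x) - U h (?R2 (xs h n))) \<le> n * (h\<^sup>2 * norm x)"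
      using norm_U_le_norm[OF h] Suc order_trans by metis
    with 1 have "norm ((U (real (Suc n) * h) (?R2 x) - U h (?R2 (xs h n))) + (U h (?R2 (xs h n)) - ?R2 (xs h (Suc n))))
       \<le> n * (h\<^sup>2 * norm x) + h\<^sup>2 * norm x"
      by (intro norm_triangle_le) linarith
    then show ?case by (simp add: algebra_simps)
  qed
  \<comment> \<open>\<open>Suc n\<close> steps of length \<open>t / Suc n\<close>, each with an
    error of order \<open>(t / Suc n)^2\<close>, add up to an error of order
    \<open>1 / Suc n\<close>.\<close>
  have "(\<lambda>n. ?R2 (xs (t / Suc n) (Suc n))) \<longlonglongrightarrow> U t (?R2 x)"
  proof (rule Lim_transform[OF tendsto_const], rule Lim_null_comparison)
    have "norm (?R2 (xs (t / Suc n) (Suc n)) - U t (?R2 x)) \<le> t\<^sup>2 * norm x * (1 / Suc n)" for n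
    proof -
      have "norm (U t (?R2 x) - ?R2 (xs (t / Suc n) (Suc n))) \<le> Suc n * ((t / Suc n)\<^sup>2 * norm x)"
        using err[of "t / Suc n" "Suc n"] t by (simp add: norm_minus_commute)
      also have "\<dots> = t\<^sup>2 * norm x * (1 / Suc n)"
        by (simp add: power2_eq_square field_simps del: of_nat_Suc)
      finally show ?thesis by (simp add: norm_minus_commute)
    qed
    then show "\<forall>\<^sub>F n in sequentially. norm (?R2 (xs (t / Suc n) (Suc n)) - U t (?R2 x)) \<le> t\<^sup>2 * norm x * (1 / Suc n)"
      by simp
    show "(\<lambda>n. t\<^sup>2 * norm x * (1 / Suc n)) \<longlonglongrightarrow> 0"
      using LIMSEQ_inverse_real_of_nat by (intro tendsto_mult_right_zero) (simp add: inverse_eq_divide)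
  qed
  with RS[OF RS[OF xsS]] show ?thesis by (rule closed_sequentially[OF S(1)])
qed

section \<open>The Hilbert space of square-integrable functions\<close>

lemma strongly_measurable_compose:
  assumes "continuous_on UNIV h" "strongly_measurable f"
  shows "strongly_measurable (\<lambda>t. h (f t))"
proof -
  obtain s where s: "\<And>n::nat. simple_function lebesgue (s n)" "AE t in lebesgue. (\<lambda>n. s n t) \<longlonglongrightarrow> f t"
    using assms(2) by (auto simp: strongly_measurable_def)
  have "AE t in lebesgue. (\<lambda>n. h (s n t)) \<longlonglongrightarrow> h (f t)"
    using s(2) by eventually_elim (rule continuous_on_tendsto_compose[OF assms(1)], auto)
  then show ?thesis
    using simple_function_compose1[OF s(1), of h]
    unfolding strongly_measurable_def by (intro exI[of _ "\<lambda>n t. h (s n t)"]) simp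
qed

lemma strongly_measurable_Pair:
  assumes "strongly_measurable f" "strongly_measurable g"
  shows "strongly_measurable (\<lambda>t. (f t, g t))"
proof -
  obtain s where s: "\<And>n::nat. simple_function lebesgue (s n)" "AE t in lebesgue. (\<lambda>n. s n t) \<longlonglongrightarrow> f t"
    using assms(1) by (auto simp: strongly_measurable_def)
  obtain r where r: "\<And>n::nat. simple_function lebesgue (r n)" "AE t in lebesgue. (\<lambda>n. r n t) \<longlonglongrightarrow> g t"
    using assms(2) by (auto simp: strongly_measurable_def)
  have "AE t in lebesgue. (\<lambda>n. (s n t, r n t)) \<longlonglongrightarrow> (f t, g t)"
    using s(2) r(2) by eventually_elim (rule tendsto_Pair)
  moreover have "simple_function lebesgue (\<lambda>t. (s n t, r n t))" for n
    by (rule simple_function_compose2[OF s(1) r(1)])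
  ultimately show ?thesis
    unfolding strongly_measurable_def by (intro exI[of _ "\<lambda>n t. (s n t, r n t)"]) simp
qed

lemma strongly_measurable_compose2:
  assumes "continuous_on UNIV (\<lambda>(x, y). h x y)" "strongly_measurable f" "strongly_measurable g"
  shows "strongly_measurable (\<lambda>t. h (f t) (g t))"
  using strongly_measurable_compose[OF assms(1) strongly_measurable_Pair[OF assms(2,3)]] by simp

lemma strongly_measurable_simple: "simple_function lebesgue s \<Longrightarrow> strongly_measurable s"
  unfolding strongly_measurable_def by (intro exI[of _ "\<lambda>_. s"]) simp

lemma strongly_measurable_const: "strongly_measurable (\<lambda>t. c)"
  by (rule strongly_measurable_simple) simp

text \<open>Through this equivalence, norms and inner products of strongly measurable functions
  enter ordinary Lebesgue integration even when the values lie in a nonseparable space.\<close>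

lemma strongly_measurable_real:
  fixes f :: "real \<Rightarrow> real"
  shows "strongly_measurable f \<longleftrightarrow> f \<in> borel_measurable lebesgue"
proof
  assume "strongly_measurable f"
  then obtain s where s: "\<And>n::nat. simple_function lebesgue (s n)" "AE t in lebesgue. (\<lambda>n. s n t) \<longlonglongrightarrow> f t"
    by (auto simp: strongly_measurable_def)
  have "(\<lambda>t. lim (\<lambda>n. s n t)) \<in> borel_measurable lebesgue"
    by (intro borel_measurable_lim_metric borel_measurable_simple_function s)
  moreover have "AE t in lebesgue. lim (\<lambda>n. s n t) = f t"
    using s(2) by eventually_elim (rule limI)
  ultimately show "f \<in> borel_measurable lebesgue" by (rule borel_measurable_AE)
next
  assume "f \<in> borel_measurable lebesgue"
  from borel_measurable_implies_sequence_metric[OF this, of 0]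
  show "strongly_measurable f" by (auto simp: strongly_measurable_def)
qed

lemma strongly_measurable_add:
  fixes f :: "real \<Rightarrow> 'a::real_normed_vector"
  assumes "strongly_measurable f" "strongly_measurable g"
  shows "strongly_measurable (\<lambda>t. f t + g t)"
  by (rule strongly_measurable_compose2[where h = "(+)", OF _ assms])
    (unfold case_prod_unfold, intro continuous_intros)

lemma strongly_measurable_scaleR:
  fixes f :: "real \<Rightarrow> 'a::real_normed_vector"
  assumes "\<phi> \<in> borel_measurable lebesgue" "strongly_measurable f"
  shows "strongly_measurable (\<lambda>t. \<phi> t *\<^sub>R f t)"
proof (rule strongly_measurable_compose2[where h = "(*\<^sub>R)", OF _ _ assms(2)])
  show "continuous_on UNIV (\<lambda>(x, y :: 'a). x *\<^sub>R y)"
    unfolding case_prod_unfold by (intro continuous_intros)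
qed (simp add: strongly_measurable_real assms(1))

lemma borel_measurable_norm_strongly:
  fixes f :: "real \<Rightarrow> 'a::real_normed_vector"
  assumes "strongly_measurable f"
  shows "(\<lambda>t. norm (f t)) \<in> borel_measurable lebesgue"
  using strongly_measurable_compose[of norm f, OF continuous_on_norm_id assms]
  by (simp add: strongly_measurable_real)

lemma borel_measurable_norm2_strongly:
  fixes f :: "real \<Rightarrow> 'a::real_normed_vector"
  shows "strongly_measurable f \<Longrightarrow> (\<lambda>t. (norm (f t))\<^sup>2) \<in> borel_measurable lebesgue"
  by (rule borel_measurable_power[OF borel_measurable_norm_strongly])

lemma borel_measurable_inner_strongly:
  fixes f g :: "real \<Rightarrow> 'a::real_inner"
  assumes "strongly_measurable f" "strongly_measurable g"
  shows "(\<lambda>t. inner (f t) (g t)) \<in> borel_measurable lebesgue"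
  unfolding strongly_measurable_real[symmetric]
  by (rule strongly_measurable_compose2[where h = inner, OF _ assms])
    (unfold case_prod_unfold, intro continuous_intros)

section \<open>Square-integrable functions and their classes modulo null sets\<close>

definition square_integrable :: "(real \<Rightarrow> 'a::real_normed_vector) \<Rightarrow> bool" where
  "square_integrable f \<longleftrightarrow>
     strongly_measurable f \<and> (\<integral>\<^sup>+ t. ennreal ((norm (f t))\<^sup>2) \<partial>lebesgue) < \<infinity>"

lemma square_integrable_iff:
  "square_integrable f \<longleftrightarrow> strongly_measurable f \<and> integrable lebesgue (\<lambda>t. (norm (f t))\<^sup>2)"
  by (auto simp: square_integrable_def integrable_iff_bounded borel_measurable_norm2_strongly)

lemma square_integrable_0 [simp]: "square_integrable (\<lambda>t. 0)"
  by (simp add: square_integrable_def strongly_measurable_const)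

lemma square_integrable_bound:
  assumes g: "strongly_measurable g" and f: "square_integrable f"
    and le: "AE t in lebesgue. norm (g t) \<le> C * norm (f t)"
  shows "square_integrable g"
  unfolding square_integrable_iff
proof
  show "integrable lebesgue (\<lambda>t. (norm (g t))\<^sup>2)"
  proof (rule Bochner_Integration.integrable_bound)
    show "integrable lebesgue (\<lambda>t. C\<^sup>2 * (norm (f t))\<^sup>2)"
      using f by (simp add: square_integrable_iff)
    show "AE t in lebesgue. norm ((norm (g t))\<^sup>2) \<le> norm (C\<^sup>2 * (norm (f t))\<^sup>2)"
      using le
    proof eventually_elim
      case (elim t)
      then have "(norm (g t))\<^sup>2 \<le> (C * norm (f t))\<^sup>2" by (intro power_mono) auto
      then show ?case by (simp add: power_mult_distrib)
    qed
  qed (use g in \<open>auto intro: borel_measurable_norm2_strongly\<close>)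
qed (rule g)

lemma square_integrable_add:
  fixes f g :: "real \<Rightarrow> 'a::real_normed_vector"
  assumes f: "square_integrable f" and g: "square_integrable g"
  shows "square_integrable (\<lambda>t. f t + g t)"
  unfolding square_integrable_iff
proof
  show sm: "strongly_measurable (\<lambda>t. f t + g t)"
    using f g by (intro strongly_measurable_add) (auto simp: square_integrable_iff)
  show "integrable lebesgue (\<lambda>t. (norm (f t + g t))\<^sup>2)"
  proof (rule Bochner_Integration.integrable_bound)
    show "integrable lebesgue (\<lambda>t. 2 * (norm (f t))\<^sup>2 + 2 * (norm (g t))\<^sup>2)"
      using f g by (simp add: square_integrable_iff)
    have "(norm (x + y))\<^sup>2 \<le> 2 * (norm x)\<^sup>2 + 2 * (norm y)\<^sup>2" for x y :: 'a
    proof -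
      have "(norm (x + y))\<^sup>2 \<le> (norm x + norm y)\<^sup>2" by (intro power_mono norm_triangle_ineq) auto
      also have "\<dots> \<le> 2 * (norm x)\<^sup>2 + 2 * (norm y)\<^sup>2"
        using sum_squares_bound[of "norm x" "norm y"] by (simp add: power2_sum)
      finally show ?thesis .
    qed
    then show "AE t in lebesgue. norm ((norm (f t + g t))\<^sup>2) \<le> norm (2 * (norm (f t))\<^sup>2 + 2 * (norm (g t))\<^sup>2)"
      by simp
  qed (use sm in \<open>auto intro: borel_measurable_norm2_strongly\<close>)
qed

lemma square_integrable_scaleR:
  assumes "square_integrable f"
  shows "square_integrable (\<lambda>t. c *\<^sub>R f t)"
  by (rule square_integrable_bound[OF _ assms, where C = "\<bar>c\<bar>"])
    (use assms in \<open>auto simp: square_integrable_iff intro: strongly_measurable_scaleR\<close>)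

lemma square_integrable_diff:
  fixes f g :: "real \<Rightarrow> 'a::real_normed_vector"
  assumes f: "square_integrable f" and g: "square_integrable g"
  shows "square_integrable (\<lambda>t. f t - g t)"
  using square_integrable_add[OF f square_integrable_scaleR[OF g, of "-1"]] by simp

lemma integrable_inner_square_integrable:
  fixes f g :: "real \<Rightarrow> 'a::real_inner"
  assumes f: "square_integrable f" and g: "square_integrable g"
  shows "integrable lebesgue (\<lambda>t. inner (f t) (g t))"
proof (rule Bochner_Integration.integrable_bound)
  show "integrable lebesgue (\<lambda>t. (norm (f t))\<^sup>2 + (norm (g t))\<^sup>2)"
    using f g by (simp add: square_integrable_iff)
  have "\<bar>inner x y\<bar> \<le> (norm x)\<^sup>2 + (norm y)\<^sup>2" for x y :: 'a
    using Cauchy_Schwarz_ineq2[of x y] sum_squares_bound[of "norm x" "norm y"]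
      mult_nonneg_nonneg[OF norm_ge_zero norm_ge_zero, of x y] by linarith
  then show "AE t in lebesgue. norm (inner (f t) (g t)) \<le> norm ((norm (f t))\<^sup>2 + (norm (g t))\<^sup>2)"
    by simp
qed (use f g in \<open>auto simp: square_integrable_iff intro: borel_measurable_inner_strongly\<close>)

\<comment> \<open>A type of its own, unlike the set of those \<open>aefun\<close> that satisfy
  \<open>in_L2\<close>, can be an instance of the Hilbert space classes. Only the unweighted space
  is built; the others are reached through exponential weights.\<close>
quotient_type (overloaded) 'a l2 = "real \<Rightarrow> 'a::complex_hilbert" / partial:
  "\<lambda>f g. square_integrable f \<and> square_integrable g \<and> (AE t in lebesgue. f t = g t)"
proof (rule part_equivpI)
  show "\<exists>f :: real \<Rightarrow> 'a. square_integrable f \<and> square_integrable f \<and> (AE t in lebesgue. f t = f t)"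
    by (rule exI[of _ "\<lambda>t. 0"]) simp
  show "symp (\<lambda>f g :: real \<Rightarrow> 'a. square_integrable f \<and> square_integrable g \<and> (AE t in lebesgue. f t = g t))"
    by (auto simp: symp_def elim: eventually_mono)
  show "transp (\<lambda>f g :: real \<Rightarrow> 'a. square_integrable f \<and> square_integrable g \<and> (AE t in lebesgue. f t = g t))"
  proof (rule transpI)
    fix f g h :: "real \<Rightarrow> 'a"
    assume *: "square_integrable f \<and> square_integrable g \<and> (AE t in lebesgue. f t = g t)"
      "square_integrable g \<and> square_integrable h \<and> (AE t in lebesgue. g t = h t)"
    then have "AE t in lebesgue. f t = g t" "AE t in lebesgue. g t = h t" by auto
    then have "AE t in lebesgue. f t = h t" by eventually_elim simp
    then show "square_integrable f \<and> square_integrable h \<and> (AE t in lebesgue. f t = h t)"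
      using * by blast
  qed
qed

definition fn :: "'a::complex_hilbert l2 \<Rightarrow> real \<Rightarrow> 'a" where "fn x = rep_l2 x"

definition L2 :: "(real \<Rightarrow> 'a::complex_hilbert) \<Rightarrow> 'a l2" where "L2 f = abs_l2 f"

lemma square_integrable_fn [simp]: "square_integrable (fn x)"
  using Quotient3_rep_reflp[OF Quotient3_l2] unfolding fn_def by blast

lemma strongly_measurable_fn [simp]: "strongly_measurable (fn x)"
  using square_integrable_fn square_integrable_def by blast

lemma L2_fn [simp]: "L2 (fn x) = x"
  unfolding fn_def L2_def by (rule Quotient3_abs_rep[OF Quotient3_l2])

lemma fn_L2: "square_integrable f \<Longrightarrow> AE t in lebesgue. fn (L2 f) t = f t"
  using Quotient3_rep_abs[OF Quotient3_l2, of f] unfolding fn_def L2_def by simp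

lemma l2_eqI: "AE t in lebesgue. fn x t = fn y t \<Longrightarrow> x = y"
  using Quotient3_rel_rep[OF Quotient3_l2, of x y] square_integrable_fn[of x] square_integrable_fn[of y]
  unfolding fn_def by blast

lemma L2_eqI: "square_integrable f \<Longrightarrow> AE t in lebesgue. fn x t = f t \<Longrightarrow> L2 f = x"
  by (rule l2_eqI) (use fn_L2[of f] in \<open>auto elim: eventually_elim2\<close>)

instantiation l2 :: (complex_hilbert) real_vector
begin

definition zero_l2 :: "'a l2" where "0 = L2 (\<lambda>t. 0)"
definition plus_l2 :: "'a l2 \<Rightarrow> 'a l2 \<Rightarrow> 'a l2" where "x + y = L2 (\<lambda>t. fn x t + fn y t)"
definition minus_l2 :: "'a l2 \<Rightarrow> 'a l2 \<Rightarrow> 'a l2" where "x - y = L2 (\<lambda>t. fn x t - fn y t)"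
definition uminus_l2 :: "'a l2 \<Rightarrow> 'a l2" where "- x = L2 (\<lambda>t. (-1) *\<^sub>R fn x t)"
definition scaleR_l2 :: "real \<Rightarrow> 'a l2 \<Rightarrow> 'a l2" where "c *\<^sub>R x = L2 (\<lambda>t. c *\<^sub>R fn x t)"
lemma fn_zero: "AE t in lebesgue. fn (0::'a l2) t = 0"
  unfolding zero_l2_def by (rule fn_L2) simp

lemma fn_add: "AE t in lebesgue. fn (x + y) t = fn x t + fn (y::'a l2) t"
  unfolding plus_l2_def by (rule fn_L2) (simp add: square_integrable_add)

lemma fn_diff: "AE t in lebesgue. fn (x - y) t = fn x t - fn (y::'a l2) t"
  unfolding minus_l2_def by (rule fn_L2) (simp add: square_integrable_diff)

lemma fn_uminus: "AE t in lebesgue. fn (- x) t = - fn (x::'a l2) t"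
  unfolding uminus_l2_def using fn_L2[OF square_integrable_scaleR[OF square_integrable_fn], of "-1" x] by simp

lemma fn_scaleR: "AE t in lebesgue. fn (c *\<^sub>R x) t = c *\<^sub>R fn (x::'a l2) t"
  unfolding scaleR_l2_def by (rule fn_L2) (simp add: square_integrable_scaleR)

instance
proof
  fix x y z :: "'a l2" and a b :: real
  show "x + y + z = x + (y + z)"
    by (rule l2_eqI) (use fn_add[of x y] fn_add[of "x + y" z] fn_add[of y z] fn_add[of x "y + z"] in
      \<open>eventually_elim, simp\<close>)
  show "x + y = y + x"
    by (rule l2_eqI) (use fn_add[of x y] fn_add[of y x] in \<open>eventually_elim, simp\<close>)
  show "0 + x = x"
    by (rule l2_eqI) (use fn_add[of 0 x] fn_zero in \<open>eventually_elim, simp\<close>)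
  show "- x + x = 0"
    by (rule l2_eqI) (use fn_add[of "-x" x] fn_uminus[of x] fn_zero in \<open>eventually_elim, simp\<close>)
  show "x - y = x + - y"
    by (rule l2_eqI) (use fn_add[of x "-y"] fn_uminus[of y] fn_diff[of x y] in \<open>eventually_elim, simp\<close>)
  show "a *\<^sub>R (x + y) = a *\<^sub>R x + a *\<^sub>R y"
    by (rule l2_eqI) (use fn_scaleR[of a "x + y"] fn_add[of x y] fn_add[of "a *\<^sub>R x" "a *\<^sub>R y"]
        fn_scaleR[of a x] fn_scaleR[of a y] in \<open>eventually_elim, simp add: scaleR_add_right\<close>)
  show "(a + b) *\<^sub>R x = a *\<^sub>R x + b *\<^sub>R x"
    by (rule l2_eqI) (use fn_scaleR[of "a + b" x] fn_add[of "a *\<^sub>R x" "b *\<^sub>R x"]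
        fn_scaleR[of a x] fn_scaleR[of b x] in \<open>eventually_elim, simp add: scaleR_add_left\<close>)
  show "a *\<^sub>R b *\<^sub>R x = (a * b) *\<^sub>R x"
    by (rule l2_eqI) (use fn_scaleR[of "a * b" x] fn_scaleR[of a "b *\<^sub>R x"] fn_scaleR[of b x]
        in \<open>eventually_elim, simp\<close>)
  show "1 *\<^sub>R x = x"
    by (rule l2_eqI) (use fn_scaleR[of 1 x] in \<open>eventually_elim, simp\<close>)
qed

end

instantiation l2 :: (complex_hilbert) real_inner
begin

definition inner_l2 :: "'a l2 \<Rightarrow> 'a l2 \<Rightarrow> real" where
  "inner x y = (\<integral>t. inner (fn x t) (fn y t) \<partial>lebesgue)"
definition norm_l2 :: "'a l2 \<Rightarrow> real" where "norm_l2 x = sqrt (\<integral>t. inner (fn x t) (fn x t) \<partial>lebesgue)"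
definition dist_l2 :: "'a l2 \<Rightarrow> 'a l2 \<Rightarrow> real" where "dist_l2 x y = norm (x - y)"
definition sgn_l2 :: "'a l2 \<Rightarrow> 'a l2" where "sgn_l2 x = x /\<^sub>R norm x"
definition uniformity_l2 :: "('a l2 \<times> 'a l2) filter" where
  "(uniformity :: (_ l2 \<times> _ l2) filter) = (INF e\<in>{0 <..}. principal {(x, y). dist x y < e})"
definition open_l2 :: "'a l2 set \<Rightarrow> bool" where
  "open_l2 U = (\<forall>x\<in>U. \<forall>\<^sub>F (x', y) in uniformity. x' = x \<longrightarrow> y \<in> U)"

instance
proof
  fix x y z :: "'a l2" and a b :: real
  show "dist x y = norm (x - y)" by (simp add: dist_l2_def)
  show "sgn x = x /\<^sub>R norm x" by (simp add: sgn_l2_def)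
  show "uniformity = (INF e\<in>{0 <..}. principal {(x, y). dist (x::'a l2) y < e})"
    by (rule uniformity_l2_def)
  show "open U = (\<forall>x\<in>U. \<forall>\<^sub>F (x', y) in uniformity. x' = x \<longrightarrow> y \<in> U)" for U :: "'a l2 set"
    by (rule open_l2_def)
  show "norm x = sqrt (inner x x)" by (simp add: norm_l2_def inner_l2_def)
  show "inner x y = inner y x" by (simp add: inner_l2_def inner_commute)
  show "inner (x + y) z = inner x z + inner y z"
  proof -
    have "inner (x + y) z = (\<integral>t. inner (fn x t) (fn z t) + inner (fn y t) (fn z t) \<partial>lebesgue)"
      unfolding inner_l2_def
    proof (rule integral_cong_AE)
      show "AE t in lebesgue. inner (fn (x + y) t) (fn z t) = inner (fn x t) (fn z t) + inner (fn y t) (fn z t)"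
        using fn_add[of x y] by eventually_elim (simp add: inner_add_left)
    qed (auto intro!: borel_measurable_inner_strongly borel_measurable_add)
    then show ?thesis
      by (simp add: inner_l2_def Bochner_Integration.integral_add integrable_inner_square_integrable)
  qed
  show "inner (a *\<^sub>R x) y = a * inner x y"
  proof -
    have "inner (a *\<^sub>R x) y = (\<integral>t. a * inner (fn x t) (fn y t) \<partial>lebesgue)"
      unfolding inner_l2_def
    proof (rule integral_cong_AE)
      show "AE t in lebesgue. inner (fn (a *\<^sub>R x) t) (fn y t) = a * inner (fn x t) (fn y t)"
        using fn_scaleR[of a x] by eventually_elim simp
    qed (auto intro!: borel_measurable_inner_strongly borel_measurable_times)
    then show ?thesis by (simp add: inner_l2_def)
  qed
  show "0 \<le> inner x x" by (simp add: inner_l2_def)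
  show "inner x x = 0 \<longleftrightarrow> x = 0"
  proof
    assume "inner x x = 0"
    then have "AE t in lebesgue. inner (fn x t) (fn x t) = 0"
      unfolding inner_l2_def
      by (subst (asm) integral_nonneg_eq_0_iff_AE) (auto intro: integrable_inner_square_integrable)
    then have "AE t in lebesgue. fn x t = fn 0 t"
      using fn_zero by eventually_elim simp
    then show "x = 0" by (rule l2_eqI)
  next
    assume "x = 0"
    then have "AE t in lebesgue. inner (fn x t) (fn x t) = 0"
      using fn_zero by auto
    then show "inner x x = 0" unfolding inner_l2_def by (rule integral_eq_zero_AE)
  qed
qed

end

lemma norm_L2_sq: "(norm x)\<^sup>2 = (\<integral>t. (norm (fn x t))\<^sup>2 \<partial>lebesgue)"
  by (simp add: norm_eq_sqrt_inner inner_l2_def power2_norm_eq_inner)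

lemma nn_integral_fn: "(\<integral>\<^sup>+t. ennreal ((norm (fn x t))\<^sup>2) \<partial>lebesgue) = ennreal ((norm x)\<^sup>2)"
  unfolding norm_L2_sq using square_integrable_fn[of x]
  by (intro nn_integral_eq_integral) (auto simp: square_integrable_iff)

lemma nn_integral_L2:
  assumes "square_integrable f"
  shows "(\<integral>\<^sup>+t. ennreal ((norm (f t))\<^sup>2) \<partial>lebesgue) = ennreal ((norm (L2 f))\<^sup>2)"
  unfolding nn_integral_fn[symmetric]
  by (rule nn_integral_norm_cong_AE) (use fn_L2[OF assms] in \<open>auto elim: eventually_mono\<close>)

lemma inner_L2:
  assumes "square_integrable f" "square_integrable g"
  shows "inner (L2 f) (L2 g) = (\<integral>t. inner (f t) (g t) \<partial>lebesgue)"
  unfolding inner_l2_def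
proof (rule integral_cong_AE)
  show "AE t in lebesgue. inner (fn (L2 f) t) (fn (L2 g) t) = inner (f t) (g t)"
    using fn_L2[OF assms(1)] fn_L2[OF assms(2)] by eventually_elim simp
qed (use assms in \<open>auto intro!: borel_measurable_inner_strongly simp: square_integrable_def\<close>)

lemma L2_diff:
  assumes "square_integrable f" "square_integrable g"
  shows "L2 f - L2 g = L2 (\<lambda>t. f t - g t)"
proof (rule L2_eqI[symmetric])
  show "AE t in lebesgue. fn (L2 f - L2 g) t = f t - g t"
    using fn_L2[OF assms(1)] fn_L2[OF assms(2)] fn_diff[of "L2 f" "L2 g"] by eventually_elim simp
qed (intro square_integrable_diff assms)

text \<open>Truncating an approximating simple function where its norm exceeds \<open>2 * norm f\<close> makes it
  dominated by \<open>f\<close>.\<close>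

lemma square_integrable_approx_simple:
  fixes f :: "real \<Rightarrow> 'a::complex_hilbert"
  assumes f: "square_integrable f" and e: "e > 0"
  shows "\<exists>s. simple_function lebesgue s \<and> square_integrable s \<and> norm (L2 f - L2 s) < e"
proof -
  have fm: "strongly_measurable f" using f by (simp add: square_integrable_def)
  obtain s where s: "\<And>n::nat. simple_function lebesgue (s n)" "AE t in lebesgue. (\<lambda>n. s n t) \<longlonglongrightarrow> f t"
    using fm by (auto simp: strongly_measurable_def)
  define r where "r n t = (if norm (s n t) \<le> 2 * norm (f t) then s n t else 0)" for n t
  have rs: "simple_function lebesgue (r n)" for n
    unfolding r_def
  proof (rule simple_function_If[OF s(1)])
    have [measurable]: "(\<lambda>t. norm (s n t)) \<in> borel_measurable lebesgue"
      by (intro borel_measurable_norm_strongly strongly_measurable_simple s)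
    have [measurable]: "(\<lambda>t. norm (f t)) \<in> borel_measurable lebesgue"
      by (rule borel_measurable_norm_strongly[OF fm])
    show "{x \<in> space lebesgue. norm (s n x) \<le> 2 * norm (f x)} \<in> sets lebesgue" by measurable
  qed simp
  have rsq: "square_integrable (r n)" for n
    by (rule square_integrable_bound[OF strongly_measurable_simple[OF rs] f, where C = 2])
      (auto simp: r_def)
  have lim: "AE t in lebesgue. (\<lambda>n. r n t) \<longlonglongrightarrow> f t"
    using s(2)
  proof eventually_elim
    case (elim t)
    show ?case
    proof (cases "f t = 0")
      case True
      then have "r n t = 0" for n by (simp add: r_def)
      then show ?thesis using True by simp
    next
      case False
      have "(\<lambda>n. norm (s n t)) \<longlonglongrightarrow> norm (f t)" by (intro tendsto_intros elim)
      then have "\<forall>\<^sub>F n in sequentially. norm (s n t) < 2 * norm (f t)"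
        using False by (intro order_tendstoD) auto
      then have "\<forall>\<^sub>F n in sequentially. s n t = r n t"
        by eventually_elim (simp add: r_def)
      then show ?thesis using elim by (rule Lim_transform_eventually[rotated])
    qed
  qed
  have "(\<lambda>n. \<integral>t. (norm (f t - r n t))\<^sup>2 \<partial>lebesgue) \<longlonglongrightarrow> (\<integral>t. 0 \<partial>(lebesgue :: real measure))"
  proof (rule integral_dominated_convergence[where w = "\<lambda>t. 9 * (norm (f t))\<^sup>2" and f = "\<lambda>t. 0"
        and s = "\<lambda>n t. (norm (f t - r n t))\<^sup>2"])
    show "integrable lebesgue (\<lambda>t. 9 * (norm (f t))\<^sup>2)" using f by (simp add: square_integrable_iff)
    show "(\<lambda>t. (norm (f t - r n t))\<^sup>2) \<in> borel_measurable lebesgue" for n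
      using square_integrable_diff[OF f rsq[of n]]
      by (simp add: square_integrable_iff borel_measurable_norm2_strongly)
    show "AE t in lebesgue. (\<lambda>n. (norm (f t - r n t))\<^sup>2) \<longlonglongrightarrow> 0"
      using lim
    proof eventually_elim
      case (elim t)
      have "(\<lambda>n. (norm (f t - r n t))\<^sup>2) \<longlonglongrightarrow> (norm (f t - f t))\<^sup>2" by (intro tendsto_intros elim)
      then show ?case by simp
    qed
    have "norm ((norm (f t - r n t))\<^sup>2) \<le> 9 * (norm (f t))\<^sup>2" for n t
    proof -
      have "norm (f t - r n t) \<le> 3 * norm (f t)"
        using norm_triangle_ineq4[of "f t" "s n t"] by (auto simp: r_def)
      then have "(norm (f t - r n t))\<^sup>2 \<le> (3 * norm (f t))\<^sup>2" by (intro power_mono) auto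
      then show ?thesis by (simp add: power_mult_distrib)
    qed
    then show "AE t in lebesgue. norm ((norm (f t - r n t))\<^sup>2) \<le> 9 * (norm (f t))\<^sup>2" for n by simp
  qed simp
  moreover have "(norm (L2 f - L2 (r n)))\<^sup>2 = (\<integral>t. (norm (f t - r n t))\<^sup>2 \<partial>lebesgue)" for n
    unfolding L2_diff[OF f rsq] power2_norm_eq_inner
    using inner_L2[OF square_integrable_diff[OF f rsq] square_integrable_diff[OF f rsq]] by simp
  ultimately have "(\<lambda>n. (norm (L2 f - L2 (r n)))\<^sup>2) \<longlonglongrightarrow> 0" by simp
  then have "\<forall>\<^sub>F n in sequentially. (norm (L2 f - L2 (r n)))\<^sup>2 < e\<^sup>2"
    by (rule order_tendstoD(2)) (use e in simp)
  then obtain n where "(norm (L2 f - L2 (r n)))\<^sup>2 < e\<^sup>2"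
    using eventually_happens'[OF sequentially_bot] by blast
  then have "norm (L2 f - L2 (r n)) < e" using e by (simp add: power2_less_imp_less)
  then show ?thesis using rs rsq by blast
qed

text \<open>The Riesz-Fischer argument, run on simple functions so that the pointwise limit is
  strongly measurable by definition.\<close>

lemma simple_l2_fast_Cauchy_convergent:
  fixes s :: "nat \<Rightarrow> real \<Rightarrow> 'a::complex_hilbert"
  assumes s: "\<And>n. simple_function lebesgue (s n)" "\<And>n. square_integrable (s n)"
    and d: "\<And>n. norm (L2 (s (Suc n)) - L2 (s n)) \<le> (1/4) ^ n"
  shows "\<exists>x. (\<lambda>n. L2 (s n)) \<longlonglongrightarrow> x"
proof -
  have dm: "square_integrable (\<lambda>t. s m t - s n t)" for m n by (intro square_integrable_diff s)
  have dmm [measurable]: "(\<lambda>t. norm (s m t - s n t)) \<in> borel_measurable lebesgue" for m n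
    using dm[of m n] by (auto simp: square_integrable_def intro: borel_measurable_norm_strongly)
  have nd: "(\<integral>\<^sup>+t. ennreal ((norm (s m t - s n t))\<^sup>2) \<partial>lebesgue) = ennreal ((norm (L2 (s m) - L2 (s n)))\<^sup>2)" for m n
    using nn_integral_L2[OF dm[of m n]] L2_diff[OF s(2) s(2)] by simp
  \<comment> \<open>The squared increments are at most the square of \<open>(1/4)^n\<close>; after
    weighting with \<open>4^n\<close> they are still dominated by this series.\<close>
  have geo: "(\<Sum>n. ennreal ((1/4)^n)) < \<infinity>"
  proof -
    have "(\<Sum>n. ennreal ((1/4)^n)) = ennreal (\<Sum>n. (1/4)^n)"
      by (rule suminf_ennreal2) (auto intro: summable_geometric)
    then show ?thesis by (simp only: ennreal_less_top infinity_ennreal_def)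
  qed
  have "(\<integral>\<^sup>+t. (\<Sum>n. ennreal (4^n * (norm (s (Suc n) t - s n t))\<^sup>2)) \<partial>lebesgue)
      = (\<Sum>n. \<integral>\<^sup>+t. ennreal (4^n * (norm (s (Suc n) t - s n t))\<^sup>2) \<partial>lebesgue)"
    by (rule nn_integral_suminf) measurable
  also have "\<dots> \<le> (\<Sum>n. ennreal ((1/4)^n))"
  proof (intro suminf_le allI)
    fix n
    have "(\<integral>\<^sup>+t. ennreal (4^n * (norm (s (Suc n) t - s n t))\<^sup>2) \<partial>lebesgue)
        = ennreal (4^n) * ennreal ((norm (L2 (s (Suc n)) - L2 (s n)))\<^sup>2)"
      by (simp add: ennreal_mult nn_integral_cmult nd)
    also have "\<dots> = ennreal (4^n * (norm (L2 (s (Suc n)) - L2 (s n)))\<^sup>2)" by (simp add: ennreal_mult)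
    also have "\<dots> \<le> ennreal (4^n * ((1/4)^n)\<^sup>2)"
      by (intro ennreal_leI mult_left_mono power_mono d) auto
    also have "4^n * ((1/4)^n)\<^sup>2 = ((1/4)^n::real)"
      by (simp add: power2_eq_square power_mult_distrib[symmetric] mult.assoc[symmetric])
    finally show "(\<integral>\<^sup>+t. ennreal (4^n * (norm (s (Suc n) t - s n t))\<^sup>2) \<partial>lebesgue) \<le> ennreal ((1/4)^n)" .
  qed auto
  finally have "(\<integral>\<^sup>+t. (\<Sum>n. ennreal (4^n * (norm (s (Suc n) t - s n t))\<^sup>2)) \<partial>lebesgue) \<noteq> \<infinity>"
    using geo by (auto simp: top_unique)
  then have "AE t in lebesgue. (\<Sum>n. ennreal (4^n * (norm (s (Suc n) t - s n t))\<^sup>2)) \<noteq> \<infinity>"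
    by (intro nn_integral_noteq_infinite) measurable
  then have conv: "AE t in lebesgue. convergent (\<lambda>n. s n t)"
  proof eventually_elim
    case (elim t)
    let ?d = "\<lambda>n. norm (s (Suc n) t - s n t)"
    have sm: "summable (\<lambda>n. 4^n * (?d n)\<^sup>2)"
      using elim by (intro summable_suminf_not_top) auto
    \<comment> \<open>The weight \<open>4^n\<close> is what turns squares into increments: expanding
      a square gives \<open>2 d \<le> 4^n d^2 + (1/4)^n\<close>.\<close>
    have "summable ?d"
    proof (rule summable_comparison_test')
      show "summable (\<lambda>n. 4^n * (?d n)\<^sup>2 + (1/4)^n)" by (intro summable_add sm summable_geometric) simp
      fix n :: nat
      have "0 \<le> (2^n * ?d n - (1/2)^n)\<^sup>2" by simp
      also have "\<dots> = 4^n * (?d n)\<^sup>2 + (1/4)^n - 2 * ?d n"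
      proof -
        have "(4::real)^n = (2^n)\<^sup>2" "(1/4::real)^n = ((1/2)^n)\<^sup>2" "(2::real)^n * (1/2)^n = 1"
          by (simp_all add: power2_eq_square power_mult_distrib[symmetric])
        then show ?thesis by (simp add: power2_diff power_mult_distrib mult_ac)
      qed
      finally have "2 * ?d n \<le> 4^n * (?d n)\<^sup>2 + (1/4)^n" by simp
      then show "norm (?d n) \<le> 4^n * (?d n)\<^sup>2 + (1/4)^n" using norm_ge_zero[of "s (Suc n) t - s n t"] unfolding real_norm_def abs_norm_cancel by linarith
    qed
    then have "summable (\<lambda>n. s (Suc n) t - s n t)" by (rule summable_norm_cancel)
    then obtain l where "(\<lambda>n. \<Sum>i<n. s (Suc i) t - s i t) \<longlonglongrightarrow> l" by (auto simp: summable_def sums_def)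
    then have "(\<lambda>n. s n t - s 0 t) \<longlonglongrightarrow> l" by (simp add: sum_lessThan_telescope[of "\<lambda>i. s i t"])
    then have "(\<lambda>n. (s n t - s 0 t) + s 0 t) \<longlonglongrightarrow> l + s 0 t" by (intro tendsto_intros)
    then show ?case by (auto simp: convergent_def)
  qed
  define f where "f t = lim (\<lambda>n. s n t)" for t
  have lim: "AE t in lebesgue. (\<lambda>n. s n t) \<longlonglongrightarrow> f t"
    using conv by eventually_elim (simp add: f_def convergent_LIMSEQ_iff)
  have fm: "strongly_measurable f" unfolding strongly_measurable_def by (intro exI[of _ s]) (simp add: s(1) lim)
  have dist: "norm (L2 (s (n + k)) - L2 (s n)) \<le> 2 * (1/4)^n" for n k
  proof -
    have "norm (L2 (s (n + k)) - L2 (s n)) \<le> (\<Sum>i<k. (1/4)^(n + i))"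
    proof (induction k)
      case (Suc k)
      have "L2 (s (n + Suc k)) - L2 (s n) = (L2 (s (Suc (n + k))) - L2 (s (n + k))) + (L2 (s (n + k)) - L2 (s n))"
        by simp
      also have "norm \<dots> \<le> (1/4)^(n + k) + (\<Sum>i<k. (1/4)^(n + i))"
        by (rule norm_triangle_mono[OF d[of "n + k"] Suc])
      finally show ?case by simp
    qed simp
    also have "\<dots> = (1/4)^n * (\<Sum>i<k. (1/4)^i)" by (simp add: power_add sum_distrib_left)
    also have "\<dots> \<le> (1/4)^n * 2"
    proof (intro mult_left_mono)
      have "(\<Sum>i<k. (1/4::real)^i) \<le> (\<Sum>i. (1/4)^i)" by (intro sum_le_suminf summable_geometric) auto
      also have "\<dots> \<le> 2" by (simp add: suminf_geometric)
      finally show "(\<Sum>i<k. (1/4::real)^i) \<le> 2" .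
    qed simp
    finally show ?thesis by simp
  qed
  have fs: "(\<integral>\<^sup>+t. ennreal ((norm (f t - s n t))\<^sup>2) \<partial>lebesgue) \<le> ennreal ((2 * (1/4)^n)\<^sup>2)" for n
  proof -
    have "(\<integral>\<^sup>+t. ennreal ((norm (f t - s n t))\<^sup>2) \<partial>lebesgue)
       \<le> (\<integral>\<^sup>+t. liminf (\<lambda>m. ennreal ((norm (s (n + m) t - s n t))\<^sup>2)) \<partial>lebesgue)"
    proof (rule nn_integral_mono_AE)
      show "AE t in lebesgue. ennreal ((norm (f t - s n t))\<^sup>2) \<le> liminf (\<lambda>m. ennreal ((norm (s (n + m) t - s n t))\<^sup>2))"
        using lim
      proof eventually_elim
        case (elim t)
        have "(\<lambda>m. s (n + m) t) \<longlonglongrightarrow> f t"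
          using LIMSEQ_ignore_initial_segment[OF elim, of n] by (simp add: add.commute)
        then have "(\<lambda>m. ennreal ((norm (s (n + m) t - s n t))\<^sup>2)) \<longlonglongrightarrow> ennreal ((norm (f t - s n t))\<^sup>2)"
          by (intro tendsto_intros) auto
        from lim_imp_Liminf[OF _ this] show ?case by simp
      qed
    qed
    also have "\<dots> \<le> liminf (\<lambda>m. \<integral>\<^sup>+t. ennreal ((norm (s (n + m) t - s n t))\<^sup>2) \<partial>lebesgue)"
      by (rule nn_integral_liminf) measurable
    also have "\<dots> = liminf (\<lambda>m. ennreal ((norm (L2 (s (n + m)) - L2 (s n)))\<^sup>2))"
      by (simp add: nd)
    also have "\<dots> \<le> limsup (\<lambda>m. ennreal ((norm (L2 (s (n + m)) - L2 (s n)))\<^sup>2))"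
      by (rule Liminf_le_Limsup) simp
    also have "\<dots> \<le> ennreal ((2 * (1/4)^n)\<^sup>2)"
      by (rule Limsup_bounded) (intro always_eventually allI ennreal_leI power_mono dist, simp)
    finally show ?thesis .
  qed
  have fsq: "square_integrable (\<lambda>t. f t - s n t)" for n
    unfolding square_integrable_def
  proof
    show "strongly_measurable (\<lambda>t. f t - s n t)"
      using strongly_measurable_add[OF fm strongly_measurable_scaleR[of "\<lambda>_. -1" "s n"]]
        strongly_measurable_simple[OF s(1)[of n]] by simp
    show "(\<integral>\<^sup>+t. ennreal ((norm (f t - s n t))\<^sup>2) \<partial>lebesgue) < \<infinity>"
      using fs[of n] by (rule order_le_less_trans) simp
  qed
  have f: "square_integrable f" using square_integrable_add[OF fsq[of 0] s(2)[of 0]] by simp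
  have "norm (L2 (s n) - L2 f) \<le> 2 * (1/4)^n" for n
  proof -
    have "ennreal ((norm (L2 f - L2 (s n)))\<^sup>2) \<le> ennreal ((2 * (1/4)^n)\<^sup>2)"
      using fs[of n] by (simp add: nn_integral_L2[OF fsq] L2_diff[OF f s(2)])
    then have "(norm (L2 f - L2 (s n)))\<^sup>2 \<le> (2 * (1/4)^n)\<^sup>2" by (simp add: ennreal_le_iff)
    then have "norm (L2 f - L2 (s n)) \<le> 2 * (1/4)^n" by (rule power2_le_imp_le) simp
    then show ?thesis by (simp add: norm_minus_commute)
  qed
  moreover have "(\<lambda>n. 2 * (1/4::real)^n) \<longlonglongrightarrow> 0"
    by (intro tendsto_mult_right_zero LIMSEQ_power_zero) simp
  ultimately have "(\<lambda>n. L2 (s n) - L2 f) \<longlonglongrightarrow> 0"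
    by (intro Lim_null_comparison[of "\<lambda>n. L2 (s n) - L2 f" "\<lambda>n. 2 * (1/4) ^ n"] always_eventually allI)
  then show ?thesis by (auto simp: LIM_zero_iff)
qed

text \<open>A fast subsequence is perturbed to simple functions with errors that tend to 0
  geometrically, so the preceding lemma gives a limit for both.\<close>

instance l2 :: (complex_hilbert) banach
proof
  fix X :: "nat \<Rightarrow> 'a l2" assume X: "Cauchy X"
  have "\<exists>N. \<forall>m\<ge>N. \<forall>n\<ge>N. norm (X m - X n) < (1/4)^i / 4" for i :: nat
    using CauchyD[OF X, of "(1/4)^i / 4"] by simp
  then obtain N where N: "\<And>i m n. m \<ge> N i \<Longrightarrow> n \<ge> N i \<Longrightarrow> norm (X m - X n) < (1/4)^i / 4" by metis
  \<comment> \<open>Adding up all earlier \<open>N i\<close> makes \<open>r\<close> strictly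
    increasing and at least \<open>N n\<close> at \<open>n\<close>, without any monotonicity of
    \<open>N\<close>.\<close>
  define r where "r n = n + (\<Sum>i\<le>n. N i)" for n
  have rN: "r n \<ge> N n" for n
    unfolding r_def using member_le_sum[of n "{..n}" N] by simp
  have rmono: "strict_mono r" by (rule strict_monoI_Suc) (simp add: r_def)
  have "\<exists>s. simple_function lebesgue s \<and> square_integrable s \<and> norm (X (r n) - L2 s) < (1/4)^n / 4" for n
    using square_integrable_approx_simple[OF square_integrable_fn[of "X (r n)"], of "(1/4)^n / 4"] by simp
  then obtain s where s: "\<And>n. simple_function lebesgue (s n)" "\<And>n. square_integrable (s n)"
    "\<And>n. norm (X (r n) - L2 (s n)) < (1/4)^n / 4" by metis
  have "norm (L2 (s (Suc n)) - L2 (s n)) \<le> (1/4)^n" for n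
  proof -
    have "L2 (s (Suc n)) - L2 (s n) = (X (r (Suc n)) - X (r n)) + (X (r n) - L2 (s n)) - (X (r (Suc n)) - L2 (s (Suc n)))"
      by simp
    also have "norm \<dots> \<le> norm (X (r (Suc n)) - X (r n)) + norm (X (r n) - L2 (s n)) + norm (X (r (Suc n)) - L2 (s (Suc n)))"
      by (rule order_trans[OF norm_triangle_ineq4 add_right_mono[OF norm_triangle_ineq]])
    also have "\<dots> \<le> (1/4)^n / 4 + (1/4)^n / 4 + (1/4)^Suc n / 4"
    proof -
      have "r (Suc n) \<ge> N n" using rN[of n] strict_mono_less_eq[OF rmono, of n "Suc n"] by simp
      then show ?thesis using N[of n "r (Suc n)" "r n"] rN[of n] s(3)[of n] s(3)[of "Suc n"] by simp
    qed
    also have "\<dots> \<le> (1/4)^n" by simp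
    finally show ?thesis .
  qed
  then obtain x where x: "(\<lambda>n. L2 (s n)) \<longlonglongrightarrow> x"
    using simple_l2_fast_Cauchy_convergent[of s, OF s(1,2)] by blast
  have "(\<lambda>n. X (r n) - L2 (s n)) \<longlonglongrightarrow> 0"
  proof (rule Lim_null_comparison)
    show "\<forall>\<^sub>F n in sequentially. norm (X (r n) - L2 (s n)) \<le> (1/4)^n"
      using s(3) by (intro always_eventually allI order_trans[OF less_imp_le[OF s(3)]]) simp
    show "(\<lambda>n. (1/4::real)^n) \<longlonglongrightarrow> 0" by (rule LIMSEQ_power_zero) simp
  qed
  from tendsto_add[OF this x] have xr: "(\<lambda>n. X (r n)) \<longlonglongrightarrow> x" by simp
  have "X \<longlonglongrightarrow> x"
  proof (rule LIMSEQ_I)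
    fix e :: real assume e: "e > 0"
    obtain M where M: "\<And>m n. m \<ge> M \<Longrightarrow> n \<ge> M \<Longrightarrow> norm (X m - X n) < e / 2"
      using CauchyD[OF X, of "e/2"] e by auto
    obtain K where K: "\<And>n. n \<ge> K \<Longrightarrow> norm (X (r n) - x) < e / 2"
      using LIMSEQ_D[OF xr, of "e/2"] e by auto
    have "norm (X n - x) < e" if "n \<ge> M" for n
    proof -
      let ?k = "max K M"
      have "r ?k \<ge> M" using seq_suble[OF rmono, of ?k] by simp
      then have "norm (X n - X (r ?k)) < e / 2" using M that by blast
      moreover have "norm (X (r ?k) - x) < e / 2" by (rule K) simp
      ultimately have "norm ((X n - X (r ?k)) + (X (r ?k) - x)) < e"
        using norm_triangle_lt[of "X n - X (r ?k)" "X (r ?k) - x" e] by simp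
      then show ?thesis by simp
    qed
    then show "\<exists>no. \<forall>n\<ge>no. norm (X n - x) < e" by blast
  qed
  then show "convergent X" by (auto simp: convergent_def)
qed

section \<open>Operators on square-integrable functions\<close>

definition pw :: "('a::complex_hilbert \<Rightarrow> 'b::complex_hilbert) \<Rightarrow> 'a l2 \<Rightarrow> 'b l2" where
  "pw L x = L2 (\<lambda>t. L (fn x t))"

lemma square_integrable_bounded_linear:
  assumes L: "bounded_linear L" and f: "square_integrable f"
  shows "square_integrable (\<lambda>t. L (f t))"
proof -
  obtain K where K: "\<And>v. norm (L v) \<le> norm v * K" using bounded_linear.bounded[OF L] by blast
  have "continuous_on UNIV L" by (rule linear_continuous_on[OF L])
  then have "strongly_measurable (\<lambda>t. L (f t))"
    by (rule strongly_measurable_compose) (use f in \<open>simp add: square_integrable_def\<close>)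
  then show ?thesis
    by (rule square_integrable_bound[OF _ f, where C = K]) (use K in \<open>simp add: mult.commute\<close>)
qed

lemma fn_pw: "bounded_linear L \<Longrightarrow> AE t in lebesgue. fn (pw L x) t = L (fn x t)"
  unfolding pw_def by (rule fn_L2[OF square_integrable_bounded_linear]) simp_all

lemma norm_le_AE:
  assumes "AE t in lebesgue. norm (fn x t) \<le> c * norm (fn y t)" and c: "0 \<le> c"
  shows "norm x \<le> c * norm y"
proof -
  have "(norm x)\<^sup>2 \<le> (\<integral>t. c\<^sup>2 * (norm (fn y t))\<^sup>2 \<partial>lebesgue)"
    unfolding norm_L2_sq
  proof (rule integral_mono_AE)
    show "AE t in lebesgue. (norm (fn x t))\<^sup>2 \<le> c\<^sup>2 * (norm (fn y t))\<^sup>2"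
      using assms(1)
    proof eventually_elim
      case (elim t)
      then have "(norm (fn x t))\<^sup>2 \<le> (c * norm (fn y t))\<^sup>2" by (intro power_mono) auto
      then show ?case by (simp add: power_mult_distrib)
    qed
  qed (use square_integrable_fn[of x] square_integrable_fn[of y] in \<open>simp_all add: square_integrable_iff\<close>)
  also have "\<dots> = (c * norm y)\<^sup>2" by (simp add: norm_L2_sq power_mult_distrib)
  finally show ?thesis by (rule power2_le_imp_le) (use c in simp)
qed

lemma norm_pw_le:
  assumes "bounded_linear L" "\<And>v. norm (L v) \<le> c * norm v" "0 \<le> c"
  shows "norm (pw L x) \<le> c * norm x"
proof (rule norm_le_AE)
  show "AE t in lebesgue. norm (fn (pw L x) t) \<le> c * norm (fn x t)"
    using fn_pw[OF assms(1), of x] by eventually_elim (simp add: assms(2))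
qed (rule assms)

lemma norm_pw_ge:
  assumes "bounded_linear L" "\<And>v. norm v \<le> c * norm (L v)" "0 \<le> c"
  shows "norm x \<le> c * norm (pw L x)"
proof (rule norm_le_AE)
  show "AE t in lebesgue. norm (fn x t) \<le> c * norm (fn (pw L x) t)"
    using fn_pw[OF assms(1), of x] by eventually_elim (simp add: assms(2))
qed (rule assms)

lemma bounded_linear_pw:
  assumes L: "bounded_linear L"
  shows "bounded_linear (pw L)"
proof -
  obtain K where K: "K > 0" "\<And>v. norm (L v) \<le> norm v * K"
    using bounded_linear.pos_bounded[OF L] by blast
  have lin: "linear L" using L by (rule bounded_linear.linear)
  show ?thesis
  proof (rule bounded_linear_intro[where K = K])
    show "pw L (x + y) = pw L x + pw L y" for x y
      by (rule l2_eqI) (use fn_pw[OF L, of "x + y"] fn_pw[OF L, of x] fn_pw[OF L, of y] fn_add[of x y]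
        fn_add[of "pw L x" "pw L y"] in \<open>eventually_elim, simp add: linear_add[OF lin]\<close>)
    show "pw L (r *\<^sub>R x) = r *\<^sub>R pw L x" for r x
      by (rule l2_eqI) (use fn_pw[OF L, of "r *\<^sub>R x"] fn_pw[OF L, of x] fn_scaleR[of r x]
        fn_scaleR[of r "pw L x"] in \<open>eventually_elim, simp add: linear_scale[OF lin]\<close>)
    show "norm (pw L x) \<le> norm x * K" for x
      using norm_pw_le[OF L, of K] K by (simp add: mult.commute)
  qed
qed

lemma pw_pw:
  assumes L: "bounded_linear L" and K: "bounded_linear K"
  shows "pw L (pw K x) = pw (\<lambda>v. L (K v)) x"
  by (rule l2_eqI) (use fn_pw[OF L, of "pw K x"] fn_pw[OF K, of x]
      fn_pw[OF bounded_linear_compose[OF L K], of x] in \<open>eventually_elim, simp\<close>)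

lemma pw_add:
  assumes L: "bounded_linear L" and K: "bounded_linear K"
  shows "pw (\<lambda>v. L v + K v) x = pw L x + pw K x"
  by (rule l2_eqI) (use fn_pw[OF L, of x] fn_pw[OF K, of x] fn_add[of "pw L x" "pw K x"]
      fn_pw[OF bounded_linear_add[OF L K], of x] in \<open>eventually_elim, simp\<close>)

lemma pw_scaleR: "pw (\<lambda>v. r *\<^sub>R v) x = r *\<^sub>R x"
  by (simp add: pw_def scaleR_l2_def)

subsection \<open>Complex structure\<close>

lemma scaleC_scaleR_decomp: "c *\<^sub>C (x::'a::complex_hilbert) = Re c *\<^sub>R x + Im c *\<^sub>R (\<i> *\<^sub>C x)"
proof -
  have "c = complex_of_real (Re c) + complex_of_real (Im c) * \<i>" by (simp add: complex_eq mult.commute)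
  then have "c *\<^sub>C x = (complex_of_real (Re c) + complex_of_real (Im c) * \<i>) *\<^sub>C x" by simp
  then show ?thesis by (simp only: scaleC_add_left scaleC_of_real scaleC_scaleC[symmetric])
qed

lemma cinner_scaleC_right: "cinner x (c *\<^sub>C y) = cnj c * cinner x (y::'a::complex_hilbert)"
  using cinner_commute[of x "c *\<^sub>C y"] cinner_commute[of y x] by (simp add: cinner_scaleC_left)

lemma inner_scaleC_left: "inner (c *\<^sub>C x) (y::'a::complex_hilbert) = inner x (cnj c *\<^sub>C y)"
  by (simp add: Re_cinner[symmetric] cinner_scaleC_left cinner_scaleC_right)

lemma norm_scaleC: "norm (c *\<^sub>C (x::'a::complex_hilbert)) = cmod c * norm x"
proof -
  have "(norm (c *\<^sub>C x))\<^sup>2 = inner x ((cnj c * c) *\<^sub>C x)"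
    by (simp add: power2_norm_eq_inner inner_scaleC_left scaleC_scaleC)
  also have "cnj c * c = complex_of_real ((cmod c)\<^sup>2)"
    by (metis complex_norm_square mult.commute)
  also have "inner x (complex_of_real ((cmod c)\<^sup>2) *\<^sub>C x) = (cmod c * norm x)\<^sup>2"
    unfolding scaleC_of_real by (simp add: power2_norm_eq_inner[symmetric] power_mult_distrib)
  finally show ?thesis by (simp add: power2_eq_iff_nonneg)
qed

lemma scaleR_scaleC_commute: "r *\<^sub>R (c *\<^sub>C x) = c *\<^sub>C (r *\<^sub>R (x::'a::complex_hilbert))"
  by (simp add: scaleC_of_real[symmetric] scaleC_scaleC mult.commute)

lemma bounded_linear_scaleC: "bounded_linear (\<lambda>x::'a::complex_hilbert. c *\<^sub>C x)"
  by (rule bounded_linear_intro[where K = "cmod c"])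
    (simp_all add: scaleC_add_right scaleR_scaleC_commute norm_scaleC mult.commute)

instantiation l2 :: (complex_hilbert) complex_hilbert
begin

definition scaleC_l2 :: "complex \<Rightarrow> 'a l2 \<Rightarrow> 'a l2" where
  "scaleC_l2 c x = pw (\<lambda>v. c *\<^sub>C v) x"

text \<open>The form is conjugate linear in the second argument, so its imaginary part at
  \<open>(x, y)\<close> is its real part at \<open>x\<close> and \<open>i\<close> times
  \<open>y\<close>.\<close>

definition cinner_l2 :: "'a l2 \<Rightarrow> 'a l2 \<Rightarrow> complex" where
  "cinner_l2 x y = Complex (inner x y) (inner x (\<i> *\<^sub>C y))"

instance
proof
  fix a b :: complex and r :: real and x y z :: "'a l2"
  have blin: "linear (\<lambda>x::'a l2. c *\<^sub>C x)" for c
    using bounded_linear.linear[OF bounded_linear_pw[OF bounded_linear_scaleC]]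
    by (simp add: scaleC_l2_def)
  show add_right: "a *\<^sub>C (x + y) = a *\<^sub>C x + a *\<^sub>C y" for x y :: "'a l2" by (rule linear_add[OF blin])
  show add_left: "(a + b) *\<^sub>C x = a *\<^sub>C x + b *\<^sub>C x" for a b and x :: "'a l2"
    by (simp add: scaleC_l2_def scaleC_add_left pw_add bounded_linear_scaleC)
  show scaleC_scaleC: "a *\<^sub>C (b *\<^sub>C x) = (a * b) *\<^sub>C x" for a b and x :: "'a l2"
    by (simp add: scaleC_l2_def pw_pw bounded_linear_scaleC scaleC_scaleC)
  show of_real: "complex_of_real r *\<^sub>C x = r *\<^sub>R x" for r and x :: "'a l2"
    by (simp add: scaleC_l2_def scaleC_of_real pw_scaleR)
  show "cinner (x + y) z = cinner x z + cinner y z"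
    by (simp add: cinner_l2_def inner_add_left complex_eq_iff)
  have i_adj: "inner (\<i> *\<^sub>C x) y = - inner x (\<i> *\<^sub>C y)" for x y :: "'a l2"
  proof -
    have "inner (\<i> *\<^sub>C x) y = (\<integral>t. - inner (fn x t) (fn (\<i> *\<^sub>C y) t) \<partial>lebesgue)"
      unfolding inner_l2_def
    proof (rule integral_cong_AE)
      show "AE t in lebesgue. inner (fn (\<i> *\<^sub>C x) t) (fn y t) = - inner (fn x t) (fn (\<i> *\<^sub>C y) t)"
        unfolding scaleC_l2_def
        using fn_pw[OF bounded_linear_scaleC[of \<i>], of x] fn_pw[OF bounded_linear_scaleC[of \<i>], of y]
      proof eventually_elim
        case (elim t)
        have "cnj \<i> *\<^sub>C fn y t = - (\<i> *\<^sub>C fn y t)"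
          using scaleC_scaleR_decomp[of "- \<i>" "fn y t"] by simp
        then show ?case using elim by (simp add: inner_scaleC_left)
      qed
    qed (auto intro!: borel_measurable_inner_strongly borel_measurable_uminus)
    then show ?thesis by (simp add: inner_l2_def)
  qed
  have decomp: "c *\<^sub>C x = Re c *\<^sub>R x + Im c *\<^sub>R (\<i> *\<^sub>C x)" for c and x :: "'a l2"
  proof -
    have "c = complex_of_real (Re c) + complex_of_real (Im c) * \<i>" by (simp add: complex_eq mult.commute)
    then have "c *\<^sub>C x = (complex_of_real (Re c) + complex_of_real (Im c) * \<i>) *\<^sub>C x" by simp
    then show ?thesis by (simp only: add_left of_real scaleC_scaleC[symmetric])
  qed
  have ii: "\<i> *\<^sub>C (\<i> *\<^sub>C x) = - x" for x :: "'a l2"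
    using of_real[of "-1" x] by (simp add: scaleC_scaleC)
  have lin: "linear (\<lambda>x::'a l2. \<i> *\<^sub>C x)" by (rule blin)
  show "cinner (a *\<^sub>C x) y = a * cinner x y"
    unfolding cinner_l2_def decomp[of a x]
    by (simp add: complex_eq_iff inner_add_left i_adj ii algebra_simps)
  show "cinner x y = cnj (cinner y x)"
    using i_adj[of y x] by (simp add: cinner_l2_def complex_eq_iff inner_commute)
  show "Re (cinner x y) = inner x y" by (simp add: cinner_l2_def)
qed

end

lemma pw_scaleC:
  assumes L: "bounded_linear L" "\<And>c v. L (c *\<^sub>C v) = c *\<^sub>C L v"
  shows "pw L (c *\<^sub>C x) = c *\<^sub>C pw L x"
  by (simp add: scaleC_l2_def pw_pw L bounded_linear_scaleC)

lemma fn_scaleC: "AE t in lebesgue. fn (c *\<^sub>C x) t = c *\<^sub>C fn x t"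
  unfolding scaleC_l2_def by (rule fn_pw[OF bounded_linear_scaleC])

subsection \<open>Multiplication by bounded functions\<close>

definition bounded_measurable :: "(real \<Rightarrow> real) \<Rightarrow> bool" where
  "bounded_measurable \<phi> \<longleftrightarrow> \<phi> \<in> borel_measurable lebesgue \<and> (\<exists>C. \<forall>t. \<bar>\<phi> t\<bar> \<le> C)"

definition mul :: "(real \<Rightarrow> real) \<Rightarrow> 'a::complex_hilbert l2 \<Rightarrow> 'a l2" where
  "mul \<phi> x = L2 (\<lambda>t. \<phi> t *\<^sub>R fn x t)"

lemma bounded_measurableI:
  "\<phi> \<in> borel_measurable borel \<Longrightarrow> (\<And>t. \<bar>\<phi> t\<bar> \<le> C) \<Longrightarrow> bounded_measurable \<phi>"
  unfolding bounded_measurable_def by (auto intro: measurable_completion)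

lemma bounded_measurable_indicator [simp]: "A \<in> sets borel \<Longrightarrow> bounded_measurable (indicator A)"
  by (rule bounded_measurableI[where C = 1]) (auto simp: indicator_def)

lemma bounded_measurable_mult:
  assumes "bounded_measurable \<phi>" "bounded_measurable \<psi>"
  shows "bounded_measurable (\<lambda>t. \<phi> t * \<psi> t)"
proof -
  obtain C D where CD: "\<And>t. \<bar>\<phi> t\<bar> \<le> C" "\<And>t. \<bar>\<psi> t\<bar> \<le> D"
    using assms by (auto simp: bounded_measurable_def)
  have "\<bar>\<phi> t * \<psi> t\<bar> \<le> C * D" for t
    unfolding abs_mult by (rule mult_mono'[OF CD]) auto
  then show ?thesis using assms by (auto simp: bounded_measurable_def)
qed

lemma square_integrable_mul:
  assumes "bounded_measurable \<phi>" "square_integrable f"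
  shows "square_integrable (\<lambda>t. \<phi> t *\<^sub>R f t)"
proof -
  obtain C where C: "\<And>t. \<bar>\<phi> t\<bar> \<le> C" using assms(1) by (auto simp: bounded_measurable_def)
  show ?thesis
  proof (rule square_integrable_bound[OF _ assms(2), where C = C])
    show "strongly_measurable (\<lambda>t. \<phi> t *\<^sub>R f t)"
      using assms by (simp add: bounded_measurable_def square_integrable_def strongly_measurable_scaleR)
    show "AE t in lebesgue. norm (\<phi> t *\<^sub>R f t) \<le> C * norm (f t)"
      by (intro always_eventually allI) (simp add: C mult_right_mono)
  qed
qed

lemma fn_mul: "bounded_measurable \<phi> \<Longrightarrow> AE t in lebesgue. fn (mul \<phi> x) t = \<phi> t *\<^sub>R fn x t"
  unfolding mul_def by (rule fn_L2[OF square_integrable_mul]) simp_all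

lemma norm_mul_le:
  assumes "bounded_measurable \<phi>" "\<And>t. \<bar>\<phi> t\<bar> \<le> C"
  shows "norm (mul \<phi> x) \<le> C * norm x"
proof (rule norm_le_AE)
  show "AE t in lebesgue. norm (fn (mul \<phi> x) t) \<le> C * norm (fn x t)"
    using fn_mul[OF assms(1), of x]
    by eventually_elim (use assms(2) in \<open>simp add: mult_right_mono\<close>)
  show "0 \<le> C" using assms(2)[of 0] by simp
qed

lemma bounded_linear_mul:
  assumes \<phi>: "bounded_measurable \<phi>"
  shows "bounded_linear (mul \<phi>)"
proof -
  obtain C where C: "\<And>t. \<bar>\<phi> t\<bar> \<le> C" using \<phi> by (auto simp: bounded_measurable_def)
  show ?thesis
  proof (rule bounded_linear_intro[where K = C])
    show "mul \<phi> (x + y) = mul \<phi> x + mul \<phi> y" for x y :: "'a l2"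
      by (rule l2_eqI) (use fn_mul[OF \<phi>, of "x + y"] fn_mul[OF \<phi>, of x] fn_mul[OF \<phi>, of y] fn_add[of x y]
        fn_add[of "mul \<phi> x" "mul \<phi> y"] in \<open>eventually_elim, simp add: scaleR_add_right\<close>)
    show "mul \<phi> (r *\<^sub>R x) = r *\<^sub>R mul \<phi> x" for r and x :: "'a l2"
      by (rule l2_eqI) (use fn_mul[OF \<phi>, of "r *\<^sub>R x"] fn_mul[OF \<phi>, of x] fn_scaleR[of r x]
        fn_scaleR[of r "mul \<phi> x"] in \<open>eventually_elim, simp\<close>)
    show "norm (mul \<phi> x) \<le> norm x * C" for x :: "'a l2"
      using norm_mul_le[OF \<phi> C] by (simp add: mult.commute)
  qed
qed

lemma mul_mul:
  assumes "bounded_measurable \<phi>" "bounded_measurable \<psi>"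
  shows "mul \<phi> (mul \<psi> x) = mul (\<lambda>t. \<phi> t * \<psi> t) x"
  by (rule l2_eqI) (use fn_mul[OF assms(1), of "mul \<psi> x"] fn_mul[OF assms(2), of x]
      fn_mul[OF bounded_measurable_mult[OF assms], of x] in \<open>eventually_elim, simp\<close>)

lemma mul_eqI: "bounded_measurable \<phi> \<Longrightarrow> AE t in lebesgue. \<phi> t *\<^sub>R fn x t = fn y t \<Longrightarrow> mul \<phi> x = y"
  by (rule l2_eqI) (use fn_mul[of \<phi> x] in \<open>auto elim: eventually_elim2\<close>)

lemma inner_mul:
  assumes "bounded_measurable \<phi>"
  shows "inner (mul \<phi> x) y = inner x (mul \<phi> y)"
  unfolding inner_l2_def
proof (rule integral_cong_AE)
  show "AE t in lebesgue. inner (fn (mul \<phi> x) t) (fn y t) = inner (fn x t) (fn (mul \<phi> y) t)"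
    using fn_mul[OF assms, of x] fn_mul[OF assms, of y] by eventually_elim simp
qed (auto intro!: borel_measurable_inner_strongly)

lemma pw_mul:
  assumes "bounded_linear L" "bounded_measurable \<phi>"
  shows "pw L (mul \<phi> x) = mul \<phi> (pw L x)"
  by (rule l2_eqI) (use fn_pw[OF assms(1), of "mul \<phi> x"] fn_pw[OF assms(1), of x] fn_mul[OF assms(2), of x]
      fn_mul[OF assms(2), of "pw L x"] in \<open>eventually_elim, simp add: linear_scale[OF bounded_linear.linear[OF assms(1)]]\<close>)

lemma mul_scaleC: "bounded_measurable \<phi> \<Longrightarrow> mul \<phi> (c *\<^sub>C x) = c *\<^sub>C mul \<phi> x"
  by (simp add: scaleC_l2_def pw_mul bounded_linear_scaleC)

subsection \<open>Translations\<close>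

definition sh :: "real \<Rightarrow> 'a::complex_hilbert l2 \<Rightarrow> 'a l2" where
  "sh t x = L2 (\<lambda>s. fn x (t + s))"

lemma measurable_lebesgue_add: "(\<lambda>s::real. t + s) \<in> lebesgue \<rightarrow>\<^sub>M lebesgue"
  using lebesgue_affine_measurable[of "\<lambda>_::real. 1" t] by simp

lemma square_integrable_sh:
  assumes f: "square_integrable f"
  shows "square_integrable (\<lambda>s. f (t + s))"
    and nn_integral_sh: "(\<integral>\<^sup>+ s. ennreal ((norm (f (t + s)))\<^sup>2) \<partial>lebesgue) = (\<integral>\<^sup>+ s. ennreal ((norm (f s))\<^sup>2) \<partial>lebesgue)"
proof -
  have fm: "strongly_measurable f" using f by (simp add: square_integrable_def)
  obtain s where s: "\<And>n::nat. simple_function lebesgue (s n)" "AE t in lebesgue. (\<lambda>n. s n t) \<longlonglongrightarrow> f t"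
    using fm by (auto simp: strongly_measurable_def)
  have "strongly_measurable (\<lambda>s. f (t + s))"
    unfolding strongly_measurable_def
    by (intro exI[of _ "\<lambda>n x. s n (t + x)"] conjI allI simple_function_comp[OF measurable_lebesgue_add s(1)]
      AE_lebesgue_translation[OF s(2)])
  moreover show eq: "(\<integral>\<^sup>+ s. ennreal ((norm (f (t + s)))\<^sup>2) \<partial>lebesgue) = (\<integral>\<^sup>+ s. ennreal ((norm (f s))\<^sup>2) \<partial>lebesgue)"
    using nn_integral_real_affine_lebesgue[of "\<lambda>s. ennreal ((norm (f s))\<^sup>2)" 1 t]
      borel_measurable_norm2_strongly[OF fm] by simp
  ultimately show "square_integrable (\<lambda>s. f (t + s))"
    using f by (simp add: square_integrable_def)
qed

lemma fn_sh: "AE s in lebesgue. fn (sh t x) s = fn x (t + s)"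
  unfolding sh_def by (rule fn_L2[OF square_integrable_sh(1)]) simp

lemma norm_sh [simp]: "norm (sh t x) = norm x"
proof -
  have "ennreal ((norm (sh t x))\<^sup>2) = ennreal ((norm x)\<^sup>2)"
    unfolding nn_integral_fn[of x, symmetric] nn_integral_sh[OF square_integrable_fn, symmetric, of _ t]
    by (simp add: sh_def nn_integral_L2[symmetric] square_integrable_sh(1))
  then show ?thesis by (simp add: power2_eq_iff_nonneg)
qed

lemma bounded_linear_sh: "bounded_linear (sh t)"
proof (rule bounded_linear_intro[where K = 1])
  show "sh t (x + y) = sh t x + sh t y" for x y :: "'a l2"
    by (rule l2_eqI) (use fn_sh[of t "x + y"] fn_sh[of t x] fn_sh[of t y] AE_lebesgue_translation[OF fn_add[of x y], of t]
        fn_add[of "sh t x" "sh t y"] in \<open>eventually_elim, simp\<close>)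
  show "sh t (r *\<^sub>R x) = r *\<^sub>R sh t x" for r and x :: "'a l2"
    by (rule l2_eqI) (use fn_sh[of t "r *\<^sub>R x"] fn_sh[of t x] AE_lebesgue_translation[OF fn_scaleR[of r x], of t]
        fn_scaleR[of r "sh t x"] in \<open>eventually_elim, simp\<close>)
qed simp

lemmas linear_sh = bounded_linear.linear[OF bounded_linear_sh]

lemma sh_0 [simp]: "sh 0 x = x"
  by (simp add: sh_def)

lemma sh_sh: "sh s (sh t x) = sh (s + t) x"
  by (rule l2_eqI) (use fn_sh[of s "sh t x"] AE_lebesgue_translation[OF fn_sh[of t x], of s] fn_sh[of "s + t" x]
      in \<open>eventually_elim, simp add: ac_simps\<close>)

lemma inner_sh_sh [simp]: "inner (sh t x) (sh t y) = inner x y"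
  using dot_norm[of "sh t x" "sh t y"] by (simp add: linear_add[OF linear_sh, symmetric] dot_norm)

lemma inner_sh: "inner (sh t x) y = inner x (sh (- t) y)"
  using inner_sh_sh[of t x "sh (-t) y"] by (simp add: sh_sh)

lemma pw_sh:
  assumes "bounded_linear L"
  shows "pw L (sh t x) = sh t (pw L x)"
  by (rule l2_eqI) (use fn_pw[OF assms, of "sh t x"] fn_sh[of t x] fn_sh[of t "pw L x"]
      AE_lebesgue_translation[OF fn_pw[OF assms, of x], of t] in \<open>eventually_elim, simp\<close>)

lemma sh_scaleC: "sh t (c *\<^sub>C x) = c *\<^sub>C sh t x"
  by (simp add: scaleC_l2_def pw_sh bounded_linear_scaleC)

subsection \<open>Exponentials\<close>

definition ef :: "real \<Rightarrow> real \<Rightarrow> real" where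
  "ef lam t = indicator {0..} t * exp (- lam * t)"

text \<open>For \<open>f\<close> supported in the future, \<open>inner f (E lam v)\<close> is the
  Laplace transform of \<open>f\<close> at \<open>lam\<close>, paired with \<open>v\<close>; thus
  \<open>E lam v\<close> is the kernel of the Hardy space at \<open>lam\<close>.\<close>

definition E :: "real \<Rightarrow> 'a::complex_hilbert \<Rightarrow> 'a l2" where
  "E lam v = L2 (\<lambda>t. ef lam t *\<^sub>R v)"

abbreviation fut :: "'a::complex_hilbert l2 \<Rightarrow> 'a l2" where
  "fut \<equiv> mul (indicator {0..})"

lemma ef_measurable [measurable]: "ef lam \<in> borel_measurable borel"
  unfolding ef_def[abs_def] by measurable

lemma bounded_measurable_ef [simp]:
  assumes "0 \<le> lam" shows "bounded_measurable (ef lam)"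
  by (rule bounded_measurableI[where C = 1]) (use assms in \<open>auto simp: ef_def indicator_def\<close>)

lemma ef_mult: "ef a t * ef b t = ef (a + b) t"
  by (auto simp: ef_def indicator_def mult_exp_exp algebra_simps)

lemma has_bochner_integral_ef:
  assumes lam: "lam > 0"
  shows "has_bochner_integral lebesgue (ef lam) (1 / lam)"
proof (rule has_bochner_integral_nn_integral)
  have "integral\<^sup>N lborel (\<lambda>x. indicator {0..} x * exp (- lam * x)) = exp (- lam * 0) / lam"
    by (rule nn_integral_has_integral_lebesgue[OF _ has_integral_exp_minus_to_infinity[OF lam]]) simp
  then show "(\<integral>\<^sup>+x. ennreal (ef lam x) \<partial>lebesgue) = ennreal (1 / lam)"
    by (simp add: nn_integral_completion ef_def)
  show "ef lam \<in> borel_measurable lebesgue"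
    using ef_measurable by (auto intro: measurable_completion)
  show "AE x in lebesgue. 0 \<le> ef lam x" by (simp add: ef_def indicator_def)
qed (use lam in simp)

lemma square_integrable_ef:
  assumes lam: "lam > 0"
  shows "square_integrable (\<lambda>t. ef lam t *\<^sub>R v)"
  unfolding square_integrable_iff
proof
  have m: "ef lam \<in> borel_measurable lebesgue"
    using ef_measurable by (auto intro: measurable_completion)
  show "strongly_measurable (\<lambda>t. ef lam t *\<^sub>R v)"
    by (rule strongly_measurable_scaleR[OF m strongly_measurable_const])
  have "(norm (ef lam t *\<^sub>R v))\<^sup>2 = ef (2 * lam) t * (norm v)\<^sup>2" for t
    using ef_mult[of lam t lam] by (simp add: power_mult_distrib power2_eq_square)
  then show "integrable lebesgue (\<lambda>t. (norm (ef lam t *\<^sub>R v))\<^sup>2)"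
    using has_bochner_integral_ef[of "2 * lam"] lam by (simp add: has_bochner_integral_iff)
qed

lemma fn_E: "lam > 0 \<Longrightarrow> AE t in lebesgue. fn (E lam v) t = ef lam t *\<^sub>R v"
  unfolding E_def by (rule fn_L2[OF square_integrable_ef])

lemma inner_E_E:
  assumes "lam > 0" shows "inner (E lam u) (E lam v) = inner u v / (2 * lam)"
proof -
  have "inner (E lam u) (E lam v) = (\<integral>t. ef (2 * lam) t * inner u v \<partial>lebesgue)"
    unfolding E_def inner_L2[OF square_integrable_ef square_integrable_ef, OF assms assms]
    using ef_mult[of lam _ lam] by (intro Bochner_Integration.integral_cong) (auto simp: mult.assoc[symmetric])
  then show ?thesis
    using has_bochner_integral_ef[of "2 * lam"] assms by (simp add: has_bochner_integral_iff)
qed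

lemma norm_E: "lam > 0 \<Longrightarrow> norm (E lam v) = norm v / sqrt (2 * lam)"
  by (simp add: norm_eq_sqrt_inner inner_E_E real_sqrt_divide)

lemma pw_E:
  assumes "lam > 0" "bounded_linear L" shows "pw L (E lam v) = E lam (L v)"
  by (rule l2_eqI) (use fn_pw[OF assms(2), of "E lam v"] fn_E[OF assms(1), of v] fn_E[OF assms(1), of "L v"]
    in \<open>eventually_elim, simp add: linear_scale[OF bounded_linear.linear[OF assms(2)]]\<close>)

lemma E_scaleC: "lam > 0 \<Longrightarrow> E lam (c *\<^sub>C v) = c *\<^sub>C E lam v"
  by (simp add: scaleC_l2_def pw_E bounded_linear_scaleC)

lemma bounded_linear_E:
  assumes lam: "lam > 0" shows "bounded_linear (E lam)"
proof (rule bounded_linear_intro[where K = "1 / sqrt (2 * lam)"])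
  show "E lam (x + y) = E lam x + E lam y" for x y :: 'a
    by (rule l2_eqI) (use fn_E[OF lam, of "x + y"] fn_E[OF lam, of x] fn_E[OF lam, of y]
      fn_add[of "E lam x" "E lam y"] in \<open>eventually_elim, simp add: scaleR_add_right\<close>)
  show "E lam (r *\<^sub>R x) = r *\<^sub>R E lam x" for r and x :: 'a
    by (rule l2_eqI) (use fn_E[OF lam, of "r *\<^sub>R x"] fn_E[OF lam, of x]
      fn_scaleR[of r "E lam x"] in \<open>eventually_elim, simp\<close>)
qed (simp add: norm_E lam)

text \<open>Exponentials are eigenvectors of the truncated left translations, the adjoints of right
  translations on the future. The exponential factors in all Gram matrices below come from
  here.\<close>

lemma fut_sh_E:
  assumes lam: "lam > 0" and t: "0 \<le> t"
  shows "fut (sh t (E lam v)) = exp (- lam * t) *\<^sub>R E lam v"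
proof (rule mul_eqI)
  show "AE s in lebesgue. indicator {0..} s *\<^sub>R fn (sh t (E lam v)) s = fn (exp (- lam * t) *\<^sub>R E lam v) s"
    using fn_sh[of t "E lam v"] AE_lebesgue_translation[OF fn_E[OF lam, of v], of t]
      fn_scaleR[of "exp (- lam * t)" "E lam v"] fn_E[OF lam, of v]
    by eventually_elim (use t in \<open>auto simp: ef_def indicator_def exp_add[symmetric] algebra_simps\<close>)
qed simp

lemma fut_sh_E_neg:
  assumes lam: "lam > 0" and t: "t \<le> 0"
  shows "fut (sh t (E lam v)) = sh t (E lam v)"
proof (rule mul_eqI)
  show "AE s in lebesgue. indicator {0..} s *\<^sub>R fn (sh t (E lam v)) s = fn (sh t (E lam v)) s"
    using fn_sh[of t "E lam v"] AE_lebesgue_translation[OF fn_E[OF lam, of v], of t]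
    by eventually_elim (use t in \<open>auto simp: ef_def indicator_def\<close>)
qed simp

lemma fut_E: "lam > 0 \<Longrightarrow> fut (E lam v) = E lam v"
  using fut_sh_E_neg[of lam 0 v] by simp

lemma fut_fut [simp]: "fut (fut x) = fut x"
  by (simp add: mul_mul indicator_inter_arith[symmetric])

lemma inner_sh_E:
  assumes lam: "lam > 0" and t: "0 \<le> t" and f: "fut f = f"
  shows "inner f (sh t (E lam v)) = exp (- lam * t) * inner f (E lam v)"
proof -
  have "inner f (sh t (E lam v)) = inner (fut f) (sh t (E lam v))" using f by simp
  then show ?thesis by (simp add: inner_mul fut_sh_E[OF lam t])
qed

lemma mul_ef_E:
  assumes "lam > 0" "0 \<le> w"
  shows "mul (ef w) (E lam v) = E (w + lam) v"
proof (rule mul_eqI)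
  show "AE t in lebesgue. ef w t *\<^sub>R fn (E lam v) t = fn (E (w + lam) v) t"
    using fn_E[OF assms(1), of v] fn_E[OF add_nonneg_pos[OF assms(2,1)], of v]
    by eventually_elim (simp add: ef_mult)
qed (use assms in simp)

lemma fut_sh_mono:
  assumes "fut x = x" "0 \<le> t"
  shows "fut (sh (- t) x) = sh (- t) x"
proof (rule mul_eqI)
  have "AE s in lebesgue. fn x s = indicator {0..} s *\<^sub>R fn x s"
    using fn_mul[of "indicator {0..}" x] assms(1) by simp
  from AE_lebesgue_translation[OF this, of "- t"]
  show "AE s in lebesgue. indicator {0..} s *\<^sub>R fn (sh (- t) x) s = fn (sh (- t) x) s"
    using fn_sh[of "-t" x]
    by eventually_elim (use assms(2) in \<open>auto simp: indicator_def split: if_splits\<close>)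
qed simp

lemma mul_ef_sh:
  assumes x: "fut x = x" and t: "0 \<le> t" and w: "0 \<le> w"
  shows "mul (ef w) (sh (- t) x) = exp (- w * t) *\<^sub>R sh (- t) (mul (ef w) x)"
proof (rule mul_eqI)
  have *: "AE s in lebesgue. fn x s = indicator {0..} s *\<^sub>R fn x s"
    using fn_mul[of "indicator {0..}" x] x by simp
  have m: "AE s in lebesgue. fn (mul (ef w) x) s = ef w s *\<^sub>R fn x s"
    using w by (intro fn_mul) simp
  show "AE s in lebesgue. ef w s *\<^sub>R fn (sh (- t) x) s = fn (exp (- w * t) *\<^sub>R sh (- t) (mul (ef w) x)) s"
    using fn_sh[of "-t" x] AE_lebesgue_translation[OF *, of "-t"] AE_lebesgue_translation[OF m, of "-t"]
      fn_sh[of "-t" "mul (ef w) x"] fn_scaleR[of "exp (- w * t)" "sh (- t) (mul (ef w) x)"]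
  proof eventually_elim
    case (elim s)
    show ?case
    proof (cases "- t + s \<ge> 0")
      case True
      then have "ef w s = exp (- w * t) * ef w (- t + s)"
        using t by (simp add: ef_def indicator_def exp_add[symmetric] algebra_simps)
      then show ?thesis using elim by simp
    next
      case False
      then have "fn x (- t + s) = 0" using elim(2) by (simp add: indicator_def)
      then show ?thesis using elim by simp
    qed
  qed
qed (use w in simp)

text \<open>The positive and negative parts of an integrand all of whose integrals over half-lines vanish
  have the same density measure.\<close>

lemma AE_0_if_integrals_Ioi_0:
  fixes h :: "real \<Rightarrow> real"
  assumes int: "\<And>a. integrable lebesgue (\<lambda>t. indicator {a<..} t * h t)"
    and zero: "\<And>a. (\<integral>t. indicator {a<..} t * h t \<partial>lebesgue) = 0"
    and hm: "h \<in> borel_measurable lebesgue"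
  shows "AE t in lebesgue. h t = 0"
proof -
  obtain g where g [measurable]: "g \<in> borel_measurable lborel" and ae: "AE t in lborel. h t = g t"
    using completion_ex_borel_measurable_real[OF hm] by blast
  have ae': "AE t in lebesgue. indicator {a<..} t * h t = indicator {a<..} t * g t" for a
    using AE_completion[OF ae] by eventually_elim simp
  have intg: "integrable lborel (\<lambda>t. indicator {a<..} t * g t)" for a
  proof -
    have "integrable lebesgue (\<lambda>t. indicator {a<..} t * g t)"
      using integrable_cong_AE_imp[OF int[of a] _ ae'] by (simp add: measurable_completion)
    then show ?thesis by (simp add: integrable_completion)
  qed
  have zerog: "(\<integral>t. indicator {a<..} t * g t \<partial>lborel) = 0" for a
  proof -
    have "(\<integral>t. indicator {a<..} t * g t \<partial>lborel) = (\<integral>t. indicator {a<..} t * g t \<partial>lebesgue)"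
      by (rule integral_completion[symmetric]) simp
    also have "\<dots> = (\<integral>t. indicator {a<..} t * h t \<partial>lebesgue)"
    proof (rule integral_cong_AE)
      show "AE t in lebesgue. indicator {a<..} t * g t = indicator {a<..} t * h t"
        using ae'[of a] by eventually_elim (rule sym)
      show "(\<lambda>t. indicator {a<..} t * g t) \<in> borel_measurable lebesgue"
        by (rule measurable_completion) simp
    qed (rule borel_measurable_integrable[OF int])
    finally show ?thesis using zero by simp
  qed
  let ?M = "density lborel (\<lambda>t. ennreal (g t))" and ?N = "density lborel (\<lambda>t. ennreal (- g t))"
  have em: "emeasure ?M {a<..} = (\<integral>\<^sup>+t. ennreal (indicator {a<..} t * g t) \<partial>lborel)" for a
    by (simp add: emeasure_density) (rule nn_integral_cong, auto simp: indicator_def)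
  have en: "emeasure ?N {a<..} = (\<integral>\<^sup>+t. ennreal (- (indicator {a<..} t * g t)) \<partial>lborel)" for a
    by (simp add: emeasure_density) (rule nn_integral_cong, auto simp: indicator_def)
  have fin: "(\<integral>\<^sup>+t. ennreal (indicator {a<..} t * g t) \<partial>lborel) < \<infinity>"
     "(\<integral>\<^sup>+t. ennreal (- (indicator {a<..} t * g t)) \<partial>lborel) < \<infinity>" for a
    using intg[of a] by (simp_all add: real_integrable_def less_top)
  have "?M = ?N"
  proof (rule measure_eqI_lessThan)
    show "emeasure ?M {a<..} = emeasure ?N {a<..}" for a
    proof -
      have "enn2real (\<integral>\<^sup>+t. ennreal (indicator {a<..} t * g t) \<partial>lborel)
          = enn2real (\<integral>\<^sup>+t. ennreal (- (indicator {a<..} t * g t)) \<partial>lborel)"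
        using real_lebesgue_integral_def[OF intg[of a]] zerog[of a] by simp
      then show ?thesis unfolding em en using fin[of a]
        by (metis ennreal_enn2real infinity_ennreal_def)
    qed
    show "emeasure ?M {a<..} < \<infinity>" for a using fin(1)[of a] by (simp only: em)
  qed simp_all
  then have "AE t in lborel. ennreal (g t) = ennreal (- g t)"
    by (intro sigma_finite_measure.density_unique[OF lborel.sigma_finite_measure_axioms]) simp_all
  then have "AE t in lborel. g t = 0"
  proof eventually_elim
    case (elim t)
    show ?case
    proof (cases "g t \<ge> 0")
      case True
      then have "ennreal (g t) = 0" using elim by (simp add: ennreal_neg)
      then show ?thesis using True by (simp add: ennreal_eq_0_iff)
    next
      case False
      then have "ennreal (- g t) = 0" using elim by (simp add: ennreal_neg)
      then show ?thesis using False by (simp add: ennreal_eq_0_iff)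
    qed
  qed
  with ae have "AE t in lborel. h t = 0" by eventually_elim simp
  then show ?thesis by (rule AE_completion)
qed

text \<open>The exceptional null set may depend on \<open>v\<close>, and the space may be
  nonseparable. The values of the simple functions approximating \<open>f\<close> form a countable
  set that is large enough to detect \<open>f\<close>.\<close>

lemma l2_eq_0_if_inner_0:
  fixes f :: "'a::complex_hilbert l2"
  assumes "\<And>v. AE t in lebesgue. inner (fn f t) v = 0"
  shows "f = 0"
proof -
  obtain s where s: "\<And>n::nat. simple_function lebesgue (s n)" "AE t in lebesgue. (\<lambda>n. s n t) \<longlonglongrightarrow> fn f t"
    using strongly_measurable_fn[of f] by (auto simp: strongly_measurable_def)
  define C where "C = (\<Union>n. range (s n))"
  have "finite (range (s n))" for n using s(1)[of n] by (simp add: simple_function_def)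
  then have "countable C" by (auto simp: C_def intro: countable_finite)
  then have "AE t in lebesgue. \<forall>v\<in>C. inner (fn f t) v = 0"
    by (subst AE_ball_countable) (auto intro: assms)
  with s(2) fn_zero[where 'a = 'a] have "AE t in lebesgue. fn f t = fn 0 t"
  proof eventually_elim
    case (elim t)
    have "(\<lambda>n. inner (fn f t) (s n t)) \<longlonglongrightarrow> inner (fn f t) (fn f t)" by (intro tendsto_intros elim)
    moreover have "inner (fn f t) (s n t) = 0" for n using elim by (auto simp: C_def)
    ultimately show ?case using elim by (simp add: LIMSEQ_const_iff)
  qed
  then show ?thesis by (rule l2_eqI)
qed

text \<open>Up to a scalar, pairing with \<open>sh (- a) (E lam v)\<close> integrates
  \<open>exp (- lam * t) * inner (fn f t) v\<close> over the half-line from \<open>a\<close>, and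
  half-lines determine an integrand.\<close>

lemma inner_E_total:
  assumes lam: "lam > 0" and z: "\<And>t v. inner f (sh t (E lam v)) = 0"
  shows "f = 0"
proof (rule l2_eq_0_if_inner_0)
  fix v
  define h where "h t = exp (- lam * t) * inner (fn f t) v" for t
  have fm: "(\<lambda>t. inner (fn f t) v) \<in> borel_measurable lebesgue"
    by (intro borel_measurable_inner_strongly strongly_measurable_const) simp
  have hm: "h \<in> borel_measurable lebesgue"
    unfolding h_def[abs_def] by (intro borel_measurable_times fm measurable_completion) measurable
  have ae: "AE t in lebesgue. indicator {a<..} t * h t = exp (- lam * a) * inner (fn f t) (fn (sh (- a) (E lam v)) t)" for a
  proof -
    \<comment> \<open>The shifted exponential is supported in the closed half-line, whereas the
      indicator is that of the open one.\<close>
    have "AE t in lebesgue. t \<noteq> a"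
      by (intro AE_completion AE_lborel_singleton)
    with fn_sh[of "-a" "E lam v"] AE_lebesgue_translation[OF fn_E[OF lam, of v], of "-a"] show ?thesis
      by eventually_elim (auto simp: h_def ef_def indicator_def exp_add[symmetric] algebra_simps)
  qed
  have int: "integrable lebesgue (\<lambda>t. exp (- lam * a) * inner (fn f t) (fn (sh (- a) (E lam v)) t))" for a
    by (intro integrable_mult_right integrable_inner_square_integrable) simp_all
  have m: "(\<lambda>t. indicator {a<..} t * h t) \<in> borel_measurable lebesgue" for a
    by (intro borel_measurable_times hm measurable_completion) simp
  have "AE t in lebesgue. h t = 0"
  proof (rule AE_0_if_integrals_Ioi_0)
    fix a
    show "integrable lebesgue (\<lambda>t. indicator {a<..} t * h t)"
      using int[of a] ae[of a] m[of a] by (subst integrable_cong_AE[OF _ _ ae]) auto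
    have "(\<integral>t. indicator {a<..} t * h t \<partial>lebesgue) =
        (\<integral>t. exp (- lam * a) * inner (fn f t) (fn (sh (- a) (E lam v)) t) \<partial>lebesgue)"
      using int[of a] by (intro integral_cong_AE m ae) auto
    also have "\<dots> = exp (- lam * a) * inner f (sh (- a) (E lam v))"
      by (simp add: inner_l2_def)
    finally show "(\<integral>t. indicator {a<..} t * h t \<partial>lebesgue) = 0" using z by simp
  qed (rule hm)
  then show "AE t in lebesgue. inner (fn f t) v = 0"
    by eventually_elim (simp add: h_def)
qed

section \<open>Density of shifted exponentials and strong continuity of translations\<close>

definition Eset :: "real \<Rightarrow> 'a::complex_hilbert l2 set" where
  "Eset lam = {sh t (E lam v) | t v. True}"

lemma closure_span_Eset:
  assumes "lam > 0" shows "closure (span (Eset lam)) = UNIV"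
proof (rule subspace_dense_if_orthogonal_trivial)
  fix x :: "'a l2" assume "\<And>s. s \<in> span (Eset lam) \<Longrightarrow> inner x s = 0"
  then show "x = 0" by (intro inner_E_total[OF assms]) (auto simp: Eset_def intro!: span_base)
qed (rule subspace_span)

lemma l2_operator_eqI:
  assumes "bounded_linear P" "bounded_linear Q" "lam > 0"
    and "\<And>t v. P (sh t (E lam v)) = Q (sh t (E lam v))"
  shows "P x = Q x"
  by (rule bounded_linear_eqI_dense[OF assms(1,2) closure_span_Eset[OF assms(3)]])
    (auto simp: Eset_def assms(4))

lemma sh_commute: "sh t (sh r x) = sh r (sh t x)"
  by (simp add: sh_sh add.commute)

text \<open>On shifted exponentials the distance is explicit, by the eigenvector property.
  Translations are isometries, so continuity passes from the dense span to every
  \<open>x\<close>.\<close>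

lemma isCont_sh_0:
  fixes x :: "'a::complex_hilbert l2"
  shows "((\<lambda>t. sh t x) \<longlongrightarrow> x) (at_right 0)"
proof -
  let ?S = "{x :: 'a l2. ((\<lambda>t. sh t x) \<longlongrightarrow> x) (at_right 0)}"
  have sub: "subspace ?S"
    by (rule subspaceI) (auto simp: linear_0[OF linear_sh] linear_add[OF linear_sh] linear_scale[OF linear_sh]
      intro: tendsto_add tendsto_scaleR tendsto_const)
  have "Eset 1 \<subseteq> ?S"
  proof
    fix y :: "'a l2" assume "y \<in> Eset 1"
    then obtain r v where y: "y = sh r (E 1 v)" by (auto simp: Eset_def)
    have "((\<lambda>t. sh t y - y) \<longlongrightarrow> 0) (at_right 0)"
    proof (rule Lim_null_comparison)
      have "norm (sh t y - y) = sqrt ((1 - exp (- t)) * (norm v)\<^sup>2)" if "t > 0" for t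
      proof -
        have "(norm (sh t y - y))\<^sup>2 = 2 * (norm y)\<^sup>2 - 2 * inner y (sh t y)"
          unfolding power2_norm_eq_inner by (simp add: inner_diff_left inner_diff_right inner_commute)
        also have "inner y (sh t y) = inner (E 1 v) (sh t (E 1 v))"
          unfolding y by (simp add: sh_commute[of t r])
        also have "\<dots> = exp (- t) * inner (E 1 v) (E 1 v)"
          using inner_sh_E[of 1 t "E 1 v" v] that by (simp add: fut_E)
        also have "norm y = norm (E 1 v)" by (simp add: y)
        finally have "(norm (sh t y - y))\<^sup>2 = (1 - exp (- t)) * (norm v)\<^sup>2"
          by (simp add: inner_E_E power2_norm_eq_inner algebra_simps)
        then show ?thesis by (metis norm_ge_zero real_sqrt_unique)
      qed
      then show "\<forall>\<^sub>F t in at_right 0. norm (sh t y - y) \<le> sqrt ((1 - exp (- t)) * (norm v)\<^sup>2)"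
        by (intro eventually_mono[OF eventually_at_right_less[of 0]]) simp
      have "((\<lambda>t::real. sqrt ((1 - exp (- t)) * (norm v)\<^sup>2)) \<longlongrightarrow> sqrt ((1 - exp (- 0)) * (norm v)\<^sup>2)) (at_right 0)"
        by (intro tendsto_intros)
      then show "((\<lambda>t::real. sqrt ((1 - exp (- t)) * (norm v)\<^sup>2)) \<longlongrightarrow> 0) (at_right 0)" by simp
    qed
    then show "y \<in> ?S" by (simp add: LIM_zero_iff)
  qed
  then have sp: "span (Eset 1) \<subseteq> ?S" using sub by (rule span_minimal)
  show ?thesis
  proof (rule tendstoI)
    fix e :: real assume e: "e > 0"
    have "x \<in> closure (span (Eset 1))" using closure_span_Eset[where 'a = 'a, of 1] by simp
    then obtain y where y: "y \<in> span (Eset 1)" "dist y x < e / 3"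
      using e by (meson closure_approachable divide_pos_pos zero_less_numeral)
    then have "((\<lambda>t. sh t y) \<longlongrightarrow> y) (at_right 0)" using sp by blast
    then have "\<forall>\<^sub>F t in at_right 0. dist (sh t y) y < e / 3" using e by (intro tendstoD) simp_all
    then show "\<forall>\<^sub>F t in at_right 0. dist (sh t x) x < e"
    proof eventually_elim
      case (elim t)
      have "dist (sh t x) (sh t y) = dist x y"
        by (simp add: dist_norm linear_diff[OF linear_sh, symmetric])
      then have "dist (sh t x) x \<le> dist x y + dist (sh t y) y + dist y x"
        using dist_triangle[of "sh t x" x "sh t y"] dist_triangle[of "sh t y" x y] by linarith
      also have "\<dots> < e" using y(2) elim by (simp add: dist_commute)
      finally show ?case .
    qed
  qed
qed

lemma continuous_on_sh: "continuous_on A (\<lambda>t. sh t x)"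
  unfolding continuous_on_def
proof
  fix r assume "r \<in> A"
  have "((\<lambda>t. sh \<bar>t - r\<bar> x) \<longlongrightarrow> x) (at r)"
  proof (rule filterlim_compose[OF isCont_sh_0])
    show "filterlim (\<lambda>t. \<bar>t - r\<bar>) (at_right 0) (at r)"
      unfolding filterlim_at
      by (auto intro!: tendsto_eq_intros eventually_at_leftI simp: eventually_at_filter)
  qed
  then have "((\<lambda>t. norm (sh \<bar>t - r\<bar> x - x)) \<longlongrightarrow> 0) (at r)"
    by (simp add: tendsto_norm_zero_iff LIM_zero_iff)
  moreover have "norm (sh t x - sh r x) = norm (sh \<bar>t - r\<bar> x - x)" for t
  proof (cases "t \<ge> r")
    case True
    then have "sh t x - sh r x = sh r (sh \<bar>t - r\<bar> x - x)" by (simp add: linear_diff[OF linear_sh] sh_sh)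
    then show ?thesis by simp
  next
    case False
    then have "sh r x - sh t x = sh t (sh \<bar>t - r\<bar> x - x)" by (simp add: linear_diff[OF linear_sh] sh_sh)
    then show ?thesis by (metis norm_minus_commute norm_sh)
  qed
  ultimately have "((\<lambda>t. norm (sh t x - sh r x)) \<longlongrightarrow> 0) (at r)" by simp
  then have "((\<lambda>t. sh t x) \<longlongrightarrow> sh r x) (at r)"
    by (simp only: tendsto_norm_zero_iff LIM_zero_iff)
  then show "((\<lambda>t. sh t x) \<longlongrightarrow> sh r x) (at r within A)"
    by (rule tendsto_within_subset[where S = UNIV, simplified])
qed

section \<open>Causal time-invariant operators\<close>

subsection \<open>Change of the exponential weight\<close>

text \<open>A relation, because multiplication by an unbounded exponential does not map the space
  into itself.\<close>

definition wt :: "real \<Rightarrow> 'a::complex_hilbert l2 \<Rightarrow> 'a l2 \<Rightarrow> bool" where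
  "wt a x y \<longleftrightarrow> (AE t in lebesgue. fn y t = exp (- a * t) *\<^sub>R fn x t)"

lemma wt_add:
  assumes "wt a x y" "wt a x' y'" shows "wt a (x + x') (y + y')"
  using assms fn_add[of x x'] fn_add[of y y'] unfolding wt_def
  by eventually_elim (simp add: scaleR_add_right)

lemma wt_scaleR:
  assumes "wt a x y" shows "wt a (r *\<^sub>R x) (r *\<^sub>R y)"
  using assms fn_scaleR[of r x] fn_scaleR[of r y] unfolding wt_def
  by eventually_elim simp

lemma wt_zero: "wt a 0 (0 :: 'a::complex_hilbert l2)"
  using fn_zero[where 'a = 'a] unfolding wt_def by eventually_elim simp

lemma wt_scaleC:
  assumes "wt a x y" shows "wt a (c *\<^sub>C x) (c *\<^sub>C y)"
  using assms fn_scaleC[of c x] fn_scaleC[of c y] unfolding wt_def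
  by eventually_elim (simp add: scaleR_scaleC_commute)

lemma wt_sh:
  assumes "wt a x y" shows "wt a (sh t x) (exp (a * t) *\<^sub>R sh t y)"
proof -
  have "AE s in lebesgue. fn y (t + s) = exp (- a * (t + s)) *\<^sub>R fn x (t + s)"
    using assms unfolding wt_def by (rule AE_lebesgue_translation)
  then show ?thesis
    unfolding wt_def using fn_sh[of t x] fn_sh[of t y] fn_scaleR[of "exp (a * t)" "sh t y"]
    by eventually_elim (simp add: exp_add[symmetric] algebra_simps)
qed

lemma wt_mul:
  assumes "bounded_measurable \<phi>" "wt a x y" shows "wt a (mul \<phi> x) (mul \<phi> y)"
  using assms(2) fn_mul[OF assms(1), of x] fn_mul[OF assms(1), of y] unfolding wt_def
  by eventually_elim simp

lemma wt_pw:
  assumes "bounded_linear L" "wt a x y" shows "wt a (pw L x) (pw L y)"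
  using assms(2) fn_pw[OF assms(1), of x] fn_pw[OF assms(1), of y] unfolding wt_def
  by eventually_elim (simp add: linear_scale[OF bounded_linear.linear[OF assms(1)]])

lemma wt_unique:
  assumes "wt a x y" "wt a x y'" shows "y = y'"
proof (rule l2_eqI)
  show "AE t in lebesgue. fn y t = fn y' t"
    using assms unfolding wt_def by eventually_elim simp
qed

lemma wt_0_iff: "wt 0 x y \<longleftrightarrow> x = y"
  unfolding wt_def by (auto intro!: l2_eqI elim: eventually_mono)

lemma wt_trans:
  assumes "wt a x y" "wt b y z" shows "wt (a + b) x z"
  using assms unfolding wt_def
  by eventually_elim (simp add: exp_add[symmetric] algebra_simps)

lemma wt_sym:
  assumes "wt a x y" shows "wt (- a) y x"
  using assms unfolding wt_def by eventually_elim (simp add: exp_add[symmetric])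

lemma wt_E:
  assumes "lam > 0" "lam + a > 0" shows "wt a (E lam v) (E (lam + a) v)"
  unfolding wt_def using fn_E[OF assms(1), of v] fn_E[OF assms(2), of v]
  by eventually_elim (simp add: ef_def indicator_def exp_add[symmetric] algebra_simps)

lemma wt_fut:
  assumes "0 \<le> w" "fut x = x" shows "wt w x (mul (ef w) x)"
proof -
  have "AE s in lebesgue. fn x s = indicator {0..} s *\<^sub>R fn x s"
    using fn_mul[of "indicator {0..}" x] assms(2) by simp
  moreover have "AE s in lebesgue. fn (mul (ef w) x) s = ef w s *\<^sub>R fn x s"
    using assms(1) by (intro fn_mul) simp
  ultimately show ?thesis unfolding wt_def
  proof eventually_elim
    case (elim t)
    then show ?case by (cases "0 \<le> t") (simp_all add: ef_def)
  qed
qed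

lemma bounded_measurable_gauss: "bounded_measurable (\<lambda>t. exp (- a * t - t\<^sup>2))"
proof (rule bounded_measurableI[where C = "exp (a\<^sup>2 / 4)"])
  fix t :: real
  have "0 \<le> (t + a / 2)\<^sup>2" by simp
  then have "- a * t - t\<^sup>2 \<le> a\<^sup>2 / 4" by (simp add: power2_eq_square field_simps)
  then show "\<bar>exp (- a * t - t\<^sup>2)\<bar> \<le> exp (a\<^sup>2 / 4)" by simp
qed measurable

text \<open>The Gaussian factor never vanishes and makes both multipliers bounded. The relation thus
  becomes the equality of two bounded operators, which survives limits and resolvents;
  \<open>- 0 * t\<close> keeps the right-hand side an instance of the same multiplier.\<close>

lemma wt_iff_mul: "wt a x y \<longleftrightarrow> mul (\<lambda>t. exp (- a * t - t\<^sup>2)) x = mul (\<lambda>t. exp (- 0 * t - t\<^sup>2)) y"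
proof
  assume "wt a x y"
  then have "AE t in lebesgue. exp (- a * t - t\<^sup>2) *\<^sub>R fn x t = fn (mul (\<lambda>t. exp (- 0 * t - t\<^sup>2)) y) t"
    unfolding wt_def using fn_mul[OF bounded_measurable_gauss[of 0], of y]
    by eventually_elim (simp add: exp_diff exp_minus field_simps)
  then show "mul (\<lambda>t. exp (- a * t - t\<^sup>2)) x = mul (\<lambda>t. exp (- 0 * t - t\<^sup>2)) y"
    by (rule mul_eqI[OF bounded_measurable_gauss])
next
  assume *: "mul (\<lambda>t. exp (- a * t - t\<^sup>2)) x = mul (\<lambda>t. exp (- 0 * t - t\<^sup>2)) y"
  have "AE t in lebesgue. fn (mul (\<lambda>t. exp (- a * t - t\<^sup>2)) x) t = exp (- a * t - t\<^sup>2) *\<^sub>R fn x t"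
    by (rule fn_mul[OF bounded_measurable_gauss])
  moreover have "AE t in lebesgue. fn (mul (\<lambda>t. exp (- a * t - t\<^sup>2)) x) t = exp (- 0 * t - t\<^sup>2) *\<^sub>R fn y t"
    unfolding * by (rule fn_mul[OF bounded_measurable_gauss])
  ultimately show "wt a x y" unfolding wt_def
  proof eventually_elim
    case (elim t)
    then have "exp (t\<^sup>2) *\<^sub>R (exp (- 0 * t - t\<^sup>2) *\<^sub>R fn y t) = exp (t\<^sup>2) *\<^sub>R (exp (- a * t - t\<^sup>2) *\<^sub>R fn x t)"
      by simp
    then show ?case by (simp add: exp_add[symmetric])
  qed
qed

lemma wt_limit:
  assumes "X \<longlonglongrightarrow> x" "Y \<longlonglongrightarrow> y" "\<And>n. wt a (X n) (Y n)"
  shows "wt a x y"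
proof -
  have "(\<lambda>n. mul (\<lambda>t. exp (- a * t - t\<^sup>2)) (X n)) \<longlonglongrightarrow> mul (\<lambda>t. exp (- a * t - t\<^sup>2)) x"
    by (rule bounded_linear.tendsto[OF bounded_linear_mul[OF bounded_measurable_gauss] assms(1)])
  moreover have "(\<lambda>n. mul (\<lambda>t. exp (- 0 * t - t\<^sup>2)) (Y n)) \<longlonglongrightarrow> mul (\<lambda>t. exp (- 0 * t - t\<^sup>2)) y"
    by (rule bounded_linear.tendsto[OF bounded_linear_mul[OF bounded_measurable_gauss] assms(2)])
  ultimately show ?thesis using assms(3) LIMSEQ_unique unfolding wt_iff_mul by simp
qed

text \<open>Exponentials decaying faster than \<open>exp (- a * t)\<close> have preimages under the
  weight, and their shifts already span a dense subspace.\<close>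

lemma wt_E_shift_preimage:
  assumes "lam > 0" "lam > a"
  shows "wt a (exp (- a * t) *\<^sub>R sh t (E (lam - a) v)) (sh t (E lam v))"
  using wt_scaleR[OF wt_sh[OF wt_E[of "lam - a" a v], of t], of "exp (- a * t)"] assms
  by (simp add: exp_add[symmetric])

section \<open>From domination on half-lines to domination in a weighted norm\<close>

lemma nn_integral_exp_tail:
  fixes a t :: real
  assumes a: "a > 0"
  shows "(\<integral>\<^sup>+T. (if t \<le> T then ennreal (2 * a * exp (- (2 * a) * T)) else 0) \<partial>lborel) = ennreal (exp (- (2 * a) * t))"
proof -
  have "((\<lambda>T. exp (- (2 * a) * T)) has_integral exp (- (2 * a) * t) / (2 * a)) {t..}"
    by (rule has_integral_exp_minus_to_infinity) (use a in simp)
  then have "((\<lambda>T. 2 * a * exp (- (2 * a) * T)) has_integral 2 * a * (exp (- (2 * a) * t) / (2 * a))) {t..}"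
    by (rule has_integral_mult_right)
  then have "integral\<^sup>N lborel (\<lambda>T. ennreal (2 * a * exp (- (2 * a) * T)) * indicator {t..} T)
      = ennreal (2 * a * (exp (- (2 * a) * t) / (2 * a)))"
    by (rule nn_integral_has_integral_lebesgue'[rotated]) (use a in simp)
  also have "(\<lambda>T. ennreal (2 * a * exp (- (2 * a) * T)) * indicator {t..} T)
      = (\<lambda>T. if t \<le> T then ennreal (2 * a * exp (- (2 * a) * T)) else 0)"
    by (auto simp: indicator_def)
  finally show ?thesis using a by simp
qed

text \<open>Tonelli's theorem, after the weight at \<open>t\<close> is written as an integral over
  \<open>T \<ge> t\<close>.\<close>

lemma nn_integral_exp_weight:
  fixes h :: "real \<Rightarrow> ennreal"
  assumes a: "a > 0" and h [measurable]: "h \<in> borel_measurable borel"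
  shows "(\<integral>\<^sup>+t. ennreal (exp (- (2 * a) * t)) * h t \<partial>lborel)
    = (\<integral>\<^sup>+T. ennreal (2 * a * exp (- (2 * a) * T)) * (\<integral>\<^sup>+t. (if t \<le> T then h t else 0) \<partial>lborel) \<partial>lborel)"
proof -
  have "(\<integral>\<^sup>+t. ennreal (exp (- (2 * a) * t)) * h t \<partial>lborel)
      = (\<integral>\<^sup>+t. (\<integral>\<^sup>+T. (if t \<le> T then ennreal (2 * a * exp (- (2 * a) * T)) else 0) * h t \<partial>lborel) \<partial>lborel)"
    by (subst nn_integral_multc) (simp_all add: nn_integral_exp_tail[OF a])
  also have "\<dots> = (\<integral>\<^sup>+T. (\<integral>\<^sup>+t. (if t \<le> T then ennreal (2 * a * exp (- (2 * a) * T)) else 0) * h t \<partial>lborel) \<partial>lborel)"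
    by (rule lborel_pair.Fubini') simp
  also have "\<dots> = (\<integral>\<^sup>+T. (\<integral>\<^sup>+t. ennreal (2 * a * exp (- (2 * a) * T)) * (if t \<le> T then h t else 0) \<partial>lborel) \<partial>lborel)"
    by (intro nn_integral_cong) auto
  also have "\<dots> = (\<integral>\<^sup>+T. ennreal (2 * a * exp (- (2 * a) * T)) * (\<integral>\<^sup>+t. (if t \<le> T then h t else 0) \<partial>lborel) \<partial>lborel)"
    by (subst nn_integral_cmult) simp_all
  finally show ?thesis .
qed

text \<open>The interchange of integrals takes place on \<open>lborel\<close>, so the squared norm,
  which is only Lebesgue measurable, is replaced by a Borel function equal to it almost
  everywhere.\<close>

lemma borel_norm2_fn:
  obtains h where "h \<in> borel_measurable borel" "AE t in lebesgue. ennreal ((norm (fn x t))\<^sup>2) = h t"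
    "\<And>T. (\<integral>\<^sup>+t. (if t \<le> T then h t else 0) \<partial>lborel) = ennreal ((norm (mul (indicator {..T}) x))\<^sup>2)"
proof -
  have "(\<lambda>t. ennreal ((norm (fn x t))\<^sup>2)) \<in> borel_measurable lebesgue"
    by (intro measurable_compose[OF _ measurable_ennreal] borel_measurable_norm2_strongly strongly_measurable_fn)
  from completion_ex_borel_measurable[OF this]
  obtain h where h: "h \<in> borel_measurable borel" and ae: "AE t in lborel. ennreal ((norm (fn x t))\<^sup>2) = h t"
    by auto
  have "(\<integral>\<^sup>+t. (if t \<le> T then h t else 0) \<partial>lborel) = ennreal ((norm (mul (indicator {..T}) x))\<^sup>2)" for T
  proof -
    have "(\<integral>\<^sup>+t. (if t \<le> T then h t else 0) \<partial>lborel) = (\<integral>\<^sup>+t. (if t \<le> T then h t else 0) \<partial>lebesgue)"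
      by (simp add: nn_integral_completion)
    also have "\<dots> = (\<integral>\<^sup>+t. ennreal ((norm (fn (mul (indicator {..T}) x) t))\<^sup>2) \<partial>lebesgue)"
    proof (rule nn_integral_cong_AE)
      have "AE t in lebesgue. fn (mul (indicator {..T}) x) t = indicator {..T} t *\<^sub>R fn x t"
        by (rule fn_mul) simp
      with AE_completion[OF ae]
      show "AE t in lebesgue. (if t \<le> T then h t else 0) = ennreal ((norm (fn (mul (indicator {..T}) x) t))\<^sup>2)"
        by eventually_elim (auto simp: indicator_def)
    qed
    finally show ?thesis by (simp add: nn_integral_fn)
  qed
  then show thesis using that h AE_completion[OF ae] by blast
qed

lemma nn_integral_wt:
  assumes h: "h \<in> borel_measurable borel" "AE t in lebesgue. ennreal ((norm (fn x t))\<^sup>2) = h t"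
  shows "(\<integral>\<^sup>+t. ennreal ((norm (exp (- a * t) *\<^sub>R fn x t))\<^sup>2) \<partial>lebesgue) = (\<integral>\<^sup>+t. ennreal (exp (- (2 * a) * t)) * h t \<partial>lborel)"
proof -
  have "(\<integral>\<^sup>+t. ennreal ((norm (exp (- a * t) *\<^sub>R fn x t))\<^sup>2) \<partial>lebesgue) = (\<integral>\<^sup>+t. ennreal (exp (- (2 * a) * t)) * h t \<partial>lebesgue)"
  proof (rule nn_integral_cong_AE)
    show "AE t in lebesgue. ennreal ((norm (exp (- a * t) *\<^sub>R fn x t))\<^sup>2) = ennreal (exp (- (2 * a) * t)) * h t"
      using h(2)
    proof eventually_elim
      case (elim t)
      have "(exp (- a * t))\<^sup>2 = exp (- (2 * a) * t)" by (simp add: power2_eq_square exp_add[symmetric])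
      then have "(norm (exp (- a * t) *\<^sub>R fn x t))\<^sup>2 = exp (- (2 * a) * t) * (norm (fn x t))\<^sup>2"
        by (simp add: power_mult_distrib)
      then show ?case by (simp add: ennreal_mult elim)
    qed
  qed
  then show ?thesis by (simp add: nn_integral_completion)
qed

text \<open>The squared weight \<open>exp (- 2 a t)\<close> is a mixture of indicators of half-lines \<open>{..T}\<close>, so domination
  on all half-lines carries over to the weighted norm.\<close>

lemma wt_domination:
  assumes dom: "\<And>T. norm (mul (indicator {..T}) z) \<le> K * norm (mul (indicator {..T}) x)"
    and wt: "wt a x y" and a: "a > 0" and K: "0 \<le> K"
  shows "\<exists>w. wt a z w \<and> norm w \<le> K * norm y"
proof -
  obtain hx where hx: "hx \<in> borel_measurable borel" "AE t in lebesgue. ennreal ((norm (fn x t))\<^sup>2) = hx t"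
    "\<And>T. (\<integral>\<^sup>+t. (if t \<le> T then hx t else 0) \<partial>lborel) = ennreal ((norm (mul (indicator {..T}) x))\<^sup>2)"
    using borel_norm2_fn[of x] by blast
  obtain hz where hz: "hz \<in> borel_measurable borel" "AE t in lebesgue. ennreal ((norm (fn z t))\<^sup>2) = hz t"
    "\<And>T. (\<integral>\<^sup>+t. (if t \<le> T then hz t else 0) \<partial>lborel) = ennreal ((norm (mul (indicator {..T}) z))\<^sup>2)"
    using borel_norm2_fn[of z] by blast
  let ?z = "\<lambda>t. exp (- a * t) *\<^sub>R fn z t"
  have "(\<integral>\<^sup>+t. ennreal ((norm (?z t))\<^sup>2) \<partial>lebesgue)
      = (\<integral>\<^sup>+T. ennreal (2 * a * exp (- (2 * a) * T)) * ennreal ((norm (mul (indicator {..T}) z))\<^sup>2) \<partial>lborel)"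
    unfolding nn_integral_wt[OF hz(1,2)] nn_integral_exp_weight[OF a hz(1)] hz(3) by simp
  also have "\<dots> \<le> (\<integral>\<^sup>+T. ennreal (K\<^sup>2) * (ennreal (2 * a * exp (- (2 * a) * T)) * ennreal ((norm (mul (indicator {..T}) x))\<^sup>2)) \<partial>lborel)"
  proof (rule nn_integral_mono)
    fix T
    have "(norm (mul (indicator {..T}) z))\<^sup>2 \<le> K\<^sup>2 * (norm (mul (indicator {..T}) x))\<^sup>2"
      using power_mono[OF dom norm_ge_zero, of T 2] by (simp add: power_mult_distrib)
    then have "ennreal ((norm (mul (indicator {..T}) z))\<^sup>2) \<le> ennreal (K\<^sup>2) * ennreal ((norm (mul (indicator {..T}) x))\<^sup>2)"
      by (simp add: ennreal_mult[symmetric] ennreal_leI)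
    then show "ennreal (2 * a * exp (- (2 * a) * T)) * ennreal ((norm (mul (indicator {..T}) z))\<^sup>2)
      \<le> ennreal (K\<^sup>2) * (ennreal (2 * a * exp (- (2 * a) * T)) * ennreal ((norm (mul (indicator {..T}) x))\<^sup>2))"
      by (metis mult.left_commute mult_left_mono zero_le)
  qed
  also have "\<dots> = ennreal (K\<^sup>2) * (\<integral>\<^sup>+T. ennreal (2 * a * exp (- (2 * a) * T)) * ennreal ((norm (mul (indicator {..T}) x))\<^sup>2) \<partial>lborel)"
  proof (rule nn_integral_cmult)
    have [measurable]: "hx \<in> borel_measurable borel" by (rule hx)
    have "(\<lambda>T. \<integral>\<^sup>+t. (if t \<le> T then hx t else 0) \<partial>lborel) \<in> borel_measurable lborel" by measurable
    then have [measurable]: "(\<lambda>T. ennreal ((norm (mul (indicator {..T}) x))\<^sup>2)) \<in> borel_measurable lborel"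
      by (simp only: hx(3))
    show "(\<lambda>T. ennreal (2 * a * exp (- (2 * a) * T)) * ennreal ((norm (mul (indicator {..T}) x))\<^sup>2)) \<in> borel_measurable lborel"
      by measurable
  qed
  also have "\<dots> = ennreal (K\<^sup>2) * (\<integral>\<^sup>+t. ennreal ((norm (exp (- a * t) *\<^sub>R fn x t))\<^sup>2) \<partial>lebesgue)"
    unfolding nn_integral_wt[OF hx(1,2)] nn_integral_exp_weight[OF a hx(1)] hx(3) by simp
  also have "(\<integral>\<^sup>+t. ennreal ((norm (exp (- a * t) *\<^sub>R fn x t))\<^sup>2) \<partial>lebesgue) = ennreal ((norm y)\<^sup>2)"
    unfolding nn_integral_fn[symmetric]
    by (rule nn_integral_norm_cong_AE) (use wt in \<open>auto simp: wt_def elim: eventually_mono\<close>)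
  finally have le: "(\<integral>\<^sup>+t. ennreal ((norm (?z t))\<^sup>2) \<partial>lebesgue) \<le> ennreal ((K * norm y)\<^sup>2)"
    by (simp add: ennreal_mult[symmetric] power_mult_distrib)
  have "strongly_measurable ?z"
    by (intro strongly_measurable_scaleR measurable_completion strongly_measurable_fn) simp
  then have sq: "square_integrable ?z"
    using le_less_trans[OF le ennreal_less_top] by (simp add: square_integrable_def)
  have "wt a z (L2 ?z)" unfolding wt_def by (rule fn_L2[OF sq])
  moreover have "norm (L2 ?z) \<le> K * norm y"
    using le K unfolding nn_integral_L2[OF sq] by (auto simp: ennreal_le_iff intro: power2_le_imp_le)
  ultimately show ?thesis by blast
qed

text \<open>Conjugation by the weight turns the operators of every \<open>TIC_op w\<close> into
  these: the scalar factor that a translation picks up cancels, and supports do not change. One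
  notion on the unweighted space therefore serves all \<open>w\<close>.\<close>

definition tico :: "('a::complex_hilbert l2 \<Rightarrow> 'b::complex_hilbert l2) \<Rightarrow> bool" where
  "tico Q \<longleftrightarrow> bounded_linear Q \<and> (\<forall>c x. Q (c *\<^sub>C x) = c *\<^sub>C Q x) \<and> (\<forall>t x. Q (sh t x) = sh t (Q x)) \<and>
     (\<forall>x. fut x = x \<longrightarrow> fut (Q x) = Q x)"

lemma tico_bounded_linear: "tico Q \<Longrightarrow> bounded_linear Q" by (simp add: tico_def)
lemma tico_linear: "tico Q \<Longrightarrow> linear Q" by (simp add: tico_def bounded_linear.linear)
lemma tico_scaleC: "tico Q \<Longrightarrow> Q (c *\<^sub>C x) = c *\<^sub>C Q x" by (simp add: tico_def)
lemma tico_sh: "tico Q \<Longrightarrow> Q (sh t x) = sh t (Q x)" by (simp add: tico_def)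
lemma tico_causal: "tico Q \<Longrightarrow> fut x = x \<Longrightarrow> fut (Q x) = Q x" by (simp add: tico_def)

text \<open>Causality at time 0, carried to time \<open>T\<close> by translation invariance: what
  \<open>x\<close> does after \<open>T\<close> can only affect \<open>Q x\<close> after
  \<open>T\<close>.\<close>

lemma tico_truncation:
  assumes Q: "tico Q"
  shows "mul (indicator {..T}) (Q x) = mul (indicator {..T}) (Q (mul (indicator {..T}) x))"
proof -
  have split: "mul (indicator {..T}) x + mul (indicator {T<..}) x = x" for x :: "'c::complex_hilbert l2"
  proof (rule l2_eqI)
    have "AE s in lebesgue. fn (mul (indicator {..T}) x) s = indicator {..T} s *\<^sub>R fn x s"
      "AE s in lebesgue. fn (mul (indicator {T<..}) x) s = indicator {T<..} s *\<^sub>R fn x s"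
      by (intro fn_mul; simp)+
    then show "AE s in lebesgue. fn (mul (indicator {..T}) x + mul (indicator {T<..}) x) s = fn x s"
      using fn_add[of "mul (indicator {..T}) x" "mul (indicator {T<..}) x"]
      by eventually_elim (auto simp: indicator_def)
  qed
  define w where "w = mul (indicator {T<..}) x"
  have "fut (sh T w) = sh T w"
  proof (rule mul_eqI)
    have "AE s in lebesgue. fn w s = indicator {T<..} s *\<^sub>R fn x s"
      unfolding w_def by (rule fn_mul) simp
    from AE_lebesgue_translation[OF this, of T]
    show "AE s in lebesgue. indicator {0..} s *\<^sub>R fn (sh T w) s = fn (sh T w) s"
      using fn_sh[of T w] by eventually_elim (auto simp: indicator_def)
  qed simp
  then have fQ: "fut (sh T (Q w)) = sh T (Q w)"
    using tico_causal[OF Q, of "sh T w"] by (simp add: tico_sh[OF Q])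
  have "mul (indicator {..T}) (Q w) = 0"
  proof (rule mul_eqI)
    have "AE s in lebesgue. fn (fut (sh T (Q w))) s = indicator {0..} s *\<^sub>R fn (sh T (Q w)) s"
      by (rule fn_mul) simp
    then have "AE s in lebesgue. fn (sh T (Q w)) s = indicator {0..} s *\<^sub>R fn (sh T (Q w)) s"
      unfolding fQ .
    with fn_sh[of T "Q w"] have "AE s in lebesgue. s < 0 \<longrightarrow> fn (Q w) (T + s) = 0"
      by eventually_elim (auto simp: indicator_def)
    from AE_lebesgue_translation[OF this, of "- T"]
    have "AE s in lebesgue. s < T \<longrightarrow> fn (Q w) s = 0" by eventually_elim auto
    \<comment> \<open>Support in the future is closed at 0, so after the shift the endpoint
      \<open>T\<close>, which belongs to the indicator, is excluded as a null set.\<close>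
    moreover have "AE s in lebesgue. s \<noteq> T" by (intro AE_completion AE_lborel_singleton)
    ultimately show "AE s in lebesgue. indicator {..T} s *\<^sub>R fn (Q w) s = fn 0 s"
      using fn_zero[where 'a = 'b] by eventually_elim (auto simp: indicator_def)
  qed simp
  moreover have "Q x = Q (mul (indicator {..T}) x) + Q w"
    using split[of x] linear_add[OF tico_linear[OF Q], of "mul (indicator {..T}) x" w] by (simp add: w_def)
  ultimately show ?thesis
    by (simp add: linear_add[OF bounded_linear.linear[OF bounded_linear_mul]])
qed

lemma tico_truncation_bound:
  assumes Q: "tico Q" and K: "\<And>x. norm (Q x) \<le> K * norm x"
  shows "norm (mul (indicator {..T}) (Q x)) \<le> K * norm (mul (indicator {..T}) x)"
proof -
  have "norm (mul (indicator {..T}) (Q x)) \<le> 1 * norm (Q (mul (indicator {..T}) x))"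
    unfolding tico_truncation[OF Q, of T x]
    by (rule norm_mul_le) (auto simp: indicator_def)
  also have "\<dots> \<le> K * norm (mul (indicator {..T}) x)" using K by simp
  finally show ?thesis .
qed

text \<open>The inclusion of stable causal operators into those with a larger weight, with the same
  norm bound. Causality gives the bound on every \<open>{..T}\<close>, and averaging over
  \<open>T\<close> gives it for the weighted norm; the sign of \<open>a\<close> matters for that
  averaging.\<close>

lemma tico_extension:
  fixes Q :: "'a::complex_hilbert l2 \<Rightarrow> 'b::complex_hilbert l2"
  assumes Q: "tico Q" and a: "0 \<le> a"
  shows "\<exists>Q'. tico Q' \<and> (\<forall>x y. wt a x y \<longrightarrow> wt a (Q x) (Q' y))"
proof (cases "a = 0")
  case True
  then show ?thesis using Q by (auto simp: wt_0_iff)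
next
  case False
  then have a: "a > 0" using a by simp
  obtain K where K: "K > 0" "\<And>x. norm (Q x) \<le> norm x * K"
    using bounded_linear.pos_bounded[OF tico_bounded_linear[OF Q]] by blast
  have Kx: "norm (Q x) \<le> K * norm x" for x using K(2)[of x] by (simp add: mult.commute)
  have ex: "\<exists>z. wt a (Q x) z \<and> norm z \<le> K * norm y" if "wt a x y" for x y
    by (rule wt_domination[OF tico_truncation_bound[OF Q Kx] that a]) (use K in simp)
  define R where "R = {(y, z). \<exists>x. wt a x y \<and> wt a (Q x) z}"
  note lin = tico_linear[OF Q]
  have sub: "subspace R"
  proof (rule subspaceI)
    have "wt a 0 0 \<and> wt a (Q 0) 0" by (simp add: linear_0[OF lin] wt_zero)
    then show "0 \<in> R" unfolding R_def zero_prod_def by blast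
  next
    fix p q assume "p \<in> R" "q \<in> R"
    then obtain x x' where "wt a x (fst p)" "wt a (Q x) (snd p)" "wt a x' (fst q)" "wt a (Q x') (snd q)"
      by (auto simp: R_def)
    then have "wt a (x + x') (fst (p + q))" "wt a (Q (x + x')) (snd (p + q))"
      by (simp_all add: linear_add[OF lin] wt_add)
    then show "p + q \<in> R" by (auto simp: R_def case_prod_unfold)
  next
    fix c and p assume "p \<in> R"
    then obtain x where "wt a x (fst p)" "wt a (Q x) (snd p)" by (auto simp: R_def)
    then have "wt a (c *\<^sub>R x) (fst (c *\<^sub>R p))" "wt a (Q (c *\<^sub>R x)) (snd (c *\<^sub>R p))"
      by (simp_all add: linear_scale[OF lin] wt_scaleR)
    then show "c *\<^sub>R p \<in> R" by (auto simp: R_def case_prod_unfold)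
  qed
  \<comment> \<open>With exponent \<open>a + 1\<close>, removing the weight \<open>a\<close> still
    leaves decay at rate 1.\<close>
  have dom: "sh t (E (a + 1) v) \<in> fst ` R" for t v
  proof -
    have w: "wt a (exp (- a * t) *\<^sub>R sh t (E (a + 1 - a) v)) (sh t (E (a + 1) v))"
      by (rule wt_E_shift_preimage) (use a in auto)
    from ex[OF w] w show ?thesis by (force simp: R_def)
  qed
  have "span (Eset (a + 1)) \<subseteq> fst ` R"
    by (rule span_minimal) (use dom in \<open>auto simp: Eset_def\<close>, rule linear_subspace_image[OF linear_fst sub])
  then have D: "closure (fst ` R) = UNIV"
    using closure_mono[of "span (Eset (a + 1))" "fst ` R"] closure_span_Eset[of "a + 1"] a by auto
  have bd: "norm z \<le> K * norm y" if yz: "(y, z) \<in> R" for y z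
  proof -
    obtain x where x: "wt a x y" "wt a (Q x) z" using yz by (auto simp: R_def)
    obtain z' where "wt a (Q x) z'" "norm z' \<le> K * norm y" using ex[OF x(1)] by blast
    then show ?thesis using wt_unique[OF x(2)] by simp
  qed
  obtain Q' where Q': "bounded_linear Q'" "\<And>y z. (y, z) \<in> R \<Longrightarrow> Q' y = z"
    using bounded_linear_relation_extension[OF sub bd D] by blast
  have wtQ: "wt a (Q x) (Q' y)" if "wt a x y" for x y
    using ex[OF that] Q'(2)[of y] that by (auto simp: R_def)
  have Q'I: "Q' y = z" if "wt a x y" "wt a (Q x) z" for x y z
    using wtQ[OF that(1)] that(2) by (rule wt_unique)
  have pre: "\<exists>x. wt a x (sh t (E (a + 1) v))" for t and v :: 'a
    using dom[of t v] by (auto simp: R_def)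
  have pos: "a + 1 > 0" using a by simp
  have "tico Q'"
    unfolding tico_def
  proof (intro conjI allI impI)
    show "Q' (c *\<^sub>C y) = c *\<^sub>C Q' y" for c y
    proof (rule l2_operator_eqI[OF _ _ pos, of "\<lambda>y. Q' (c *\<^sub>C y)" "\<lambda>y. c *\<^sub>C Q' y"])
      show "bounded_linear (\<lambda>y. Q' (c *\<^sub>C y))" "bounded_linear (\<lambda>y. c *\<^sub>C Q' y)"
        by (rule bounded_linear_compose[OF Q'(1) bounded_linear_scaleC]
            bounded_linear_compose[OF bounded_linear_scaleC Q'(1)])+
      fix t and v :: 'a
      obtain x where x: "wt a x (sh t (E (a + 1) v))" using pre by blast
      show "Q' (c *\<^sub>C sh t (E (a + 1) v)) = c *\<^sub>C Q' (sh t (E (a + 1) v))"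
        by (rule Q'I[OF wt_scaleC[OF x]]) (simp add: tico_scaleC[OF Q] wt_scaleC wtQ x)
    qed
    show "Q' (sh s y) = sh s (Q' y)" for s y
    proof (rule l2_operator_eqI[OF _ _ pos, of "\<lambda>y. Q' (sh s y)" "\<lambda>y. sh s (Q' y)"])
      show "bounded_linear (\<lambda>y. Q' (sh s y))" "bounded_linear (\<lambda>y. sh s (Q' y))"
        by (rule bounded_linear_compose[OF Q'(1) bounded_linear_sh]
            bounded_linear_compose[OF bounded_linear_sh Q'(1)])+
      fix t and v :: 'a
      obtain x where x: "wt a x (sh t (E (a + 1) v))" using pre by blast
      have "Q' (exp (a * s) *\<^sub>R sh s (sh t (E (a + 1) v))) = exp (a * s) *\<^sub>R sh s (Q' (sh t (E (a + 1) v)))"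
        by (rule Q'I[OF wt_sh[OF x]]) (simp add: tico_sh[OF Q] wt_sh wtQ x)
      then show "Q' (sh s (sh t (E (a + 1) v))) = sh s (Q' (sh t (E (a + 1) v)))"
        by (simp add: linear_scale[OF bounded_linear.linear[OF Q'(1)]])
    qed
    show "fut (Q' y) = Q' y" if y: "fut y = y" for y
    proof -
      have bf: "bounded_linear (mul (indicator {0..}))" by (rule bounded_linear_mul) simp
      have "fut (Q' (fut y)) = Q' (fut y)"
      proof (rule l2_operator_eqI[OF _ _ pos, of "\<lambda>y. fut (Q' (fut y))" "\<lambda>y. Q' (fut y)"])
        show "bounded_linear (\<lambda>y. fut (Q' (fut y)))" "bounded_linear (\<lambda>y. Q' (fut y))"
          by (intro bounded_linear_compose[OF bf] bounded_linear_compose[OF Q'(1) bf])+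
        fix t and v :: 'a
        obtain x where x: "wt a x (sh t (E (a + 1) v))" using pre by blast
        then have fx: "wt a (fut x) (fut (sh t (E (a + 1) v)))" by (intro wt_mul) simp
        have "wt a (fut (Q (fut x))) (fut (Q' (fut (sh t (E (a + 1) v)))))"
          by (intro wt_mul wtQ fx) simp
        moreover have "fut (Q (fut x)) = Q (fut x)" by (rule tico_causal[OF Q]) simp
        ultimately have "wt a (Q (fut x)) (fut (Q' (fut (sh t (E (a + 1) v)))))" by (simp only:)
        from Q'I[OF fx this]
        show "fut (Q' (fut (sh t (E (a + 1) v)))) = Q' (fut (sh t (E (a + 1) v)))" by (rule sym)
      qed
      then show ?thesis using y by simp
    qed
  qed (rule Q'(1))
  then show ?thesis using wtQ by (intro exI[of _ Q'] conjI allI impI)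
qed

section \<open>Orthogonal projections\<close>

definition proj :: "'a::{real_inner,banach} set \<Rightarrow> 'a \<Rightarrow> 'a" where
  "proj S x = (SOME p. p \<in> S \<and> (\<forall>s\<in>S. inner (x - p) s = 0))"

context
  fixes S :: "'a::{real_inner,banach} set"
  assumes S: "subspace S" "closed S"
begin

lemma proj_in: "proj S x \<in> S" and proj_orth: "s \<in> S \<Longrightarrow> inner (x - proj S x) s = 0"
proof -
  have "proj S x \<in> S \<and> (\<forall>s\<in>S. inner (x - proj S x) s = 0)"
    unfolding proj_def by (rule someI_ex) (use closed_subspace_projection[OF S] in blast)
  then show "proj S x \<in> S" "s \<in> S \<Longrightarrow> inner (x - proj S x) s = 0" by auto
qed

lemma proj_eqI:
  assumes p: "p \<in> S" and o: "\<And>s. s \<in> S \<Longrightarrow> inner (x - p) s = 0"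
  shows "proj S x = p"
proof -
  have d: "proj S x - p \<in> S" using subspace_diff[OF S(1) proj_in p] .
  have "inner (proj S x - p) (proj S x - p) = inner (x - p) (proj S x - p) - inner (x - proj S x) (proj S x - p)"
    by (simp add: inner_diff_left)
  also have "\<dots> = 0" using o[OF d] proj_orth[OF d] by simp
  finally show ?thesis by simp
qed

lemma inner_proj: "s \<in> S \<Longrightarrow> inner (proj S x) s = inner x s"
  using proj_orth[of s x] by (simp add: inner_diff_left)

lemma norm_proj_pythagoras: "(norm x)\<^sup>2 = (norm (proj S x))\<^sup>2 + (norm (x - proj S x))\<^sup>2"
  using proj_orth[OF proj_in, of x x] unfolding power2_norm_eq_inner
  by (simp add: inner_diff_left inner_diff_right inner_commute)

lemma norm_proj_le: "norm (proj S x) \<le> norm x"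
proof (rule power2_le_imp_le)
  show "(norm (proj S x))\<^sup>2 \<le> (norm x)\<^sup>2"
    using norm_proj_pythagoras[of x] zero_le_power2[of "norm (x - proj S x)"] by linarith
qed simp

lemma bounded_linear_proj: "bounded_linear (proj S)"
proof (rule bounded_linear_intro[where K = 1])
  show "proj S (x + y) = proj S x + proj S y" for x y
    by (rule proj_eqI) (simp_all add: subspace_add[OF S(1)] proj_in inner_diff_left inner_add_left inner_proj)
  show "proj S (r *\<^sub>R x) = r *\<^sub>R proj S x" for r x
    by (rule proj_eqI) (simp_all add: subspace_scale[OF S(1)] proj_in inner_diff_left inner_proj)
qed (simp add: norm_proj_le)

lemma norm_diff_proj_le:
  assumes "s \<in> S" shows "norm (x - proj S x) \<le> norm (x - s)"
proof -
  have "proj S (x - s) = proj S x - s"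
    using linear_diff[OF bounded_linear.linear[OF bounded_linear_proj]] proj_eqI[of s s] assms by simp
  then have "(norm (x - s))\<^sup>2 = (norm (proj S x - s))\<^sup>2 + (norm (x - proj S x))\<^sup>2"
    using norm_proj_pythagoras[of "x - s"] by simp
  then have "(norm (x - proj S x))\<^sup>2 \<le> (norm (x - s))\<^sup>2"
    using zero_le_power2[of "norm (proj S x - s)"] by linarith
  then show ?thesis by (rule power2_le_imp_le) simp
qed

end

section \<open>Resolvents of the translation semigroup\<close>

text \<open>Unlike \<open>resolvent_commute\<close>, this allows a bounded operator on either side,
  which suits the change of weight: it is available only as an equality
  \<open>P x = Q y\<close>.\<close>

lemma resolvent_intertwine:
  assumes "contraction_semigroup U lam" and "contraction_semigroup V mu"
    and P: "bounded_linear P" and Q: "bounded_linear Q"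
    and eq: "\<And>r. 0 \<le> r \<Longrightarrow> P (U r x) = Q (V r y)"
  shows "P (contraction_semigroup.resolvent U x) = Q (contraction_semigroup.resolvent V y)"
proof -
  interpret U: contraction_semigroup U lam by fact
  interpret V: contraction_semigroup V mu by fact
  have "P (U.J (real n) x) = Q (V.J (real n) y)" for n
    unfolding U.J_bounded_linear_image[OF P] V.J_bounded_linear_image[OF Q]
    by (rule integral_cong) (use eq in auto)
  moreover have "(\<lambda>n. P (U.J (real n) x)) \<longlonglongrightarrow> P (U.resolvent x)"
    by (rule bounded_linear.tendsto[OF P U.J_sums(2)])
  moreover have "(\<lambda>n. Q (V.J (real n) y)) \<longlonglongrightarrow> Q (V.resolvent y)"
    by (rule bounded_linear.tendsto[OF Q V.J_sums(2)])
  ultimately show ?thesis using LIMSEQ_unique by auto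
qed

definition esh :: "real \<Rightarrow> real \<Rightarrow> 'a::complex_hilbert l2 \<Rightarrow> 'a l2" where
  "esh lam t x = exp (- lam * t) *\<^sub>R sh t x"

lemma contraction_semigroup_esh:
  assumes "lam > 0"
  shows "contraction_semigroup (esh lam :: real \<Rightarrow> 'a::complex_hilbert l2 \<Rightarrow> 'a l2) lam"
proof -
  have 1: "bounded_linear (esh lam t :: 'a l2 \<Rightarrow> 'a l2)" for t
    unfolding esh_def[abs_def]
    by (intro bounded_linear_scaleR_right[THEN bounded_linear_compose] bounded_linear_sh)
  have 2: "continuous_on {0..} (\<lambda>t. esh lam t x)" for x :: "'a l2"
    unfolding esh_def by (intro continuous_intros continuous_on_sh)
  show ?thesis
    by (rule contraction_semigroup.intro; (rule 1 2 assms)?)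
      (simp_all add: esh_def sh_sh linear_scale[OF linear_sh] exp_add[symmetric] algebra_simps)
qed

text \<open>On Fourier-Laplace transforms this is division by \<open>lam - s\<close>.\<close>

definition Res :: "real \<Rightarrow> 'a::complex_hilbert l2 \<Rightarrow> 'a l2" where
  "Res lam = contraction_semigroup.resolvent (esh lam)"

text \<open>By \<open>inner_sh_E\<close>, a function supported in the future would produce the first
  term alone. The second term is the obstruction, proportional to the transform of \<open>f\<close>
  at \<open>lam\<close>.\<close>

lemma inner_Res_sh_E:
  assumes lam: "lam > 0" and f: "fut f = f" and t: "0 \<le> t"
  shows "inner (Res lam f) (sh t (E lam v)) = exp (- lam * t) * inner (Res lam f) (E lam v) + t * exp (- lam * t) * inner f (E lam v)"
proof -
  interpret contraction_semigroup "esh lam" lam by (rule contraction_semigroup_esh[OF lam])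
  let ?e = "sh t (E lam v)"
  have "Res lam f = esh lam t (Res lam f) + J t f"
    using U_resolvent[OF t, of f] by (simp add: Res_def)
  then have "inner (Res lam f) ?e = inner (esh lam t (Res lam f)) ?e + inner (J t f) ?e"
    by (metis inner_add_left)
  also have "inner (esh lam t (Res lam f)) ?e = exp (- lam * t) * inner (Res lam f) (E lam v)"
    by (simp add: esh_def)
  also have "inner (J t f) ?e = integral {0..t} (\<lambda>r. inner (esh lam r f) ?e)"
    by (rule J_bounded_linear_image[OF bounded_linear_inner_left])
  also have "\<dots> = integral {0..t} (\<lambda>r. exp (- lam * t) * inner f (E lam v))"
  proof (rule integral_cong)
    fix r assume r: "r \<in> {0..t}"
    have "inner (esh lam r f) ?e = exp (- lam * r) * inner f (sh (t - r) (E lam v))"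
      by (simp add: esh_def inner_sh sh_sh)
    also have "\<dots> = exp (- lam * r) * (exp (- lam * (t - r)) * inner f (E lam v))"
      using inner_sh_E[OF lam _ f, of "t - r" v] r by simp
    also have "\<dots> = exp (- lam * t) * inner f (E lam v)"
    proof -
      have "exp (- lam * r) * exp (- lam * (t - r)) = exp (- lam * t)"
        by (simp add: exp_add[symmetric] algebra_simps)
      then show ?thesis by (simp only: mult.assoc[symmetric])
    qed
    finally show "inner (esh lam r f) ?e = exp (- lam * t) * inner f (E lam v)" .
  qed
  also have "\<dots> = t * exp (- lam * t) * inner f (E lam v)" using t by simp
  finally show ?thesis .
qed

text \<open>The zero of the transform at \<open>lam\<close> cancels the pole introduced by the
  resolvent.\<close>

lemma fut_Res:
  assumes lam: "lam > 0" and f: "fut f = f" and z: "\<And>v. inner f (E lam v) = 0"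
  shows "fut (Res lam f) = Res lam f"
proof -
  have "inner (Res lam f - fut (Res lam f)) (sh t (E lam v)) = 0" for t v
  proof (cases "0 \<le> t")
    case True
    then show ?thesis
      using inner_Res_sh_E[OF lam f True, of v] z
      by (simp add: inner_diff_left inner_mul fut_sh_E[OF lam])
  next
    case False
    then show ?thesis by (simp add: inner_diff_left inner_mul fut_sh_E_neg[OF lam])
  qed
  then have "Res lam f - fut (Res lam f) = 0" by (rule inner_E_total[OF lam])
  then show ?thesis by simp
qed

text \<open>Conversely, a remaining pole would show; comparison of the two pairing formulas at
  \<open>t = 1\<close> isolates its residue.\<close>

lemma inner_E_eq_0_if_fut_Res:
  assumes lam: "lam > 0" and f: "fut f = f" and R: "fut (Res lam f) = Res lam f"
  shows "inner f (E lam v) = 0"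
  using inner_Res_sh_E[OF lam f, of 1 v] inner_sh_E[OF lam _ R, of 1 v] by simp

text \<open>The weight \<open>w\<close> translates the spectral variable, so the point
  \<open>w + mu\<close> becomes \<open>mu\<close>.\<close>

lemma wt_Res:
  assumes "wt w x y" "mu > 0" "w + mu > 0"
  shows "wt w (Res (w + mu) x) (Res mu y)"
  unfolding wt_iff_mul Res_def
proof (rule resolvent_intertwine[OF contraction_semigroup_esh[OF assms(3)] contraction_semigroup_esh[OF assms(2)]
      bounded_linear_mul[OF bounded_measurable_gauss] bounded_linear_mul[OF bounded_measurable_gauss]])
  fix r :: real
  have "wt w (exp (- (w + mu) * r) *\<^sub>R sh r x) (exp (- (w + mu) * r) *\<^sub>R exp (w * r) *\<^sub>R sh r y)"
    by (intro wt_scaleR wt_sh assms)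
  also have "exp (- (w + mu) * r) *\<^sub>R exp (w * r) *\<^sub>R sh r y = esh mu r y"
    by (simp add: esh_def exp_add[symmetric] algebra_simps)
  finally show "mul (\<lambda>t. exp (- w * t - t\<^sup>2)) (esh (w + mu) r x) = mul (\<lambda>t. exp (- 0 * t - t\<^sup>2)) (esh mu r y)"
    unfolding wt_iff_mul by (simp add: esh_def)
qed

lemma tico_Res:
  assumes Q: "tico Q" and lam: "lam > 0"
  shows "Q (Res lam x) = Res lam (Q x)"
  unfolding Res_def
  by (rule contraction_semigroup.resolvent_commute[OF contraction_semigroup_esh[OF lam] contraction_semigroup_esh[OF lam]
        tico_bounded_linear[OF Q]])
    (simp add: esh_def linear_scale[OF tico_linear[OF Q]] tico_sh[OF Q])

text \<open>Such an \<open>x\<close> vanishes before every time. In terms of exponentials: shifting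
  both arguments of the pairing by \<open>n\<close> costs nothing and gains the factor
  \<open>exp (- (n + r))\<close>.\<close>

lemma eq_0_if_fut_sh:
  fixes x :: "'a::complex_hilbert l2"
  assumes x: "\<And>t. 0 \<le> t \<Longrightarrow> fut (sh t x) = sh t x"
  shows "x = 0"
proof (rule inner_E_total[of 1])
  fix r and v :: 'a
  have "(\<lambda>n. exp (- (real n + r)) * (norm x * norm (E 1 v))) \<longlonglongrightarrow> 0 * (norm x * norm (E 1 v))"
  proof (intro tendsto_mult tendsto_const)
    have "(\<lambda>n. exp (- r) * exp (-1) ^ n) \<longlonglongrightarrow> exp (- r) * (0::real)"
      by (intro tendsto_mult tendsto_const LIMSEQ_power_zero) simp
    then show "(\<lambda>n. exp (- (real n + r))) \<longlonglongrightarrow> 0"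
      by (simp add: exp_of_nat_mult[symmetric] exp_add[symmetric] exp_diff algebra_simps)
  qed
  moreover have "norm (inner x (sh r (E 1 v))) \<le> exp (- (real n + r)) * (norm x * norm (E 1 v))" if "n \<ge> nat \<lceil>- r\<rceil>" for n
  proof -
    have n: "real n + r \<ge> 0" using that by linarith
    have "inner x (sh r (E 1 v)) = inner (sh n x) (sh (n + r) (E 1 v))"
      using inner_sh_sh[of "real n" x "sh r (E 1 v)"] by (simp add: sh_sh)
    also have "\<dots> = exp (- 1 * (n + r)) * inner (sh n x) (E 1 v)"
      by (rule inner_sh_E) (use n x[of n] in auto)
    also have "\<bar>\<dots>\<bar> \<le> exp (- (n + r)) * (norm (sh n x) * norm (E 1 v))"
      unfolding abs_mult using Cauchy_Schwarz_ineq2[of "sh n x" "E 1 v"] by simp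
    finally show ?thesis by simp
  qed
  then have "eventually (\<lambda>n. norm (inner x (sh r (E 1 v))) \<le> exp (- (real n + r)) * (norm x * norm (E 1 v))) sequentially"
    unfolding eventually_sequentially by blast
  ultimately have "norm (inner x (sh r (E 1 v))) \<le> 0 * (norm x * norm (E 1 v))"
    by (intro tendsto_lowerbound) auto
  then show "inner x (sh r (E 1 v)) = 0" by simp
qed simp

section \<open>Factorization of the graph\<close>

definition shp :: "real \<Rightarrow> 'a::complex_hilbert l2 \<times> 'b::complex_hilbert l2 \<Rightarrow> 'a l2 \<times> 'b l2" where
  "shp t g = (sh t (fst g), sh t (snd g))"

lemma fst_shp [simp]: "fst (shp t g) = sh t (fst g)" and snd_shp [simp]: "snd (shp t g) = sh t (snd g)"
  by (simp_all add: shp_def)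

lemma bounded_linear_shp: "bounded_linear (shp t)"
  unfolding shp_def[abs_def]
  by (intro bounded_linear_Pair bounded_linear_compose[OF bounded_linear_sh] bounded_linear_fst bounded_linear_snd)

lemmas linear_shp = bounded_linear.linear[OF bounded_linear_shp]

lemma shp_0 [simp]: "shp 0 g = g" by (simp add: shp_def)
lemma shp_shp: "shp s (shp t g) = shp (s + t) g" by (simp add: shp_def sh_sh)
lemma inner_shp_shp [simp]: "inner (shp t g) (shp t h) = inner g h" by (simp add: inner_prod_def)
lemma inner_shp: "inner (shp t g) h = inner g (shp (- t) h)" by (simp add: inner_prod_def inner_sh)
lemma norm_shp [simp]: "norm (shp t g) = norm g" by (simp add: norm_eq_sqrt_inner)
lemma shp_scaleC: "shp t (c *\<^sub>C g) = c *\<^sub>C shp t g" by (simp add: shp_def scaleC_prod_def sh_scaleC)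

definition eshp :: "real \<Rightarrow> real \<Rightarrow> 'a::complex_hilbert l2 \<times> 'b::complex_hilbert l2 \<Rightarrow> 'a l2 \<times> 'b l2" where
  "eshp lam t g = exp (- lam * t) *\<^sub>R shp t g"

lemma contraction_semigroup_eshp:
  assumes "lam > 0"
  shows "contraction_semigroup (eshp lam :: real \<Rightarrow> 'a::complex_hilbert l2 \<times> 'b::complex_hilbert l2 \<Rightarrow> 'a l2 \<times> 'b l2) lam"
proof -
  have 1: "bounded_linear (eshp lam t :: 'a l2 \<times> 'b l2 \<Rightarrow> 'a l2 \<times> 'b l2)" for t
    unfolding eshp_def[abs_def]
    by (intro bounded_linear_scaleR_right[THEN bounded_linear_compose] bounded_linear_shp)
  have 2: "continuous_on {0..} (\<lambda>t. eshp lam t x)" for x :: "'a l2 \<times> 'b l2"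
    unfolding eshp_def shp_def by (intro continuous_intros continuous_on_sh)
  show ?thesis
    by (rule contraction_semigroup.intro; (rule 1 2 assms)?)
      (simp_all add: eshp_def shp_shp linear_scale[OF linear_shp] exp_add[symmetric] algebra_simps)
qed

definition Resp :: "real \<Rightarrow> 'a::complex_hilbert l2 \<times> 'b::complex_hilbert l2 \<Rightarrow> 'a l2 \<times> 'b l2" where
  "Resp lam = contraction_semigroup.resolvent (eshp lam)"

lemma Resp_eq:
  assumes lam: "lam > 0" shows "Resp lam g = (Res lam (fst g), Res lam (snd g))"
proof -
  have "fst (Resp lam g) = Res lam (fst g)" unfolding Resp_def Res_def
    by (rule contraction_semigroup.resolvent_commute[OF contraction_semigroup_eshp[OF lam] contraction_semigroup_esh[OF lam]
        bounded_linear_fst]) (simp add: eshp_def esh_def)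
  moreover have "snd (Resp lam g) = Res lam (snd g)" unfolding Resp_def Res_def
    by (rule contraction_semigroup.resolvent_commute[OF contraction_semigroup_eshp[OF lam] contraction_semigroup_esh[OF lam]
        bounded_linear_snd]) (simp add: eshp_def esh_def)
  ultimately show ?thesis by (metis prod.collapse)
qed

lemma inner_sh_E_sh_E:
  assumes lam: "lam > 0"
  shows "inner (sh t (E lam p)) (sh r (E lam q)) = exp (- lam * \<bar>t - r\<bar>) * (inner p q / (2 * lam))"
proof -
  have *: "inner (E lam p) (sh r (E lam q)) = exp (- lam * r) * (inner p q / (2 * lam))" if "0 \<le> r" for r p and q :: 'a
    using inner_sh_E[OF lam that fut_E[OF lam], of p q] by (simp add: inner_E_E[OF lam])
  show ?thesis
  proof (cases "t \<le> r")
    case True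
    have "inner (sh t (E lam p)) (sh r (E lam q)) = inner (E lam p) (sh (r - t) (E lam q))"
      by (simp add: inner_sh sh_sh)
    then show ?thesis using *[of "r - t" p q] True by simp
  next
    case False
    have "inner (sh t (E lam p)) (sh r (E lam q)) = inner (E lam q) (sh (t - r) (E lam p))"
      by (subst inner_commute) (simp add: inner_sh sh_sh)
    then show ?thesis using *[of "t - r" q p] False by (simp add: inner_commute)
  qed
qed

text \<open>\<open>D\<close> acts with weight \<open>w\<close>, i.e. on \<open>exp (- w t) f\<close>; \<open>A\<close>, \<open>B\<close> are stable with extensions \<open>Aw\<close>, \<open>Bw\<close>
  to weight \<open>w\<close>, and \<open>A1\<close>, \<open>B1\<close> are the stable restrictions of \<open>D Aw\<close>, \<open>D Bw\<close>.\<close>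

locale stable_factorization =
  fixes w :: real
    and D :: "'u::complex_hilbert l2 \<Rightarrow> 'y::complex_hilbert l2"
    and A Aw :: "'u l2 \<Rightarrow> 'u l2" and A1 :: "'u l2 \<Rightarrow> 'y l2"
    and B Bw :: "'y l2 \<Rightarrow> 'u l2" and B1 :: "'y l2 \<Rightarrow> 'y l2"
  assumes w: "0 \<le> w"
    and D: "tico D" and A: "tico A" and Aw: "tico Aw" and A1: "tico A1"
    and B: "tico B" and Bw: "tico Bw" and B1: "tico B1"
    and wtA: "wt w x y \<Longrightarrow> wt w (A x) (Aw y)" and wtA1: "wt w x y \<Longrightarrow> wt w (A1 x) (D (Aw y))"
    and wtB: "wt w x' y' \<Longrightarrow> wt w (B x') (Bw y')" and wtB1: "wt w x' y' \<Longrightarrow> wt w (B1 x') (D (Bw y'))"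
    \<comment> \<open>In the application this is the upper left entry of
      \<open>[A, B; C, E] [I, - T; - D, I] = I\<close>.\<close>
    and bezout: "Aw x - Bw (D x) = x"
begin

text \<open>Beyond \<open>w\<close>, so that evaluation at \<open>lam\<close> factors through the
  weighted space as evaluation at 1, see \<open>inner_La_E\<close>. Only there can the action of
  \<open>D\<close> be used.\<close>

abbreviation lam :: real where "lam \<equiv> w + 1"

lemma lam: "lam > 0" using w by simp

abbreviation La :: "'b::complex_hilbert l2 \<Rightarrow> 'b l2" where "La \<equiv> mul (ef w)"

lemma bounded_linear_La: "bounded_linear La" by (intro bounded_linear_mul) (simp add: w)

lemmas linear_La = bounded_linear.linear[OF bounded_linear_La]

lemma wt_La: "fut x = x \<Longrightarrow> wt w x (La x)" by (rule wt_fut[OF w])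

lemma wt_imp_La: "fut x = x \<Longrightarrow> wt w x y \<Longrightarrow> y = La x" by (rule wt_unique[OF _ wt_La])

lemma fut_La: "fut x = x \<Longrightarrow> fut (La x) = La x"
  using wt_mul[of "indicator {0..}", OF _ wt_La, of x] wt_imp_La[of x "fut (La x)"] by simp

lemma inner_La_E: "inner (La x) (E 1 v) = inner x (E lam v)"
  by (simp add: inner_mul w mul_ef_E)

definition G :: "('u l2 \<times> 'y l2) set" where
  "G = {(u, y). fut u = u \<and> fut y = y \<and> D (La u) = La y}"

lemma G_iff: "g \<in> G \<longleftrightarrow> fut (fst g) = fst g \<and> fut (snd g) = snd g \<and> D (La (fst g)) = La (snd g)"
  by (cases g) (simp add: G_def)

lemma G_closed: "closed G"
proof -
  have bf: "bounded_linear (mul (indicator {0..}))" by (rule bounded_linear_mul) simp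
  have "G = {g. fut (fst g) = fst g} \<inter> {g. fut (snd g) = snd g} \<inter> {g. D (La (fst g)) = La (snd g)}"
    by (auto simp: G_iff)
  also have "closed \<dots>"
    by (intro closed_Int closed_Collect_eq linear_continuous_on bounded_linear_fst bounded_linear_snd
      bounded_linear_compose[OF bf] bounded_linear_compose[OF tico_bounded_linear[OF D]] bounded_linear_compose[OF bounded_linear_La])
  finally show ?thesis .
qed

lemma linear_fut: "linear (mul (indicator {0..}))"
  by (intro bounded_linear.linear bounded_linear_mul) simp

lemma G_subspace: "subspace G"
proof (rule subspaceI)
  show "0 \<in> G" by (simp add: G_iff linear_0[OF linear_fut] linear_0[OF linear_La] linear_0[OF tico_linear[OF D]])
  show "x + y \<in> G" if "x \<in> G" "y \<in> G" for x y
    using that by (simp add: G_iff linear_add[OF linear_fut] linear_add[OF linear_La] linear_add[OF tico_linear[OF D]])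
  show "c *\<^sub>R x \<in> G" if "x \<in> G" for c x
    using that by (simp add: G_iff linear_scale[OF linear_fut] linear_scale[OF linear_La] linear_scale[OF tico_linear[OF D]])
qed

lemma G_scaleC: "g \<in> G \<Longrightarrow> c *\<^sub>C g \<in> G"
  by (simp add: G_iff scaleC_prod_def mul_scaleC w tico_scaleC[OF D])

lemma G_shp:
  assumes g: "g \<in> G" and t: "0 \<le> t" shows "shp (- t) g \<in> G"
proof -
  have "D (La (sh (- t) (fst g))) = La (sh (- t) (snd g))"
    using g t w unfolding G_iff
    by (simp add: mul_ef_sh linear_scale[OF tico_linear[OF D]] tico_sh[OF D])
  then show ?thesis using g t unfolding G_iff by (simp add: fut_sh_mono)
qed

lemma pair_in_G:
  assumes Q: "tico Q" "tico Q1" and f: "fut f = f"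
    and wtQ: "\<And>x y. wt w x y \<Longrightarrow> wt w (Q x) (Qw y)" "\<And>x y. wt w x y \<Longrightarrow> wt w (Q1 x) (D (Qw y))"
  shows "(Q f, Q1 f) \<in> G"
proof -
  have fQ: "fut (Q f) = Q f" "fut (Q1 f) = Q1 f" using tico_causal Q f by blast+
  have "Qw (La f) = La (Q f)" by (rule wt_imp_La[OF fQ(1) wtQ(1)[OF wt_La[OF f]]])
  moreover have "D (Qw (La f)) = La (Q1 f)" by (rule wt_imp_La[OF fQ(2) wtQ(2)[OF wt_La[OF f]]])
  ultimately show ?thesis using fQ by (simp add: G_iff)
qed

section \<open>Kernel vectors of the graph and their lower bound\<close>

definition e :: "'u \<Rightarrow> 'u l2 \<times> 'y l2" where "e v = (E lam v, 0)"

text \<open>The kernel of \<open>G\<close> at \<open>lam\<close>: by \<open>inner_k\<close>, pairing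
  \<open>g\<close> with \<open>k v\<close> reads off the transform of \<open>fst g\<close> at
  \<open>lam\<close> against \<open>v\<close>.\<close>

definition k :: "'u \<Rightarrow> 'u l2 \<times> 'y l2" where "k v = proj G (e v)"

lemma k_in_G: "k v \<in> G" unfolding k_def by (rule proj_in[OF G_subspace G_closed])

lemma inner_k: "g \<in> G \<Longrightarrow> inner g (k v) = inner (fst g) (E lam v)"
  using inner_proj[OF G_subspace G_closed, of g "e v"]
  by (simp add: k_def e_def inner_commute inner_prod_def)

lemma bounded_linear_k: "bounded_linear k"
  unfolding k_def[abs_def] e_def[abs_def]
  by (intro bounded_linear_compose[OF bounded_linear_proj[OF G_subspace G_closed]] bounded_linear_Pair
    bounded_linear_E lam bounded_linear_zero)

lemma k_scaleC: "k (c *\<^sub>C v) = c *\<^sub>C k v"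
  unfolding k_def
proof (rule proj_eqI[OF G_subspace G_closed])
  show "c *\<^sub>C proj G (e v) \<in> G" by (intro G_scaleC proj_in[OF G_subspace G_closed])
  fix s assume s: "s \<in> G"
  have "e (c *\<^sub>C v) - c *\<^sub>C proj G (e v) = c *\<^sub>C (e v - proj G (e v))"
    unfolding linear_diff[OF bounded_linear.linear[OF bounded_linear_scaleC]]
    using lam by (simp add: e_def scaleC_prod_def E_scaleC linear_0[OF bounded_linear.linear[OF bounded_linear_scaleC]])
  then show "inner (e (c *\<^sub>C v) - c *\<^sub>C proj G (e v)) s = 0"
    using proj_orth[OF G_subspace G_closed G_scaleC[OF s]] by (simp add: inner_scaleC_left)
qed

lemma inner_shp_k:
  assumes g: "g \<in> G" and t: "0 \<le> t"
  shows "inner (shp (- t) g) (k v) = exp (- lam * t) * inner g (k v)"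
proof -
  have "inner (shp (- t) g) (k v) = inner (fst g) (sh t (E lam v))"
    using inner_k[OF G_shp[OF g t]] by (simp add: inner_sh)
  also have "\<dots> = exp (- lam * t) * inner (fst g) (E lam v)"
    by (rule inner_sh_E[OF lam t]) (use g in \<open>simp add: G_iff\<close>)
  finally show ?thesis using inner_k[OF g] by simp
qed

lemma inner_shp_k_shp_k: "inner (shp t (k u)) (shp r (k v)) = exp (- lam * \<bar>t - r\<bar>) * inner (k u) (k v)"
proof (cases "t \<le> r")
  case True
  have "inner (shp t (k u)) (shp r (k v)) = inner (shp (- (r - t)) (k u)) (k v)"
    by (simp add: inner_shp shp_shp)
  then show ?thesis using inner_shp_k[OF k_in_G, of "r - t" u v] True by simp
next
  case False
  have "inner (shp t (k u)) (shp r (k v)) = inner (shp (- (t - r)) (k v)) (k u)"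
    by (subst inner_commute) (simp add: inner_shp shp_shp)
  then show ?thesis using inner_shp_k[OF k_in_G, of "t - r" v u] False by (simp add: inner_commute)
qed

text \<open>The element \<open>(A f - B h, D (A f - B h))\<close> of \<open>G\<close>, with \<open>f = exp (- lam t) v\<close> and \<open>h\<close> the truncation
  of \<open>D f\<close> to \<open>[0, T]\<close>, has a first component close to \<open>f\<close> in the weighted norm.\<close>

lemma k_bounded_below: "\<exists>c\<ge>0. \<forall>v. norm v \<le> c * norm (k v)"
proof -
  obtain KA where KA: "KA > 0" "\<And>x. norm (A x) \<le> norm x * KA" using bounded_linear.pos_bounded[OF tico_bounded_linear[OF A]] by blast
  obtain KB where KB: "KB > 0" "\<And>x. norm (B x) \<le> norm x * KB" using bounded_linear.pos_bounded[OF tico_bounded_linear[OF B]] by blast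
  obtain KA1 where KA1: "KA1 > 0" "\<And>x. norm (A1 x) \<le> norm x * KA1" using bounded_linear.pos_bounded[OF tico_bounded_linear[OF A1]] by blast
  obtain KB1 where KB1: "KB1 > 0" "\<And>x. norm (B1 x) \<le> norm x * KB1" using bounded_linear.pos_bounded[OF tico_bounded_linear[OF B1]] by blast
  obtain KD where KD: "KD > 0" "\<And>x. norm (D x) \<le> norm x * KD" using bounded_linear.pos_bounded[OF tico_bounded_linear[OF D]] by blast
  obtain KW where KW: "KW > 0" "\<And>x. norm (Bw x) \<le> norm x * KW" using bounded_linear.pos_bounded[OF tico_bounded_linear[OF Bw]] by blast
  define el where "el = 1 / sqrt (2 * lam)"
  define e1 where "e1 = 1 / sqrt (2::real)"
  have el: "el > 0" "norm (E lam v) = el * norm v" for v :: 'u using lam by (simp_all add: el_def norm_E)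
  have e1: "e1 > 0" "norm (E 1 v) = e1 * norm v" for v :: 'u by (simp_all add: e1_def norm_E)
  define C where "C = KW * KD * el * e1"
  have C: "C > 0" using KW KD el e1 by (simp add: C_def)
  \<comment> \<open>The main term of \<open>inner g (k v)\<close> will be
    \<open>(norm v)^2 / (2 * lam)\<close>; \<open>n\<close> is taken so large that the truncation
    error is at most half of it.\<close>
  obtain n :: nat where n: "exp (-1) ^ n < 1 / (4 * lam * C)"
    using real_arch_pow_inv[of "1 / (4 * lam * C)" "exp (-1)"] lam C by auto
  define T where "T = real n"
  have T: "0 \<le> T" "exp (- T) * C \<le> 1 / (4 * lam)"
  proof -
    have "exp (- T) \<le> 1 / (4 * lam * C)" using n by (simp add: T_def exp_of_nat_mult[symmetric])
    then have "exp (- T) * C \<le> 1 / (4 * lam * C) * C" using C by (intro mult_right_mono) auto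
    then show "exp (- T) * C \<le> 1 / (4 * lam)" using C by simp
  qed (simp add: T_def)
  \<comment> \<open>Truncation combined with removal of the weight: on \<open>[0, T]\<close> the
    factor \<open>exp (w * t)\<close> is bounded, so a stable operator may be applied to the
    result.\<close>
  define \<phi> where "\<phi> t = indicator {0..T} t * exp (w * t)" for t
  have \<phi>: "bounded_measurable \<phi>" "\<bar>\<phi> t\<bar> \<le> exp (w * T)" for t
  proof -
    show b: "\<bar>\<phi> t\<bar> \<le> exp (w * T)" for t using w by (auto simp: \<phi>_def indicator_def mult_left_mono)
    show "bounded_measurable \<phi>" by (rule bounded_measurableI[OF _ b]) (simp add: \<phi>_def[abs_def])
  qed
  \<comment> \<open>The bracket bounds \<open>norm g\<close> in terms of \<open>norm v\<close>,
    through the stable operators alone; \<open>4 * lam\<close> is the reciprocal of the constant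
    left in the main term.\<close>
  define c where "c = 4 * lam * (el * KA + exp (w * T) * (KD * el) * KB + (el * KA1 + exp (w * T) * (KD * el) * KB1))"
  have c: "c \<ge> 0" using lam KA KB KA1 KB1 KD el by (simp add: c_def)
  moreover have "norm v \<le> c * norm (k v)" for v
  proof -
    define f where "f = E lam v"
    define y where "y = D (La f)"
    define h where "h = mul \<phi> y"
    define g where "g = (A f - B h, A1 f - B1 h)"
    have f: "fut f = f" unfolding f_def by (rule fut_E[OF lam])
    have nLa: "norm (La x) \<le> 1 * norm x" for x :: "'u l2"
      by (rule norm_mul_le) (use w in \<open>auto simp: ef_def indicator_def\<close>)
    have fy: "fut y = y" unfolding y_def by (rule tico_causal[OF D fut_La[OF f]])
    have ny: "norm y \<le> KD * el * norm v"
    proof -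
      have "norm y \<le> norm (La f) * KD" unfolding y_def by (rule KD)
      also have "\<dots> \<le> norm f * KD" using nLa[of f] KD by (intro mult_right_mono) auto
      finally show ?thesis by (simp add: f_def el mult_ac)
    qed
    have wth: "wt w h (mul (indicator {0..T}) y)"
      unfolding wt_def
    proof -
      have "AE t in lebesgue. fn h t = \<phi> t *\<^sub>R fn y t" unfolding h_def by (rule fn_mul[OF \<phi>(1)])
      moreover have "AE t in lebesgue. fn (mul (indicator {0..T}) y) t = indicator {0..T} t *\<^sub>R fn y t"
        by (rule fn_mul) simp
      ultimately show "AE t in lebesgue. fn (mul (indicator {0..T}) y) t = exp (- w * t) *\<^sub>R fn h t"
        by eventually_elim (simp add: \<phi>_def exp_add[symmetric])
    qed
    have fh: "fut h = h"
    proof -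
      have "(\<lambda>t. indicator {0..} t * \<phi> t) = \<phi>" by (auto simp: \<phi>_def indicator_def)
      then show ?thesis by (simp add: h_def mul_mul \<phi>)
    qed
    have Ag: "(A f, A1 f) \<in> G" by (rule pair_in_G[OF A A1 f wtA wtA1])
    have Bg: "(B h, B1 h) \<in> G" by (rule pair_in_G[OF B B1 fh wtB wtB1])
    have g: "g \<in> G" using subspace_diff[OF G_subspace Ag Bg] by (simp add: g_def)
    have nh: "norm h \<le> exp (w * T) * (KD * el) * norm v"
    proof -
      have "norm h \<le> exp (w * T) * norm y" unfolding h_def by (rule norm_mul_le[OF \<phi>])
      also have "\<dots> \<le> exp (w * T) * (KD * el * norm v)" by (intro mult_left_mono ny) simp
      finally show ?thesis by (simp add: mult_ac)
    qed
    have ng: "4 * lam * norm g \<le> c * norm v"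
    proof -
      have "norm g \<le> norm (fst g) + norm (snd g)" by (metis norm_Pair_le prod.collapse)
      also have "\<dots> \<le> (norm (A f) + norm (B h)) + (norm (A1 f) + norm (B1 h))"
        unfolding g_def fst_conv snd_conv by (intro add_mono norm_triangle_ineq4)
      also have "\<dots> \<le> (norm f * KA + norm h * KB) + (norm f * KA1 + norm h * KB1)"
        by (intro add_mono KA KB KA1 KB1)
      also have "\<dots> \<le> ((el * norm v) * KA + (exp (w * T) * (KD * el) * norm v) * KB)
          + ((el * norm v) * KA1 + (exp (w * T) * (KD * el) * norm v) * KB1)"
        using KA KB KA1 KB1 by (intro add_mono mult_right_mono nh) (auto simp: f_def el)
      finally have "4 * lam * norm g \<le> 4 * lam * (((el * norm v) * KA + (exp (w * T) * (KD * el) * norm v) * KB)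
          + ((el * norm v) * KA1 + (exp (w * T) * (KD * el) * norm v) * KB1))"
        by (rule mult_left_mono) (use lam in simp)
      then show ?thesis by (simp add: c_def algebra_simps)
    qed
    have fg: "fut (fst g) = fst g" using g by (simp add: G_iff)
    define r where "r = y - mul (indicator {0..T}) y"
    \<comment> \<open>With all of \<open>y\<close> in place of its truncation, the Bezout identity
      would give exactly \<open>La f\<close>; the defect is \<open>Bw\<close> applied to the tail
      \<open>r\<close>.\<close>
    have Lag: "La (fst g) = La f + Bw r"
    proof -
      have "La (A f) = Aw (La f)"
        using Ag wt_imp_La[OF _ wtA[OF wt_La[OF f]]] by (simp add: G_iff)
      moreover have "La (B h) = Bw (mul (indicator {0..T}) y)"
        using Bg wt_imp_La[OF _ wtB[OF wth]] by (simp add: G_iff)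
      moreover have "Aw (La f) = La f + Bw y" using bezout[of "La f"] by (simp add: y_def algebra_simps)
      ultimately show ?thesis
        by (simp add: g_def r_def linear_diff[OF linear_La] linear_diff[OF tico_linear[OF Bw]])
    qed
    have nr: "norm r \<le> KD * el * norm v"
    proof -
      have "r = mul (indicator {T<..}) y"
      proof (rule mul_eqI[symmetric])
        have "AE t in lebesgue. fn (fut y) t = indicator {0..} t *\<^sub>R fn y t" by (rule fn_mul) simp
        then have "AE t in lebesgue. fn y t = indicator {0..} t *\<^sub>R fn y t" unfolding fy .
        moreover have "AE t in lebesgue. fn (mul (indicator {0..T}) y) t = indicator {0..T} t *\<^sub>R fn y t"
          by (rule fn_mul) simp
        moreover have "AE t in lebesgue. fn r t = fn y t - fn (mul (indicator {0..T}) y) t"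
          unfolding r_def by (rule fn_diff)
        ultimately show "AE t in lebesgue. indicator {T<..} t *\<^sub>R fn y t = fn r t"
        proof eventually_elim
          case (elim t)
          then show ?case using T(1) by (cases "0 \<le> t"; cases "t \<le> T") (simp_all add: indicator_def)
        qed
      qed simp
      then have "norm r \<le> 1 * norm y" by (simp only:) (rule norm_mul_le, auto simp: indicator_def)
      then show ?thesis using ny by simp
    qed
    have fr: "fut (sh T r) = sh T r"
    proof (rule mul_eqI)
      have "AE t in lebesgue. fn (fut y) t = indicator {0..} t *\<^sub>R fn y t" by (rule fn_mul) simp
      then have "AE t in lebesgue. fn y t = indicator {0..} t *\<^sub>R fn y t" unfolding fy .
      moreover have "AE t in lebesgue. fn (mul (indicator {0..T}) y) t = indicator {0..T} t *\<^sub>R fn y t"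
        by (rule fn_mul) simp
      moreover have "AE t in lebesgue. fn r t = fn y t - fn (mul (indicator {0..T}) y) t"
        unfolding r_def by (rule fn_diff)
      ultimately have "AE t in lebesgue. t < T \<longrightarrow> fn r t = 0"
      proof eventually_elim
        case (elim t)
        then show ?case by (cases "0 \<le> t") (simp_all add: indicator_def)
      qed
      from AE_lebesgue_translation[OF this, of T] fn_sh[of T r]
      show "AE t in lebesgue. indicator {0..} t *\<^sub>R fn (sh T r) t = fn (sh T r) t"
        by eventually_elim (auto simp: indicator_def)
    qed simp
    \<comment> \<open>The tail lives after \<open>T\<close> and \<open>Bw\<close> is causal, so
      \<open>Bw r\<close> lives there too and its pairing with the exponential carries the factor
      \<open>exp (- T)\<close>.\<close>
    have small: "\<bar>inner (Bw r) (E 1 v)\<bar> \<le> (norm v)\<^sup>2 / (4 * lam)"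
    proof -
      have "inner (Bw r) (E 1 v) = inner (Bw (sh T r)) (sh T (E 1 v))"
        by (simp add: tico_sh[OF Bw])
      also have "\<dots> = exp (- 1 * T) * inner (Bw (sh T r)) (E 1 v)"
        by (rule inner_sh_E[OF _ T(1) tico_causal[OF Bw fr]]) simp
      also have "\<bar>\<dots>\<bar> \<le> exp (- T) * (norm (Bw (sh T r)) * norm (E 1 v))"
        unfolding abs_mult using Cauchy_Schwarz_ineq2[of "Bw (sh T r)" "E 1 v"] by simp
      also have "\<dots> \<le> exp (- T) * ((KD * el * norm v * KW) * (e1 * norm v))"
      proof (intro mult_left_mono mult_mono)
        have "norm (Bw (sh T r)) \<le> norm r * KW" using KW(2)[of "sh T r"] by simp
        also have "\<dots> \<le> KD * el * norm v * KW" using nr KW by (intro mult_right_mono) auto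
        finally show "norm (Bw (sh T r)) \<le> KD * el * norm v * KW" .
      qed (use e1 KD el KW in auto)
      also have "\<dots> = (exp (- T) * C) * (norm v)\<^sup>2" by (simp add: C_def power2_eq_square mult_ac)
      also have "\<dots> \<le> 1 / (4 * lam) * (norm v)\<^sup>2" by (intro mult_right_mono T) simp
      finally show ?thesis by simp
    qed
    have "inner g (k v) = inner (La (fst g)) (E 1 v)" by (simp add: inner_k[OF g] inner_La_E)
    also have "\<dots> = inner f (E lam v) + inner (Bw r) (E 1 v)"
      by (simp add: Lag inner_add_left inner_La_E)
    also have "inner f (E lam v) = (norm v)\<^sup>2 / (2 * lam)"
      unfolding f_def inner_E_E[OF lam] by (simp add: power2_norm_eq_inner)
    finally have "(norm v)\<^sup>2 / (2 * lam) - (norm v)\<^sup>2 / (4 * lam) \<le> inner g (k v)"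
      using small by linarith
    moreover have "(norm v)\<^sup>2 / (2 * lam) - (norm v)\<^sup>2 / (4 * lam) = (norm v)\<^sup>2 / (4 * lam)"
    proof -
      have "a / (2 * l) - a / (4 * l) = a / (4 * l)" if "l > 0" for a l :: real
        using that by (simp add: field_simps)
      then show ?thesis using lam .
    qed
    ultimately have "(norm v)\<^sup>2 / (4 * lam) \<le> inner g (k v)" by (simp only:)
    also have "\<dots> \<le> norm g * norm (k v)" by (rule norm_cauchy_schwarz)
    finally have "(norm v)\<^sup>2 \<le> 4 * lam * norm g * norm (k v)"
      using lam by (simp only: pos_divide_le_eq mult_pos_pos zero_less_numeral mult_ac)
    also have "\<dots> \<le> c * norm v * norm (k v)" by (intro mult_right_mono ng) simp
    finally have "norm v * norm v \<le> norm v * (c * norm (k v))" by (simp add: power2_eq_square mult_ac)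
    then show ?thesis using c by (cases "v = 0") simp_all
  qed
  ultimately show ?thesis by blast
qed

text \<open>The shifts of \<open>k\<close> have, up to a constant factor, the Gram matrix of the shifts of \<open>exp (- lam t) k\<close>,
  the latter taken in the space of functions with values in the graph space.\<close>

lemma shift_extension:
  obtains W where "bounded_linear W" "\<And>t v. W (sh t (E lam v)) = shp t (k v)"
    "\<And>x. (norm (W x))\<^sup>2 = 2 * lam * (norm (pw k x))\<^sup>2"
proof -
  define R0 where "R0 = {(sh t (E lam v), shp t (k v)) | t v. True}"
  define R where "R = span R0"
  have sub: "subspace R" unfolding R_def by (rule subspace_span)
  have lpw: "linear (pw k)" by (rule bounded_linear.linear[OF bounded_linear_pw[OF bounded_linear_k]])
  have gram0: "inner (snd p) (snd q) = 2 * lam * inner (pw k (fst p)) (pw k (fst q))" if pq: "p \<in> R0" "q \<in> R0" for p q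
  proof -
    obtain t u where p: "p = (sh t (E lam u), shp t (k u))" using pq(1) by (auto simp: R0_def)
    obtain r v where q: "q = (sh r (E lam v), shp r (k v))" using pq(2) by (auto simp: R0_def)
    show ?thesis unfolding p q fst_conv snd_conv inner_shp_k_shp_k
      using lam by (simp add: pw_sh[OF bounded_linear_k] pw_E[OF lam bounded_linear_k] inner_sh_E_sh_E[OF lam])
  qed
  have gram1: "inner (snd p) (snd q) = 2 * lam * inner (pw k (fst p)) (pw k (fst q))" if "p \<in> R" "q \<in> R0" for p q
    using that(1) unfolding R_def
  proof (induction rule: span_induct_alt)
    case base then show ?case by (simp add: linear_0[OF lpw])
  next
    case (step c x y)
    then show ?case using gram0[OF step(1) that(2)]
      by (simp add: inner_add_left linear_add[OF lpw] linear_scale[OF lpw] algebra_simps)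
  qed
  have gram: "inner (snd p) (snd q) = 2 * lam * inner (pw k (fst p)) (pw k (fst q))" if "p \<in> R" "q \<in> R" for p q
    using that(2) unfolding R_def
  proof (induction rule: span_induct_alt)
    case base then show ?case by (simp add: linear_0[OF lpw])
  next
    case (step c x y)
    then show ?case using gram1[OF that(1) step(1)]
      by (simp add: inner_add_right linear_add[OF lpw] linear_scale[OF lpw] algebra_simps)
  qed
  obtain K where K: "K > 0" "\<And>x. norm (pw k x) \<le> norm x * K"
    using bounded_linear.pos_bounded[OF bounded_linear_pw[OF bounded_linear_k]] by blast
  have nR: "(norm y)\<^sup>2 = 2 * lam * (norm (pw k x))\<^sup>2" if "(x, y) \<in> R" for x y
    using gram[OF that that] by (simp add: power2_norm_eq_inner)
  have bd: "norm y \<le> (sqrt (2 * lam) * K) * norm x" if "(x, y) \<in> R" for x y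
  proof (rule power2_le_imp_le)
    have "(norm y)\<^sup>2 \<le> 2 * lam * (norm x * K)\<^sup>2"
      unfolding nR[OF that] by (intro mult_left_mono power_mono K) (use lam in auto)
    then show "(norm y)\<^sup>2 \<le> (sqrt (2 * lam) * K * norm x)\<^sup>2"
      using lam by (simp add: power_mult_distrib mult_ac)
  qed (use K lam in auto)
  have dom: "sh t (E lam v) \<in> fst ` R" for t v
    unfolding R_def by (rule image_eqI[where x = "(sh t (E lam v), shp t (k v))"]) (auto simp: R0_def intro!: span_base)
  have "span (Eset lam) \<subseteq> fst ` R"
    by (rule span_minimal) (use dom in \<open>auto simp: Eset_def\<close>, rule linear_subspace_image[OF linear_fst sub])
  then have dR: "closure (fst ` R) = UNIV"
    using closure_mono[of "span (Eset lam)" "fst ` R"] closure_span_Eset[OF lam] by auto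
  obtain W where W: "bounded_linear W" "\<And>x y. (x, y) \<in> R \<Longrightarrow> W x = y"
    using bounded_linear_relation_extension[OF sub bd dR] by blast
  have "closed {x. (norm (W x))\<^sup>2 = 2 * lam * (norm (pw k x))\<^sup>2}"
    by (intro closed_Collect_eq continuous_intros linear_continuous_on W bounded_linear_pw bounded_linear_k)
  moreover have "fst ` R \<subseteq> {x. (norm (W x))\<^sup>2 = 2 * lam * (norm (pw k x))\<^sup>2}"
    using nR W(2) by auto
  ultimately have "closure (fst ` R) \<subseteq> {x. (norm (W x))\<^sup>2 = 2 * lam * (norm (pw k x))\<^sup>2}"
    by (rule closure_minimal[rotated])
  then have "(norm (W x))\<^sup>2 = 2 * lam * (norm (pw k x))\<^sup>2" for x using dR by auto
  moreover have "W (sh t (E lam v)) = shp t (k v)" for t v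
    by (rule W(2)) (auto simp: R_def R0_def intro!: span_base)
  ultimately show thesis using that W(1) by blast
qed

section \<open>The operator \<open>W\<close> and its image in the graph\<close>

definition W :: "'u l2 \<Rightarrow> 'u l2 \<times> 'y l2" where
  "W = (SOME W. bounded_linear W \<and> (\<forall>t v. W (sh t (E lam v)) = shp t (k v)) \<and>
     (\<forall>x. (norm (W x))\<^sup>2 = 2 * lam * (norm (pw k x))\<^sup>2))"

lemma W: "bounded_linear W" "W (sh t (E lam v)) = shp t (k v)" "(norm (W x))\<^sup>2 = 2 * lam * (norm (pw k x))\<^sup>2"
proof -
  have "\<exists>W. bounded_linear W \<and> (\<forall>t v. W (sh t (E lam v)) = shp t (k v)) \<and>
     (\<forall>x. (norm (W x))\<^sup>2 = 2 * lam * (norm (pw k x))\<^sup>2)"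
    using shift_extension by metis
  from someI_ex[OF this] show "bounded_linear W" "W (sh t (E lam v)) = shp t (k v)"
    "(norm (W x))\<^sup>2 = 2 * lam * (norm (pw k x))\<^sup>2" unfolding W_def by blast+
qed

lemmas linear_W = bounded_linear.linear[OF W(1)]

lemma W_bounded_below: "\<exists>c>0. \<forall>x. norm x \<le> c * norm (W x)"
proof -
  obtain c where c: "c \<ge> 0" "\<And>v. norm v \<le> c * norm (k v)" using k_bounded_below by blast
  have "norm x \<le> (c / sqrt (2 * lam) + 1) * norm (W x)" for x
  proof -
    have "norm x \<le> c * norm (pw k x)" by (rule norm_pw_ge[OF bounded_linear_k c(2,1)])
    moreover have "norm (W x) = sqrt (2 * lam) * norm (pw k x)"
    proof -
      have "(norm (W x))\<^sup>2 = (sqrt (2 * lam) * norm (pw k x))\<^sup>2"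
        using W(3)[of x] lam by (simp add: power_mult_distrib)
      then show ?thesis using lam by (simp add: power2_eq_iff_nonneg)
    qed
    ultimately have "norm x \<le> c / sqrt (2 * lam) * norm (W x)" using lam by simp
    also have "\<dots> \<le> (c / sqrt (2 * lam) + 1) * norm (W x)" by (intro mult_right_mono) auto
    finally show ?thesis .
  qed
  moreover have "c / sqrt (2 * lam) + 1 > 0" using c lam by (simp add: add_nonneg_pos)
  ultimately show ?thesis by blast
qed

lemma W_inj: "W x = W y \<Longrightarrow> x = y"
proof -
  assume "W x = W y"
  then have "W (x - y) = 0" by (simp add: linear_diff[OF linear_W])
  then show "x = y" using W_bounded_below by (metis eq_iff_diff_eq_0 mult_zero_right norm_le_zero_iff norm_zero)
qed

lemma W_sh: "W (sh s x) = shp s (W x)"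
proof (rule l2_operator_eqI[OF _ _ lam, of "\<lambda>x. W (sh s x)" "\<lambda>x. shp s (W x)"])
  show "bounded_linear (\<lambda>x. W (sh s x))" "bounded_linear (\<lambda>x. shp s (W x))"
    by (rule bounded_linear_compose[OF W(1) bounded_linear_sh] bounded_linear_compose[OF bounded_linear_shp W(1)])+
qed (simp add: sh_sh shp_shp W(2))

lemma W_scaleC: "W (c *\<^sub>C x) = c *\<^sub>C W x"
proof (rule l2_operator_eqI[OF _ _ lam, of "\<lambda>x. W (c *\<^sub>C x)" "\<lambda>x. c *\<^sub>C W x"])
  show "bounded_linear (\<lambda>x. W (c *\<^sub>C x))" "bounded_linear (\<lambda>x. c *\<^sub>C W x)"
    by (rule bounded_linear_compose[OF W(1) bounded_linear_scaleC] bounded_linear_compose[OF bounded_linear_scaleC W(1)])+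
  show "W (c *\<^sub>C sh t (E lam v)) = c *\<^sub>C W (sh t (E lam v))" for t v
    by (simp add: W(2) sh_scaleC[symmetric] E_scaleC[OF lam, symmetric] k_scaleC shp_scaleC[symmetric])
qed

text \<open>Composing with \<open>fut\<close> turns the claim into a condition on the whole space,
  defining a closed subspace. On shifted exponentials it follows from the eigenvector property for
  left shifts and from invariance of \<open>G\<close> for right shifts.\<close>

lemma W_fut_in_G: "fut x = x \<Longrightarrow> W x \<in> G"
proof -
  have bf: "bounded_linear (\<lambda>x. W (fut x))"
    by (rule bounded_linear_compose[OF W(1) bounded_linear_mul]) simp
  let ?S = "{x. W (fut x) \<in> G}"
  have "closed ((\<lambda>x. W (fut x)) -` G)"
    by (rule continuous_closed_vimage[OF G_closed]) (use bf linear_continuous_at in blast)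
  then have cl: "closed ?S" by (simp add: vimage_def)
  have sub: "subspace ?S"
    using linear_subspace_vimage[OF bounded_linear.linear[OF bf] G_subspace] by (simp add: vimage_def)
  have "Eset lam \<subseteq> ?S"
  proof
    fix x :: "'u l2" assume "x \<in> Eset lam"
    then obtain t v where x: "x = sh t (E lam v)" by (auto simp: Eset_def)
    show "x \<in> ?S"
    proof (cases "0 \<le> t")
      case True
      have "W (E lam v) = k v" using W(2)[of 0 v] by simp
      then show ?thesis unfolding x
        by (simp add: fut_sh_E[OF lam True] linear_scale[OF linear_W] subspace_scale[OF G_subspace] k_in_G)
    next
      case False
      then show ?thesis unfolding x
        using G_shp[OF k_in_G, of "- t" v] by (simp add: fut_sh_E_neg[OF lam] W(2))
    qed
  qed
  then have "span (Eset lam) \<subseteq> ?S" using sub by (rule span_minimal)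
  then have "closure (span (Eset lam)) \<subseteq> ?S" using cl by (rule closure_minimal)
  then have "W (fut x) \<in> G" using closure_span_Eset[OF lam] by auto
  then show "W x \<in> G" if "fut x = x" using that by simp
qed

text \<open>The orthogonal complement in \<open>G\<close> of the image under \<open>W\<close> of the
  functions supported in the future, which the right translates of the \<open>k v\<close>
  generate.\<close>

definition G' :: "('u l2 \<times> 'y l2) set" where
  "G' = {g \<in> G. \<forall>t\<ge>0. \<forall>v. inner g (shp (- t) (k v)) = 0}"

lemma G'_subspace: "subspace G'"
  by (rule subspaceI) (auto simp: G'_def subspace_0[OF G_subspace] subspace_add[OF G_subspace]
    subspace_scale[OF G_subspace] inner_add_left)

lemma G'_closed: "closed G'"
proof -
  have "G' = G \<inter> (\<Inter>t\<in>{0..}. \<Inter>v. {g. inner g (shp (- t) (k v)) = 0})" by (auto simp: G'_def)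
  then show ?thesis
    by (simp only:) (intro closed_Int G_closed closed_INT ballI closed_Collect_eq continuous_intros)
qed

lemma G'_shp:
  assumes g: "g \<in> G'" and r: "0 \<le> r" shows "shp (- r) g \<in> G'"
proof -
  have gG: "g \<in> G" and o: "\<And>t v. 0 \<le> t \<Longrightarrow> inner g (shp (- t) (k v)) = 0" using g by (auto simp: G'_def)
  have "inner (shp (- r) g) (shp (- t) (k v)) = 0" if t: "0 \<le> t" for t v
  proof (cases "r \<le> t")
    case True
    have "inner (shp (- r) g) (shp (- t) (k v)) = inner g (shp (- (t - r)) (k v))"
      by (simp add: inner_shp shp_shp)
    then show ?thesis using o[of "t - r" v] True by simp
  next
    case False
    have "inner (shp (- r) g) (shp (- t) (k v)) = inner (shp (- (r - t)) g) (k v)"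
      by (simp add: inner_shp shp_shp)
    then show ?thesis using inner_shp_k[OF gG, of "r - t" v] o[of 0 v] False by simp
  qed
  then show ?thesis using G_shp[OF gG r] by (simp add: G'_def)
qed

lemma Res_La:
  assumes "fut x = x" "fut (Res lam x) = Res lam x"
  shows "Res 1 (La x) = La (Res lam x)"
  by (rule wt_imp_La[OF assms(2) wt_Res[OF wt_La[OF assms(1)]]]) (use w in auto)

text \<open>Orthogonality to every \<open>k v\<close> is a zero at \<open>lam\<close> of the
  transform of the first component, so its resolvent stays in the future.\<close>

lemma G'_Resp:
  assumes g: "g \<in> G'" shows "Resp lam g \<in> G'"
proof -
  obtain u y where gu: "g = (u, y)" by (cases g)
  have gG: "g \<in> G" and o: "\<And>t v. 0 \<le> t \<Longrightarrow> inner g (shp (- t) (k v)) = 0" using g by (auto simp: G'_def)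
  have f: "fut u = u" "fut y = y" and DLa: "D (La u) = La y" using gG by (simp_all add: gu G_def)
  have "inner u (E lam v) = 0" for v
    using inner_k[OF gG, of v] o[of 0 v] by (simp add: gu)
  then have Ru: "fut (Res lam u) = Res lam u" by (rule fut_Res[OF lam f(1)])
  have "D (La (Res lam u)) = Res 1 (La y)"
    by (simp add: Res_La[OF f(1) Ru, symmetric] tico_Res[OF D] DLa)
  \<comment> \<open>The second component is not known to vanish at \<open>lam\<close> beforehand.
    Causality of \<open>D\<close> gives the support of its resolvent in the weighted space, and the
    zero follows from that.\<close>
  then have "fut (Res 1 (La y)) = Res 1 (La y)"
    using tico_causal[OF D fut_La[OF Ru]] by simp
  then have "inner (La y) (E 1 v) = 0" for v
    by (rule inner_E_eq_0_if_fut_Res[OF _ fut_La[OF f(2)], rotated]) simp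
  then have Ry: "fut (Res lam y) = Res lam y"
    by (intro fut_Res[OF lam f(2)]) (simp add: inner_La_E[symmetric])
  have "D (La (Res lam u)) = La (Res lam y)"
    by (simp add: Res_La[OF f(1) Ru, symmetric] Res_La[OF f(2) Ry, symmetric] tico_Res[OF D] DLa)
  then have "Resp lam g \<in> G" using Ru Ry by (simp add: Resp_eq[OF lam] gu G_def)
  moreover have "inner (Resp lam g) (shp (- t) (k v)) = 0" if t: "0 \<le> t" for t v
    unfolding Resp_def
  proof (rule contraction_semigroup.bounded_linear_resolvent_eq_0[OF contraction_semigroup_eshp[OF lam] bounded_linear_inner_left])
    fix r :: real assume "0 \<le> r"
    then show "inner (eshp lam r g) (shp (- t) (k v)) = 0"
      using o[of "r + t" v] t by (simp add: eshp_def inner_shp shp_shp add.commute)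
  qed
  ultimately show ?thesis by (simp add: G'_def)
qed

text \<open>\<open>G'\<close> is invariant under the resolvent and, by \<open>G'_shp\<close>, under
  the adjoints of the semigroup; hence it reduces the resolvent, as the implicit scheme
  requires.\<close>

lemma proj_G'_Resp: "proj G' (Resp lam x) = Resp lam (proj G' x)"
proof (rule proj_eqI[OF G'_subspace G'_closed])
  show "Resp lam (proj G' x) \<in> G'" by (intro G'_Resp proj_in G'_subspace G'_closed)
  fix z assume z: "z \<in> G'"
  interpret contraction_semigroup "eshp lam :: real \<Rightarrow> 'u l2 \<times> 'y l2 \<Rightarrow> _" lam
    by (rule contraction_semigroup_eshp[OF lam])
  have "inner (Resp lam (x - proj G' x)) z = 0"
    unfolding Resp_def
  proof (rule bounded_linear_resolvent_eq_0[OF bounded_linear_inner_left])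
    fix r :: real assume "0 \<le> r"
    then show "inner (eshp lam r (x - proj G' x)) z = 0"
      using proj_orth[OF G'_subspace G'_closed G'_shp[OF z], of r x] by (simp add: eshp_def inner_shp)
  qed
  then show "inner (Resp lam x - Resp lam (proj G' x)) z = 0"
    by (simp add: Resp_def linear_diff[OF bounded_linear.linear[OF bounded_linear_resolvent]])
qed

lemma G'_trivial:
  assumes g: "g \<in> G'" shows "g = 0"
proof -
  interpret contraction_semigroup "eshp lam :: real \<Rightarrow> 'u l2 \<times> 'y l2 \<Rightarrow> _" lam
    by (rule contraction_semigroup_eshp[OF lam])
  let ?h = "Resp lam (Resp lam g)"
  have inG: "eshp lam t ?h \<in> G'" if t: "0 \<le> t" for t
    unfolding Resp_def
    by (rule U_resolvent2_mem[where P = "proj G'"])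
      (use g t in \<open>simp_all add: G'_closed G'_subspace proj_in[OF G'_subspace G'_closed] norm_proj_le[OF G'_subspace G'_closed]
        norm_diff_proj_le[OF G'_subspace G'_closed] G'_Resp[unfolded Resp_def] proj_G'_Resp[unfolded Resp_def]\<close>)
  have f: "fut (sh t (fst ?h)) = sh t (fst ?h) \<and> fut (sh t (snd ?h)) = sh t (snd ?h)" if t: "0 \<le> t" for t
  proof -
    have "exp (lam * t) *\<^sub>R eshp lam t ?h \<in> G'" by (intro subspace_scale[OF G'_subspace] inG t)
    moreover have "exp (lam * t) *\<^sub>R eshp lam t ?h = shp t ?h"
      unfolding eshp_def scaleR_scaleR mult_exp_exp by (simp add: algebra_simps)
    ultimately have "shp t ?h \<in> G" by (simp add: G'_def)
    then show ?thesis by (simp add: G_iff)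
  qed
  have "fst ?h = 0" "snd ?h = 0" by (rule eq_0_if_fut_sh, use f in blast)+
  \<comment> \<open>Only the smoothed element \<open>?h\<close> was accessible to the scheme;
    injectivity of the resolvent returns to \<open>g\<close>.\<close>
  then have "resolvent (resolvent g) = 0" by (simp add: Resp_def prod_eq_iff)
  then show "g = 0" using resolvent_inj by blast
qed

text \<open>The lower bound makes the image closed, so \<open>g\<close> splits into its projection
  and a remainder in \<open>G'\<close>, which is 0.\<close>

lemma G_eq_W_image: "G = W ` {x. fut x = x}"
proof
  show "W ` {x. fut x = x} \<subseteq> G" using W_fut_in_G by blast
  let ?F = "{x :: 'u l2. fut x = x}"
  let ?H = "W ` ?F"
  have bf: "bounded_linear (mul (indicator {0..}) :: 'u l2 \<Rightarrow> _)" by (rule bounded_linear_mul) simp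
  have F: "subspace ?F"
    by (rule subspaceI) (simp_all add: linear_0[OF linear_fut] linear_add[OF linear_fut] linear_scale[OF linear_fut])
  have Fc: "closed ?F"
    by (intro closed_Collect_eq linear_continuous_on bf continuous_on_id)
  have Hs: "subspace ?H" by (rule linear_subspace_image[OF linear_W F])
  obtain c where c: "c > 0" "\<And>x. norm x \<le> c * norm (W x)" using W_bounded_below by blast
  have "complete ?H"
  proof (rule complete_isometric_image[OF _ F W(1)])
    show "0 < 1 / c" using c by simp
    show "\<forall>x\<in>?F. (1 / c) * norm x \<le> norm (W x)" using c by (auto simp: field_simps)
    show "complete ?F" using Fc by (simp add: complete_eq_closed)
  qed
  then have Hc: "closed ?H" by (simp add: complete_eq_closed)
  show "G \<subseteq> ?H"
  proof
    fix g assume g: "g \<in> G"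
    let ?p = "proj ?H g"
    have p: "?p \<in> ?H" by (rule proj_in[OF Hs Hc])
    have "g - ?p \<in> G'"
      unfolding G'_def
    proof (intro CollectI conjI allI impI)
      obtain x where x: "fut x = x" "?p = W x" using p by auto
      show "g - ?p \<in> G" unfolding x(2) by (rule subspace_diff[OF G_subspace g W_fut_in_G[OF x(1)]])
      fix t :: real and v assume t: "0 \<le> t"
      have "shp (- t) (k v) \<in> ?H"
        by (rule image_eqI[where x = "sh (- t) (E lam v)"]) (use t in \<open>simp_all add: W(2) fut_sh_E_neg[OF lam]\<close>)
      then show "inner (g - ?p) (shp (- t) (k v)) = 0" by (rule proj_orth[OF Hs Hc])
    qed
    then have "g = ?p" using G'_trivial by fastforce
    then show "g \<in> ?H" using p by simp
  qed
qed

section \<open>The factors \<open>M\<close>, \<open>N\<close> and division of stable pairs by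
  them\<close>

definition M :: "'u l2 \<Rightarrow> 'u l2" where "M x = fst (W x)"
definition N :: "'u l2 \<Rightarrow> 'y l2" where "N x = snd (W x)"

lemma W_eq: "W x = (M x, N x)" by (simp add: M_def N_def)

lemma tico_M: "tico M"
  unfolding tico_def
proof (intro conjI allI impI)
  show "bounded_linear M" unfolding M_def[abs_def] by (rule bounded_linear_compose[OF bounded_linear_fst W(1)])
  show "M (c *\<^sub>C x) = c *\<^sub>C M x" for c x by (simp add: M_def W_scaleC scaleC_prod_def)
  show "M (sh t x) = sh t (M x)" for t x by (simp add: M_def W_sh)
  show "fut (M x) = M x" if "fut x = x" for x using W_fut_in_G[OF that] by (simp add: M_def G_iff)
qed

lemma tico_N: "tico N"
  unfolding tico_def
proof (intro conjI allI impI)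
  show "bounded_linear N" unfolding N_def[abs_def] by (rule bounded_linear_compose[OF bounded_linear_snd W(1)])
  show "N (c *\<^sub>C x) = c *\<^sub>C N x" for c x by (simp add: N_def W_scaleC scaleC_prod_def)
  show "N (sh t x) = sh t (N x)" for t x by (simp add: N_def W_sh)
  show "fut (N x) = N x" if "fut x = x" for x using W_fut_in_G[OF that] by (simp add: N_def G_iff)
qed

lemma D_La_M: "fut x = x \<Longrightarrow> D (La (M x)) = La (N x)"
  using W_fut_in_G[of x] by (simp add: W_eq G_def)

lemma MN_inj: "M x = 0 \<Longrightarrow> N x = 0 \<Longrightarrow> x = 0"
  using W_inj[of x 0] by (simp add: W_eq linear_0[OF linear_W] linear_0[OF tico_linear[OF tico_M]] linear_0[OF tico_linear[OF tico_N]])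

text \<open>\<open>Q'\<close> is the inverse of \<open>W\<close> applied to the pair. The lower
  bound on \<open>W\<close> bounds it, and injectivity of \<open>W\<close> transfers the algebraic
  properties; causality needs a preimage supported in the future, as \<open>G_eq_W_image\<close>
  provides.\<close>

lemma factor_through_W:
  fixes Q :: "'z::complex_hilbert l2 \<Rightarrow> 'u l2" and Q1 :: "'z l2 \<Rightarrow> 'y l2"
  assumes Q: "tico Q" and Q1: "tico Q1" and G: "\<And>f. fut f = f \<Longrightarrow> (Q f, Q1 f) \<in> G"
  shows "\<exists>Q'. tico Q' \<and> (\<forall>f. M (Q' f) = Q f \<and> N (Q' f) = Q1 f)"
proof -
  define R where "R = {(f, u). W u = (Q f, Q1 f)}"
  have sub: "subspace R"
    by (rule subspaceI)
      (auto simp: R_def zero_prod_def linear_0[OF linear_W] linear_add[OF linear_W] linear_scale[OF linear_W]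
        linear_0[OF tico_linear[OF Q]] linear_add[OF tico_linear[OF Q]] linear_scale[OF tico_linear[OF Q]]
        linear_0[OF tico_linear[OF Q1]] linear_add[OF tico_linear[OF Q1]] linear_scale[OF tico_linear[OF Q1]])
  have bQ: "bounded_linear (\<lambda>f. (Q f, Q1 f))"
    by (intro bounded_linear_Pair tico_bounded_linear Q Q1)
  obtain KQ where KQ: "KQ > 0" "\<And>f. norm (Q f, Q1 f) \<le> norm f * KQ"
    using bounded_linear.pos_bounded[OF bQ] by blast
  obtain c where c: "c > 0" "\<And>x. norm x \<le> c * norm (W x)" using W_bounded_below by blast
  have bd: "norm u \<le> (c * KQ) * norm f" if "(f, u) \<in> R" for f u
  proof -
    have "norm u \<le> c * norm (Q f, Q1 f)" using c(2)[of u] that by (simp add: R_def)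
    also have "\<dots> \<le> c * (norm f * KQ)" using c by (intro mult_left_mono KQ) auto
    finally show ?thesis by (simp add: mult_ac)
  qed
  \<comment> \<open>The graph condition is available only for inputs supported in the future;
    translating the preimage reaches all shifted exponentials.\<close>
  have dom: "sh t (E 1 v) \<in> fst ` R" for t and v :: 'z
  proof -
    have "(Q (E 1 v), Q1 (E 1 v)) \<in> G" by (rule G) (simp add: fut_E)
    then obtain u where "W u = (Q (E 1 v), Q1 (E 1 v))" unfolding G_eq_W_image by auto
    then have "(sh t (E 1 v), sh t u) \<in> R" by (simp add: R_def W_sh shp_def tico_sh[OF Q] tico_sh[OF Q1])
    then show ?thesis by force
  qed
  have "span (Eset 1) \<subseteq> fst ` R"
    by (rule span_minimal) (use dom in \<open>auto simp: Eset_def\<close>, rule linear_subspace_image[OF linear_fst sub])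
  then have dR: "closure (fst ` R) = UNIV"
    using closure_mono[of "span (Eset 1)" "fst ` R"] closure_span_Eset[of 1] by auto
  obtain Q' where Q': "bounded_linear Q'" "\<And>f u. (f, u) \<in> R \<Longrightarrow> Q' f = u"
    using bounded_linear_relation_extension[OF sub bd dR] by blast
  have WQ': "W (Q' f) = (Q f, Q1 f)" for f
  proof (rule l2_operator_eqI[OF bounded_linear_compose[OF W(1) Q'(1)] bQ, of 1])
    fix t and v :: 'z
    obtain u where "(sh t (E 1 v), u) \<in> R" using dom[of t v] by force
    then show "W (Q' (sh t (E 1 v))) = (Q (sh t (E 1 v)), Q1 (sh t (E 1 v)))"
      using Q'(2) by (auto simp: R_def)
  qed simp
  have "tico Q'"
    unfolding tico_def
  proof (intro conjI allI impI)
    show "Q' (c *\<^sub>C f) = c *\<^sub>C Q' f" for c f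
      by (rule W_inj) (simp add: W_scaleC WQ' tico_scaleC[OF Q] tico_scaleC[OF Q1] scaleC_prod_def)
    show "Q' (sh t f) = sh t (Q' f)" for t f
      by (rule W_inj) (simp add: W_sh WQ' tico_sh[OF Q] tico_sh[OF Q1] shp_def)
    show "fut (Q' f) = Q' f" if f: "fut f = f" for f
    proof -
      obtain u where u: "fut u = u" "W u = (Q f, Q1 f)" using G[OF f] unfolding G_eq_W_image by auto
      then have "Q' f = u" using WQ'[of f] W_inj by simp
      then show ?thesis using u by simp
    qed
  qed (rule Q'(1))
  then show ?thesis using WQ' by (intro exI[of _ Q']) (simp add: W_eq)
qed

theorem factorization:
  "\<exists>(M :: 'u l2 \<Rightarrow> 'u l2) N A2 B2. tico M \<and> tico N \<and> tico A2 \<and> tico B2 \<and> (\<forall>x. fut x = x \<longrightarrow> D (La (M x)) = La (N x)) \<and>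
     (\<forall>x. M x = 0 \<longrightarrow> N x = 0 \<longrightarrow> x = 0) \<and> (\<forall>x. M (A2 x) = A x) \<and> (\<forall>y. M (B2 y) = B y)"
proof -
  obtain A2 where A2: "tico A2" "\<forall>f. M (A2 f) = A f \<and> N (A2 f) = A1 f"
    using factor_through_W[OF A A1 pair_in_G[where Qw = Aw, OF A A1 _ wtA wtA1]] by blast
  obtain B2 where B2: "tico B2" "\<forall>f. M (B2 f) = B f \<and> N (B2 f) = B1 f"
    using factor_through_W[OF B B1 pair_in_G[where Qw = Bw, OF B B1 _ wtB wtB1]] by blast
  show ?thesis
    using A2 B2 tico_M tico_N D_La_M MN_inj
    by (intro exI[of _ M] exI[of _ N] exI[of _ A2] exI[of _ B2]) simp
qed

end

section \<open>Representatives of classes of operators\<close>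

definition to_ae :: "'a::complex_hilbert l2 \<Rightarrow> 'a aefun" where "to_ae x = abs_aefun (fn x)"

text \<open>An isometry of the unweighted space onto \<open>L2w w\<close>. Conjugation by it
  replaces operators on weighted spaces by operators on \<open>l2\<close>.\<close>

definition emb :: "real \<Rightarrow> 'a::complex_hilbert l2 \<Rightarrow> 'a aefun" where
  "emb w x = weight (- w) (to_ae x)"

lemma abs_aefun_cases: obtains g where "f = abs_aefun g"
  by (metis Quotient_abs_rep[OF Quotient_aefun])

lemma emb_eq: "emb w x = abs_aefun (\<lambda>t. exp (w * t) *\<^sub>R fn x t)"
  by (simp add: emb_def to_ae_def weight.abs_eq)

lemma abs_aefun_eqI: "AE t in lebesgue. f t = g t \<Longrightarrow> abs_aefun f = abs_aefun g"
  by (simp add: aefun.abs_eq_iff)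

lemma weight_emb: "weight w (emb w x) = to_ae x"
  unfolding emb_eq to_ae_def weight.abs_eq by (rule abs_aefun_eqI) (simp add: exp_add[symmetric])

lemma mem_L2w_iff: "f \<in> L2w w \<longleftrightarrow> (\<exists>x. f = emb w x)"
proof
  assume f: "f \<in> L2w w"
  obtain g where g: "f = abs_aefun g" by (rule abs_aefun_cases)
  have sq: "square_integrable (\<lambda>t. exp (- w * t) *\<^sub>R g t)"
    using f by (simp add: L2w_def g weight.abs_eq in_L2.abs_eq square_integrable_def)
  have "f = emb w (L2 (\<lambda>t. exp (- w * t) *\<^sub>R g t))"
    unfolding emb_eq g
  proof (rule abs_aefun_eqI)
    show "AE t in lebesgue. g t = exp (w * t) *\<^sub>R fn (L2 (\<lambda>t. exp (- w * t) *\<^sub>R g t)) t"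
      using fn_L2[OF sq] by eventually_elim (simp add: exp_add[symmetric])
  qed
  then show "\<exists>x. f = emb w x" ..
next
  assume "\<exists>x. f = emb w x"
  then show "f \<in> L2w w"
    using square_integrable_fn by (auto simp: L2w_def weight_emb to_ae_def in_L2.abs_eq square_integrable_def)
qed

lemma emb_in [simp]: "emb w x \<in> L2w w"
  by (auto simp: mem_L2w_iff)

lemma emb_eq_emb_iff: "emb w x = emb w' y \<longleftrightarrow> wt (w' - w) x y"
  unfolding emb_eq aefun.abs_eq_iff wt_def
proof
  assume "AE t in lebesgue. exp (w * t) *\<^sub>R fn x t = exp (w' * t) *\<^sub>R fn y t"
  then show "AE t in lebesgue. fn y t = exp (- (w' - w) * t) *\<^sub>R fn x t"
  proof eventually_elim
    case (elim t)
    then have "exp (- w' * t) *\<^sub>R (exp (w * t) *\<^sub>R fn x t) = exp (- w' * t) *\<^sub>R (exp (w' * t) *\<^sub>R fn y t)" by simp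
    then show ?case by (simp add: exp_add[symmetric] algebra_simps)
  qed
next
  assume "AE t in lebesgue. fn y t = exp (- (w' - w) * t) *\<^sub>R fn x t"
  then show "AE t in lebesgue. exp (w * t) *\<^sub>R fn x t = exp (w' * t) *\<^sub>R fn y t"
    by eventually_elim (simp add: exp_add[symmetric] algebra_simps)
qed

lemma emb_inj [simp]: "emb w x = emb w y \<longleftrightarrow> x = y"
  by (simp add: emb_eq_emb_iff wt_0_iff)

lemma norm_L2w_emb [simp]: "norm_L2w w (emb w x) = norm x"
  by (simp add: norm_L2w_def weight_emb to_ae_def norm_L2.abs_eq nn_integral_fn)

lemma emb_add: "emb w (x + y) = emb w x + emb w y"
  unfolding emb_eq plus_aefun.abs_eq
proof (rule abs_aefun_eqI)
  show "AE t in lebesgue. exp (w * t) *\<^sub>R fn (x + y) t = exp (w * t) *\<^sub>R fn x t + exp (w * t) *\<^sub>R fn y t"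
    using fn_add[of x y] by eventually_elim (simp add: scaleR_add_right)
qed

lemma emb_uminus: "emb w (- x) = - emb w x"
  unfolding emb_eq uminus_aefun.abs_eq
proof (rule abs_aefun_eqI)
  show "AE t in lebesgue. exp (w * t) *\<^sub>R fn (- x) t = - (exp (w * t) *\<^sub>R fn x t)"
    using fn_uminus[of x] by eventually_elim simp
qed

lemma emb_scaleC: "emb w (c *\<^sub>C x) = c *\<^sub>C emb w x"
  unfolding emb_eq scaleC_aefun.abs_eq
proof (rule abs_aefun_eqI)
  show "AE t in lebesgue. exp (w * t) *\<^sub>R fn (c *\<^sub>C x) t = c *\<^sub>C (exp (w * t) *\<^sub>R fn x t)"
    using fn_scaleC[of c x] by eventually_elim (simp add: scaleR_scaleC_commute)
qed

lemma emb_zero: "emb w 0 = 0"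
  unfolding emb_eq zero_aefun_def
  using fn_zero by (intro abs_aefun_eqI) (auto elim: eventually_mono)

lemma shift_emb: "shift t (emb w x) = emb w (exp (w * t) *\<^sub>R sh t x)"
  unfolding emb_eq shift.abs_eq
proof (rule abs_aefun_eqI)
  show "AE s in lebesgue. exp (w * (t + s)) *\<^sub>R fn x (t + s) = exp (w * s) *\<^sub>R fn (exp (w * t) *\<^sub>R sh t x) s"
    using fn_scaleR[of "exp (w * t)" "sh t x"] fn_sh[of t x]
    by eventually_elim (simp add: exp_add[symmetric] algebra_simps)
qed

lemma cut_emb:
  assumes "S \<in> sets borel" shows "cut S (emb w x) = emb w (mul (indicator S) x)"
  unfolding emb_eq cut.abs_eq
proof (rule abs_aefun_eqI)
  show "AE s in lebesgue. indicator S s *\<^sub>R exp (w * s) *\<^sub>R fn x s = exp (w * s) *\<^sub>R fn (mul (indicator S) x) s"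
    using fn_mul[OF bounded_measurable_indicator[OF assms], of x] by eventually_elim simp
qed

lemma fut_iff_pi_minus: "pi_minus (emb w x) = 0 \<longleftrightarrow> fut x = x"
proof -
  have "pi_minus (emb w x) = 0 \<longleftrightarrow> mul (indicator {..<0}) x = 0"
    unfolding pi_minus_def by (subst emb_zero[of w, symmetric]) (simp add: cut_emb)
  also have "\<dots> \<longleftrightarrow> fut x = x"
  proof -
    have m: "AE t in lebesgue. fn (mul (indicator {..<0}) x) t = indicator {..<0} t *\<^sub>R fn x t"
      "AE t in lebesgue. fn (fut x) t = indicator {0..} t *\<^sub>R fn x t"
      by (intro fn_mul; simp)+
    have "x = fut x + mul (indicator {..<0}) x"
    proof (rule l2_eqI)
      show "AE t in lebesgue. fn x t = fn (fut x + mul (indicator {..<0}) x) t"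
        using m fn_add[of "fut x" "mul (indicator {..<0}) x"] by eventually_elim (auto simp: indicator_def)
    qed
    then show ?thesis by (metis add.right_neutral add_cancel_right_right)
  qed
  finally show ?thesis .
qed

lemma pi_plus_emb: "pi_plus (emb w x) = emb w (fut x)"
  by (simp add: pi_plus_def cut_emb)

text \<open>Outside \<open>L2w w\<close> the value of \<open>inv (emb w)\<close> is arbitrary, which
  is harmless because \<open>TIC_rel\<close> compares operators only inside the weighted
  spaces.\<close>

definition op :: "real \<Rightarrow> ('u::complex_hilbert l2 \<Rightarrow> 'y::complex_hilbert l2) \<Rightarrow> 'u aefun \<Rightarrow> 'y aefun" where
  "op w Q f = emb w (Q (inv (emb w) f))"

lemma op_emb [simp]: "op w Q (emb w x) = emb w (Q x)"
  by (simp add: op_def inv_f_f inj_on_def)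

lemma TIC_opI:
  fixes D :: "'u::complex_hilbert aefun \<Rightarrow> 'y::complex_hilbert aefun"
  assumes Q: "tico Q" and D: "\<And>x. D (emb w x) = emb w (Q x)"
  shows "D \<in> TIC_op w"
proof -
  obtain K where K: "\<And>x. norm (Q x) \<le> norm x * K" using bounded_linear.bounded[OF tico_bounded_linear[OF Q]] by blast
  have "\<exists>K. \<forall>f\<in>L2w w. norm_L2w w (D f) \<le> K * norm_L2w w f"
    using K by (intro exI[of _ K]) (auto simp: mem_L2w_iff mult.commute D)
  then have "D \<in> BL_L2w w"
    unfolding BL_L2w_def
    by (auto simp: mem_L2w_iff emb_add[symmetric] emb_scaleC[symmetric] linear_add[OF tico_linear[OF Q]] tico_scaleC[OF Q] D)
  then show ?thesis
    unfolding TIC_op_def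
    by (auto simp: mem_L2w_iff shift_emb pi_plus_emb fut_iff_pi_minus linear_scale[OF tico_linear[OF Q]] tico_sh[OF Q]
      tico_causal[OF Q] D)
qed

lemma TIC_op_op: "tico Q \<Longrightarrow> op w Q \<in> TIC_op w"
  by (rule TIC_opI) simp_all

lemma TIC_op_E:
  fixes D :: "'u::complex_hilbert aefun \<Rightarrow> 'y::complex_hilbert aefun"
  assumes D: "D \<in> TIC_op w"
  obtains Q where "tico Q" "\<And>x. D (emb w x) = emb w (Q x)"
proof -
  have B: "D \<in> BL_L2w w" and S: "\<And>t f. f \<in> L2w w \<Longrightarrow> shift t (D f) = D (shift t f)"
    and C: "\<And>f. f \<in> L2w w \<Longrightarrow> pi_minus (D (pi_plus f)) = 0"
    using D by (auto simp: TIC_op_def)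
  have "\<forall>x. \<exists>y. D (emb w x) = emb w y" using B by (auto simp: BL_L2w_def mem_L2w_iff)
  then obtain Q where Q: "\<And>x. D (emb w x) = emb w (Q x)" by metis
  have add: "Q (x + y) = Q x + Q y" for x y
  proof -
    have "D (emb w x + emb w y) = D (emb w x) + D (emb w y)" using B by (simp add: BL_L2w_def)
    then show ?thesis by (simp add: emb_add[symmetric] Q)
  qed
  have sC: "Q (c *\<^sub>C x) = c *\<^sub>C Q x" for c x
  proof -
    have "D (c *\<^sub>C emb w x) = c *\<^sub>C D (emb w x)" using B by (simp add: BL_L2w_def)
    then show ?thesis by (simp add: emb_scaleC[symmetric] Q)
  qed
  have sR: "Q (r *\<^sub>R x) = r *\<^sub>R Q x" for r x
    using sC[of "complex_of_real r" x] by (simp add: scaleC_of_real)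
  obtain K where "\<forall>f\<in>L2w w. norm_L2w w (D f) \<le> K * norm_L2w w f"
    using B unfolding BL_L2w_def by blast
  then have K: "norm_L2w w (D f) \<le> K * norm_L2w w f" if "f \<in> L2w w" for f using that by blast
  have "tico Q"
    unfolding tico_def
  proof (intro conjI allI impI)
    show "bounded_linear Q"
      by (rule bounded_linear_intro[where K = K, OF add sR])
        (use K[OF emb_in] in \<open>simp add: Q mult.commute\<close>)
    show "Q (sh t x) = sh t (Q x)" for t x
      using S[OF emb_in[of w x], of t] by (simp add: Q shift_emb sR)
    show "fut (Q x) = Q x" if "fut x = x" for x
      using C[OF emb_in[of w x]] that by (simp add: Q pi_plus_emb fut_iff_pi_minus)
  qed (rule sC)
  then show thesis using Q that by blast
qed

text \<open>\<open>TIC_rel\<close> after conjugation, where \<open>a\<close> is the difference of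
  the two weights.\<close>

definition agree :: "real \<Rightarrow> ('u::complex_hilbert l2 \<Rightarrow> 'y::complex_hilbert l2) \<Rightarrow> ('u l2 \<Rightarrow> 'y l2) \<Rightarrow> bool" where
  "agree a Q Q' \<longleftrightarrow> (\<forall>x y. wt a x y \<longrightarrow> wt a (Q x) (Q' y))"

lemma TIC_rel_iff:
  fixes D D' :: "'u::complex_hilbert aefun \<Rightarrow> 'y::complex_hilbert aefun"
  assumes "D \<in> TIC_op w" "D' \<in> TIC_op w'"
    and Q: "\<And>x. D (emb w x) = emb w (Q x)" and Q': "\<And>x. D' (emb w' x) = emb w' (Q' x)"
  shows "((w, D), (w', D')) \<in> TIC_rel \<longleftrightarrow> agree (w' - w) Q Q'"
proof -
  have "((w, D), (w', D')) \<in> TIC_rel \<longleftrightarrow> (\<forall>f \<in> L2w w \<inter> L2w w'. D f = D' f)"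
    using assms(1,2) by (simp add: TIC_rel_def)
  also have "\<dots> \<longleftrightarrow> (\<forall>x y. emb w x = emb w' y \<longrightarrow> D (emb w x) = D' (emb w' y))"
  proof
    assume *: "\<forall>f \<in> L2w w \<inter> L2w w'. D f = D' f"
    show "\<forall>x y. emb w x = emb w' y \<longrightarrow> D (emb w x) = D' (emb w' y)"
    proof (intro allI impI)
      fix x y :: "'u l2" assume e: "emb w x = emb w' y"
      have "emb w x \<in> L2w w \<inter> L2w w'" using emb_in[of w x] emb_in[of w' y] by (simp add: e)
      from bspec[OF * this] show "D (emb w x) = D' (emb w' y)" by (simp add: e)
    qed
  next
    assume *: "\<forall>x y. emb w x = emb w' y \<longrightarrow> D (emb w x) = D' (emb w' y)"
    show "\<forall>f \<in> L2w w \<inter> L2w w'. D f = D' f"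
    proof
      fix f :: "'u aefun" assume "f \<in> L2w w \<inter> L2w w'"
      then have "\<exists>x. f = emb w x" "\<exists>y. f = emb w' y" unfolding mem_L2w_iff[symmetric] by auto
      then obtain x y where "f = emb w x" "f = emb w' y" by blast
      then show "D f = D' f" using * by metis
    qed
  qed
  also have "\<dots> \<longleftrightarrow> agree (w' - w) Q Q'"
    unfolding agree_def Q Q' emb_eq_emb_iff ..
  finally show ?thesis .
qed

lemma mul_indicator_tendsto: "(\<lambda>n. mul (indicator {- real n..real n}) x) \<longlonglongrightarrow> x"
proof -
  let ?m = "\<lambda>n. mul (indicator {- real n..real n}) x"
  have m: "AE t in lebesgue. fn (?m n - x) t = (indicator {- real n..real n} t - 1) *\<^sub>R fn x t" for n
  proof -
    have "AE t in lebesgue. fn (?m n) t = indicator {- real n..real n} t *\<^sub>R fn x t" by (rule fn_mul) simp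
    with fn_diff[of "?m n" x] show ?thesis by eventually_elim (simp add: scaleR_diff_left)
  qed
  have "(\<lambda>n. \<integral>t. (norm (fn (?m n - x) t))\<^sup>2 \<partial>lebesgue) \<longlonglongrightarrow> (\<integral>t. 0 \<partial>(lebesgue :: real measure))"
  proof (rule integral_dominated_convergence[where w = "\<lambda>t. (norm (fn x t))\<^sup>2"])
    show "integrable lebesgue (\<lambda>t. (norm (fn x t))\<^sup>2)"
      using square_integrable_fn[of x] by (simp add: square_integrable_iff)
    have "AE t in lebesgue. \<forall>n. fn (?m n - x) t = (indicator {- real n..real n} t - 1) *\<^sub>R fn x t"
      using m by (subst AE_all_countable) blast
    then show "AE t in lebesgue. (\<lambda>n. (norm (fn (?m n - x) t))\<^sup>2) \<longlonglongrightarrow> 0"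
    proof eventually_elim
      case (elim t)
      obtain k where k: "\<bar>t\<bar> \<le> real k" using real_arch_simple by blast
      have "\<forall>\<^sub>F n in sequentially. (norm (fn (?m n - x) t))\<^sup>2 = 0"
        using eventually_ge_at_top[of k]
      proof eventually_elim
        case (elim n)
        then have "real k \<le> real n" by simp
        then have "t \<in> {- real n..real n}" using k by auto
        then show ?case using \<open>\<forall>n. _\<close> by simp
      qed
      then show ?case by (rule tendsto_eventually)
    qed
    show "AE t in lebesgue. norm ((norm (fn (?m n - x) t))\<^sup>2) \<le> (norm (fn x t))\<^sup>2" for n
      using m[of n] by eventually_elim (auto simp: indicator_def)
  qed (simp_all add: borel_measurable_norm2_strongly)
  then have "(\<lambda>n. (norm (?m n - x))\<^sup>2) \<longlonglongrightarrow> 0" by (simp only: norm_L2_sq integral_zero)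
  then have "(\<lambda>n. sqrt ((norm (?m n - x))\<^sup>2)) \<longlonglongrightarrow> sqrt 0" by (rule tendsto_real_sqrt)
  then have "(\<lambda>n. norm (?m n - x)) \<longlonglongrightarrow> 0" by simp
  then show ?thesis by (simp only: tendsto_norm_zero_iff LIM_zero_iff)
qed

text \<open>A function with the weights \<open>0\<close> and \<open>a + b\<close> need not have the weight \<open>a\<close>, but its truncations do.\<close>

lemma agree_trans:
  fixes Q1 Q2 Q3 :: "'a::complex_hilbert l2 \<Rightarrow> 'b::complex_hilbert l2"
  assumes Q: "tico Q1" "tico Q3" and "agree a Q1 Q2" "agree b Q2 Q3"
  shows "agree (a + b) Q1 Q3"
  unfolding agree_def
proof (intro allI impI)
  fix x z :: "'a l2" assume xz: "wt (a + b) x z"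
  let ?I = "\<lambda>n::nat. {- real n..real n}"
  show "wt (a + b) (Q1 x) (Q3 z)"
  proof (rule wt_limit)
    show "(\<lambda>n. Q1 (mul (indicator (?I n)) x)) \<longlonglongrightarrow> Q1 x"
      by (rule bounded_linear.tendsto[OF tico_bounded_linear[OF Q(1)] mul_indicator_tendsto])
    show "(\<lambda>n. Q3 (mul (indicator (?I n)) z)) \<longlonglongrightarrow> Q3 z"
      by (rule bounded_linear.tendsto[OF tico_bounded_linear[OF Q(2)] mul_indicator_tendsto])
    fix n
    \<comment> \<open>On the bounded interval the intermediate weight is harmless:
      \<open>mul \<phi> x\<close> is the truncation as seen at weight \<open>a\<close>, where
      \<open>Q2\<close> acts.\<close>
    define \<phi> where "\<phi> t = indicator (?I n) t * exp (- a * t)" for t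
    have \<phi>: "bounded_measurable \<phi>"
    proof (rule bounded_measurableI[where C = "exp (\<bar>a\<bar> * n)"])
      fix t
      have "- a * t \<le> \<bar>a\<bar> * n" if "t \<in> ?I n"
      proof -
        have "- a * t \<le> \<bar>a\<bar> * \<bar>t\<bar>" by (simp add: abs_mult[symmetric])
        also have "\<dots> \<le> \<bar>a\<bar> * n" using that by (intro mult_left_mono) auto
        finally show ?thesis .
      qed
      then show "\<bar>\<phi> t\<bar> \<le> exp (\<bar>a\<bar> * n)" by (auto simp: \<phi>_def indicator_def)
    qed (simp add: \<phi>_def[abs_def])
    have f: "AE t in lebesgue. fn (mul \<phi> x) t = \<phi> t *\<^sub>R fn x t" by (rule fn_mul[OF \<phi>])
    have i: "AE t in lebesgue. fn (mul (indicator (?I n)) y) t = indicator (?I n) t *\<^sub>R fn y t" for y :: "'a l2"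
      by (rule fn_mul) simp
    have 1: "wt a (mul (indicator (?I n)) x) (mul \<phi> x)"
      unfolding wt_def using f i[of x] by eventually_elim (simp add: \<phi>_def)
    have 2: "wt b (mul \<phi> x) (mul (indicator (?I n)) z)"
      using f i[of z] xz unfolding wt_def
      by eventually_elim (simp add: \<phi>_def exp_add[symmetric] algebra_simps)
    have "wt a (Q1 (mul (indicator (?I n)) x)) (Q2 (mul \<phi> x))" "wt b (Q2 (mul \<phi> x)) (Q3 (mul (indicator (?I n)) z))"
      using assms(3,4) 1 2 by (auto simp: agree_def)
    then show "wt (a + b) (Q1 (mul (indicator (?I n)) x)) (Q3 (mul (indicator (?I n)) z))" by (rule wt_trans)
  qed
qed

lemma agree_sym: "agree a Q Q' \<Longrightarrow> agree (- a) Q' Q"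
  unfolding agree_def using wt_sym by (metis minus_minus)

section \<open>Classes described by an operator at a chosen weight\<close>

lemma equiv_TIC_rel: "equiv (SIGMA w:UNIV. TIC_op w) (TIC_rel :: ((real \<times> ('u::complex_hilbert aefun \<Rightarrow> 'y::complex_hilbert aefun)) \<times> _) set)"
proof (rule equivI)
  show "refl_on (SIGMA w:UNIV. TIC_op w) (TIC_rel :: ((real \<times> ('u aefun \<Rightarrow> 'y aefun)) \<times> _) set)"
    by (auto simp: refl_on_def TIC_rel_def)
  show "(TIC_rel :: ((real \<times> ('u aefun \<Rightarrow> 'y aefun)) \<times> _) set) \<subseteq> (SIGMA w:UNIV. TIC_op w) \<times> (SIGMA w:UNIV. TIC_op w)"
    by (auto simp: TIC_rel_def)
  show "sym (TIC_rel :: ((real \<times> ('u aefun \<Rightarrow> 'y aefun)) \<times> _) set)"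
    by (auto simp: sym_def TIC_rel_def)
  show "trans (TIC_rel :: ((real \<times> ('u aefun \<Rightarrow> 'y aefun)) \<times> _) set)"
  proof (rule transI)
    fix p q r :: "real \<times> ('u aefun \<Rightarrow> 'y aefun)"
    assume pq: "(p, q) \<in> TIC_rel" and qr: "(q, r) \<in> TIC_rel"
    obtain w1 D1 w2 D2 w3 D3 where e: "p = (w1, D1)" "q = (w2, D2)" "r = (w3, D3)" by (metis prod.collapse)
    have D: "D1 \<in> TIC_op w1" "D2 \<in> TIC_op w2" "D3 \<in> TIC_op w3"
      using pq qr by (auto simp: e TIC_rel_def)
    obtain Q1 where Q1: "tico Q1" "\<And>x. D1 (emb w1 x) = emb w1 (Q1 x)" using TIC_op_E[OF D(1)] by blast
    obtain Q2 where Q2: "tico Q2" "\<And>x. D2 (emb w2 x) = emb w2 (Q2 x)" using TIC_op_E[OF D(2)] by blast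
    obtain Q3 where Q3: "tico Q3" "\<And>x. D3 (emb w3 x) = emb w3 (Q3 x)" using TIC_op_E[OF D(3)] by blast
    have "agree (w2 - w1) Q1 Q2" using pq TIC_rel_iff[OF D(1,2) Q1(2) Q2(2)] by (simp add: e)
    moreover have "agree (w3 - w2) Q2 Q3" using qr TIC_rel_iff[OF D(2,3) Q2(2) Q3(2)] by (simp add: e)
    ultimately have "agree (w3 - w1) Q1 Q3" using agree_trans[OF Q1(1) Q3(1)] by fastforce
    then show "(p, r) \<in> TIC_rel" using TIC_rel_iff[OF D(1,3) Q1(2) Q3(2)] by (simp add: e)
  qed
qed

text \<open>At a fixed weight such a \<open>Q\<close> is unique, so once classes have
  representatives at a common weight, identities between classes become pointwise identities of
  operators.\<close>

definition rep :: "real \<Rightarrow> ('u::complex_hilbert, 'y::complex_hilbert) tic \<Rightarrow> ('u l2 \<Rightarrow> 'y l2) \<Rightarrow> bool" where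
  "rep w A Q \<longleftrightarrow> tico Q \<and> A = TIC_rel `` {(w, op w Q)}"

lemma rep_tico: "rep w A Q \<Longrightarrow> tico Q" by (simp add: rep_def)

lemma class_eq_iff:
  assumes "D \<in> TIC_op w" "D' \<in> TIC_op w'"
  shows "TIC_rel `` {(w, D)} = TIC_rel `` {(w', D')} \<longleftrightarrow> ((w, D), (w', D')) \<in> TIC_rel"
  using eq_equiv_class_iff[OF equiv_TIC_rel, of "(w, D)" "(w', D')"] assms by auto

lemma rep_class:
  assumes Q: "tico Q" and D: "\<And>x. D (emb w x) = emb w (Q x)"
  shows "rep w (TIC_rel `` {(w, D)}) Q"
  unfolding rep_def class_eq_iff[OF TIC_opI[OF Q D] TIC_op_op[OF Q]]
    TIC_rel_iff[OF TIC_opI[OF Q D] TIC_op_op[OF Q] D op_emb]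
  by (simp add: agree_def wt_0_iff Q)

lemma rep_eq_iff:
  assumes "rep w A Q" "tico Q'"
  shows "rep w' A Q' \<longleftrightarrow> agree (w' - w) Q Q'"
proof -
  have Q: "tico Q" "A = TIC_rel `` {(w, op w Q)}" using assms(1) by (simp_all add: rep_def)
  show ?thesis
    unfolding rep_def Q(2) class_eq_iff[OF TIC_op_op[OF Q(1)] TIC_op_op[OF assms(2)]]
      TIC_rel_iff[OF TIC_op_op[OF Q(1)] TIC_op_op[OF assms(2)] op_emb op_emb]
    by (simp add: assms(2))
qed

lemma rep_agree: "rep w A Q \<Longrightarrow> rep w' A Q' \<Longrightarrow> agree (w' - w) Q Q'"
  using rep_eq_iff[of w A Q Q' w'] rep_tico by blast

lemma rep_unique: "rep w A Q \<Longrightarrow> rep w A Q' \<Longrightarrow> Q = Q'"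
  using rep_agree[of w A Q w Q'] by (auto simp: agree_def wt_0_iff)

lemma rep_tic_eq: "rep w A Q \<Longrightarrow> rep w B Q \<Longrightarrow> A = B" by (simp add: rep_def)

lemma rep_up:
  assumes "rep w A Q" "w \<le> w'" obtains Q' where "rep w' A Q'"
proof -
  obtain Q' where "tico Q'" "\<forall>x y. wt (w' - w) x y \<longrightarrow> wt (w' - w) (Q x) (Q' y)"
    using tico_extension[OF rep_tico[OF assms(1)], of "w' - w"] assms(2) by auto
  then have "rep w' A Q'" using rep_eq_iff[OF assms(1)] by (simp add: agree_def)
  then show thesis by (rule that)
qed

lemma rep_mem: "rep w A Q \<Longrightarrow> (w, op w Q) \<in> A"
  using equiv_class_self[OF equiv_TIC_rel, of "(w, op w Q)"] TIC_op_op[of Q w] by (auto simp: rep_def)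

lemma mem_rep:
  assumes "rep w A Q" "(w', D) \<in> A"
  obtains Q' where "rep w' A Q'" "\<And>x. D (emb w' x) = emb w' (Q' x)"
proof -
  have r: "((w, op w Q), (w', D)) \<in> TIC_rel" using assms by (simp add: rep_def)
  then have D: "D \<in> TIC_op w'" by (simp add: TIC_rel_def)
  have "A = TIC_rel `` {(w', D)}"
    using assms(1) r class_eq_iff[OF TIC_op_op[OF rep_tico[OF assms(1)]] D] by (simp add: rep_def)
  moreover obtain Q' where "tico Q'" "\<And>x. D (emb w' x) = emb w' (Q' x)" using TIC_op_E[OF D] by blast
  ultimately show thesis using that rep_class by metis
qed

lemma TIC_inf_iff: "A \<in> TIC_inf \<longleftrightarrow> (\<exists>w Q. rep w A Q)"
proof
  assume "A \<in> TIC_inf"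
  then obtain w D where D: "D \<in> TIC_op w" "A = TIC_rel `` {(w, D)}" by (auto simp: TIC_inf_def elim!: quotientE)
  obtain Q where "tico Q" "\<And>x. D (emb w x) = emb w (Q x)" using TIC_op_E[OF D(1)] by blast
  then show "\<exists>w Q. rep w A Q" using rep_class D(2) by metis
next
  assume "\<exists>w Q. rep w A Q"
  then obtain w Q where "tico Q" "A = TIC_rel `` {(w, op w Q)}" by (auto simp: rep_def)
  then show "A \<in> TIC_inf" unfolding TIC_inf_def using TIC_op_op[of Q w] by (auto intro!: quotientI)
qed

lemma TIC_iff: "A \<in> TIC w \<longleftrightarrow> (\<exists>Q. rep w A Q)"
proof
  assume "A \<in> TIC w"
  then obtain D w' Q where "(w, D) \<in> A" "rep w' A Q" by (auto simp: TIC_def TIC_inf_iff)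
  then show "\<exists>Q. rep w A Q" using mem_rep by blast
next
  assume "\<exists>Q. rep w A Q"
  then show "A \<in> TIC w" using rep_mem by (auto simp: TIC_def TIC_inf_iff)
qed

text \<open>The operations on classes are unions over all choices of representatives; the next lemma
  collapses such a union when all its members coincide.\<close>

lemma rep_Union:
  assumes Q: "tico Q" and D: "\<And>x. D (emb w x) = emb w (Q x)" and S: "TIC_rel `` {(w, D)} \<in> S"
    and all: "\<And>X. X \<in> S \<Longrightarrow> \<exists>w' D' Q'. X = TIC_rel `` {(w', D')} \<and> tico Q' \<and>
      (\<forall>x. D' (emb w' x) = emb w' (Q' x)) \<and> agree (w' - w) Q Q'"
  shows "rep w (\<Union>S) Q"
proof -
  let ?C = "TIC_rel `` {(w, D)}"
  have C: "rep w ?C Q" by (rule rep_class[OF Q D])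
  have "X = ?C" if X: "X \<in> S" for X
  proof -
    obtain w' D' Q' where Q': "X = TIC_rel `` {(w', D')}" "tico Q'" "\<And>x. D' (emb w' x) = emb w' (Q' x)"
      "agree (w' - w) Q Q'" using all[OF X] by blast
    have "rep w' X Q'" unfolding Q'(1) by (rule rep_class[OF Q'(2,3)])
    moreover have "rep w' ?C Q'" using rep_eq_iff[OF C Q'(2)] Q'(4) by simp
    ultimately show ?thesis by (rule rep_tic_eq)
  qed
  then have "S = {?C}" using S by blast
  then show ?thesis using C by simp
qed

lemma tico_compose: "tico Q \<Longrightarrow> tico P \<Longrightarrow> tico (\<lambda>x. Q (P x))"
  by (simp add: tico_def bounded_linear_compose)

lemma rep_comp:
  assumes A: "rep w A Q" and B: "rep w B P"
  shows "rep w (A \<odot> B) (\<lambda>x. Q (P x))"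
  unfolding tic_comp_def
proof (rule rep_Union)
  show "tico (\<lambda>x. Q (P x))" by (rule tico_compose[OF rep_tico[OF A] rep_tico[OF B]])
  show "op w Q (op w P (emb w x)) = emb w (Q (P x))" for x by simp
  show "TIC_rel `` {(w, \<lambda>f. op w Q (op w P f))} \<in> {TIC_rel `` {(w, \<lambda>f. D (E f))} | w D E. (w, D) \<in> A \<and> (w, E) \<in> B}"
    by (intro CollectI exI[of _ w] exI[of _ "op w Q"] exI[of _ "op w P"] conjI refl rep_mem A B)
  fix X assume "X \<in> {TIC_rel `` {(w, \<lambda>f. D (E f))} | w D E. (w, D) \<in> A \<and> (w, E) \<in> B}"
  then obtain w' D E where X: "X = TIC_rel `` {(w', \<lambda>f. D (E f))}" "(w', D) \<in> A" "(w', E) \<in> B" by auto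
  obtain Q' where Q': "rep w' A Q'" "\<And>x. D (emb w' x) = emb w' (Q' x)" using mem_rep[OF A X(2)] by blast
  obtain P' where P': "rep w' B P'" "\<And>x. E (emb w' x) = emb w' (P' x)" using mem_rep[OF B X(3)] by blast
  have "agree (w' - w) (\<lambda>x. Q (P x)) (\<lambda>x. Q' (P' x))"
    using rep_agree[OF A Q'(1)] rep_agree[OF B P'(1)] by (simp add: agree_def)
  moreover have "tico (\<lambda>x. Q' (P' x))" by (rule tico_compose[OF rep_tico[OF Q'(1)] rep_tico[OF P'(1)]])
  ultimately show "\<exists>w' D' Q''. X = TIC_rel `` {(w', D')} \<and> tico Q'' \<and> (\<forall>x. D' (emb w' x) = emb w' (Q'' x)) \<and>
      agree (w' - w) (\<lambda>x. Q (P x)) Q''"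
    by (intro exI[of _ w'] exI[of _ "\<lambda>f. D (E f)"] exI[of _ "\<lambda>x. Q' (P' x)"]) (simp add: X Q' P')
qed

lemma wt_uminus: "wt a x y \<Longrightarrow> wt a (- x) (- y)"
  using wt_scaleR[of a x y "-1"] by simp

lemma fut_uminus: "fut (- x) = - fut x"
  by (intro linear_neg bounded_linear.linear bounded_linear_mul) simp

lemma fut_add: "fut (x + y) = fut x + fut y"
  by (intro linear_add bounded_linear.linear bounded_linear_mul) simp

lemma scaleC_minus: "c *\<^sub>C (- x) = - (c *\<^sub>C (x :: 'a::complex_hilbert))"
  by (intro linear_neg bounded_linear.linear bounded_linear_scaleC)

lemma tico_uminus: "tico Q \<Longrightarrow> tico (\<lambda>x. - Q x)"
  by (simp add: tico_def bounded_linear_minus scaleC_minus linear_neg[OF linear_sh] fut_uminus)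

lemma tico_add: "tico Q \<Longrightarrow> tico P \<Longrightarrow> tico (\<lambda>x. Q x + P x)"
  by (simp add: tico_def bounded_linear_add scaleC_add_right linear_add[OF linear_sh] fut_add)

lemma tico_id: "tico (\<lambda>x. x)"
  by (simp add: tico_def bounded_linear_ident)

lemma rep_uminus:
  assumes A: "rep w A Q"
  shows "rep w (tic_uminus A) (\<lambda>x. - Q x)"
proof -
  have eq: "tic_uminus A = \<Union>{TIC_rel `` {(w, \<lambda>f. - D f)} | w D. (w, D) \<in> A}"
    by (auto simp: tic_uminus_def)
  show ?thesis unfolding eq
  proof (rule rep_Union)
    show "tico (\<lambda>x. - Q x)" by (rule tico_uminus[OF rep_tico[OF A]])
    show "- op w Q (emb w x) = emb w (- Q x)" for x by (simp add: emb_uminus)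
    show "TIC_rel `` {(w, \<lambda>f. - op w Q f)} \<in> {TIC_rel `` {(w, \<lambda>f. - D f)} | w D. (w, D) \<in> A}"
      by (intro CollectI exI[of _ w] exI[of _ "op w Q"] conjI refl rep_mem A)
    fix X assume "X \<in> {TIC_rel `` {(w, \<lambda>f. - D f)} | w D. (w, D) \<in> A}"
    then obtain w' D where X: "X = TIC_rel `` {(w', \<lambda>f. - D f)}" "(w', D) \<in> A" by auto
    obtain Q' where Q': "rep w' A Q'" "\<And>x. D (emb w' x) = emb w' (Q' x)" using mem_rep[OF A X(2)] by blast
    have "agree (w' - w) (\<lambda>x. - Q x) (\<lambda>x. - Q' x)"
      using rep_agree[OF A Q'(1)] by (simp add: agree_def wt_uminus)
    moreover have "tico (\<lambda>x. - Q' x)" by (rule tico_uminus[OF rep_tico[OF Q'(1)]])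
    ultimately show "\<exists>w' D' Q''. X = TIC_rel `` {(w', D')} \<and> tico Q'' \<and> (\<forall>x. D' (emb w' x) = emb w' (Q'' x)) \<and>
        agree (w' - w) (\<lambda>x. - Q x) Q''"
      by (intro exI[of _ w'] exI[of _ "\<lambda>f. - D f"] exI[of _ "\<lambda>x. - Q' x"]) (simp add: X Q' emb_uminus)
  qed
qed

lemma rep_one: "rep w tic_one (\<lambda>x. x)"
proof -
  have "rep 0 tic_one (\<lambda>x :: 'a l2. x)" unfolding tic_one_def by (rule rep_class[OF tico_id]) simp
  then show ?thesis using rep_eq_iff[OF _ tico_id] by (auto simp: agree_def)
qed

subsection \<open>Block operators\<close>

text \<open>Built from the two inclusions, so that causality, invariance and behaviour under weights
  are inherited from \<open>pw\<close> and sums.\<close>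

definition pr :: "'a::complex_hilbert l2 \<Rightarrow> 'b::complex_hilbert l2 \<Rightarrow> ('a \<times> 'b) l2" where
  "pr x y = pw (\<lambda>v. (v, 0)) x + pw (\<lambda>v. (0, v)) y"

lemma bounded_linear_inl: "bounded_linear (\<lambda>v. (v, 0))" and bounded_linear_inr: "bounded_linear (\<lambda>v. (0, v))"
  by (intro bounded_linear_Pair bounded_linear_ident bounded_linear_zero)+

lemma fn_pr:
  fixes x :: "'a::complex_hilbert l2" and y :: "'b::complex_hilbert l2"
  shows "AE t in lebesgue. fn (pr x y) t = (fn x t, fn y t)"
proof -
  have "AE t in lebesgue. fn (pw (\<lambda>v. (v, 0 :: 'b)) x) t = (fn x t, 0)"
    "AE t in lebesgue. fn (pw (\<lambda>v. (0 :: 'a, v)) y) t = (0, fn y t)"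
    by (rule fn_pw[OF bounded_linear_inl] fn_pw[OF bounded_linear_inr])+
  with fn_add[of "pw (\<lambda>v. (v, 0)) x" "pw (\<lambda>v. (0, v)) y"] show ?thesis
    unfolding pr_def by eventually_elim simp
qed

lemma pw_fst_pr [simp]: "pw fst (pr x y) = x"
  by (rule l2_eqI) (use fn_pw[OF bounded_linear_fst, of "pr x y"] fn_pr[of x y] in \<open>eventually_elim, simp\<close>)

lemma pw_snd_pr [simp]: "pw snd (pr x y) = y"
  by (rule l2_eqI) (use fn_pw[OF bounded_linear_snd, of "pr x y"] fn_pr[of x y] in \<open>eventually_elim, simp\<close>)

lemma pr_fst_snd [simp]: "pr (pw fst p) (pw snd p) = p"
  by (rule l2_eqI) (use fn_pw[OF bounded_linear_fst, of p] fn_pw[OF bounded_linear_snd, of p]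
    fn_pr[of "pw fst p" "pw snd p"] in \<open>eventually_elim, simp\<close>)

lemma pr_eq_iff: "pr x y = pr x' y' \<longleftrightarrow> x = x' \<and> y = y'"
  by (metis pw_fst_pr pw_snd_pr)

lemma tico_pw:
  assumes L: "bounded_linear L" "\<And>c v. L (c *\<^sub>C v) = c *\<^sub>C L v"
  shows "tico (pw L)"
  by (simp add: tico_def bounded_linear_pw L pw_scaleC pw_sh pw_mul[symmetric])

lemma scaleC_zero: "c *\<^sub>C 0 = (0 :: 'a::complex_hilbert)"
  by (intro linear_0 bounded_linear.linear bounded_linear_scaleC)

lemma tico_fst: "tico (pw fst)" and tico_snd: "tico (pw snd)"
  and tico_inl: "tico (pw (\<lambda>v. (v, 0)))" and tico_inr: "tico (pw (\<lambda>v. (0, v)))"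
  by (intro tico_pw bounded_linear_fst bounded_linear_snd bounded_linear_inl bounded_linear_inr;
    simp add: scaleC_prod_def scaleC_zero)+

lemma tico_pr: "tico Q \<Longrightarrow> tico P \<Longrightarrow> tico (\<lambda>x. pr (Q x) (P x))"
  unfolding pr_def by (intro tico_add tico_compose[OF tico_inl] tico_compose[OF tico_inr])

lemma wt_pr: "wt a x x' \<Longrightarrow> wt a y y' \<Longrightarrow> wt a (pr x y) (pr x' y')"
  unfolding pr_def by (intro wt_add wt_pw bounded_linear_inl bounded_linear_inr)

lemma ae_pair_emb: "ae_pair (emb w x) (emb w y) = emb w (pr x y)"
  unfolding emb_eq ae_pair.abs_eq
proof (rule abs_aefun_eqI)
  show "AE t in lebesgue. (exp (w * t) *\<^sub>R fn x t, exp (w * t) *\<^sub>R fn y t) = exp (w * t) *\<^sub>R fn (pr x y) t"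
    using fn_pr[of x y] by eventually_elim simp
qed

lemma ae_map_emb:
  assumes L: "bounded_linear L" shows "ae_map L (emb w x) = emb w (pw L x)"
  unfolding emb_eq ae_map.abs_eq
proof (rule abs_aefun_eqI)
  show "AE t in lebesgue. L (exp (w * t) *\<^sub>R fn x t) = exp (w * t) *\<^sub>R fn (pw L x) t"
    using fn_pw[OF L, of x] by eventually_elim (simp add: linear_scale[OF bounded_linear.linear[OF L]])
qed

definition Blk where
  "Blk a b c d p = pr (a (pw fst p) + b (pw snd p)) (c (pw fst p) + d (pw snd p))"

lemma Blk_pr: "Blk a b c d (pr x y) = pr (a x + b y) (c x + d y)"
  by (simp add: Blk_def)

lemma tico_Blk: "tico a \<Longrightarrow> tico b \<Longrightarrow> tico c \<Longrightarrow> tico d \<Longrightarrow> tico (Blk a b c d)"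
  unfolding Blk_def[abs_def]
  by (intro tico_pr tico_add) (rule tico_compose[OF _ tico_fst] tico_compose[OF _ tico_snd], assumption)+

lemma rep_block:
  assumes A: "rep w A a" and B: "rep w B b" and C: "rep w C c" and D: "rep w D d"
  shows "rep w (tic_block A B C D) (Blk a b c d)"
  unfolding tic_block_def
proof (rule rep_Union)
  let ?B = "\<lambda>a b c d f. ae_pair (a (ae_map fst f) + b (ae_map snd f)) (c (ae_map fst f) + d (ae_map snd f))"
  let ?S = "{TIC_rel `` {(w, ?B a b c d)} | w a b c d. (w, a) \<in> A \<and> (w, b) \<in> B \<and> (w, c) \<in> C \<and> (w, d) \<in> D}"
  show "tico (Blk a b c d)" using A B C D by (intro tico_Blk rep_tico)
  show "?B (op w a) (op w b) (op w c) (op w d) (emb w x) = emb w (Blk a b c d x)" for x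
    by (simp add: ae_map_emb bounded_linear_fst bounded_linear_snd ae_pair_emb emb_add[symmetric] Blk_def)
  show "TIC_rel `` {(w, ?B (op w a) (op w b) (op w c) (op w d))} \<in> ?S"
    by (intro CollectI exI[of _ w] exI[of _ "op w a"] exI[of _ "op w b"] exI[of _ "op w c"] exI[of _ "op w d"]
        conjI refl rep_mem A B C D)
  fix X assume "X \<in> ?S"
  then obtain w' a1 b1 c1 d1 where X: "X = TIC_rel `` {(w', ?B a1 b1 c1 d1)}" "(w', a1) \<in> A" "(w', b1) \<in> B"
    "(w', c1) \<in> C" "(w', d1) \<in> D" by auto
  obtain a' where a': "rep w' A a'" "\<And>x. a1 (emb w' x) = emb w' (a' x)" using mem_rep[OF A X(2)] by blast
  obtain b' where b': "rep w' B b'" "\<And>x. b1 (emb w' x) = emb w' (b' x)" using mem_rep[OF B X(3)] by blast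
  obtain c' where c': "rep w' C c'" "\<And>x. c1 (emb w' x) = emb w' (c' x)" using mem_rep[OF C X(4)] by blast
  obtain d' where d': "rep w' D d'" "\<And>x. d1 (emb w' x) = emb w' (d' x)" using mem_rep[OF D X(5)] by blast
  have "agree (w' - w) (Blk a b c d) (Blk a' b' c' d')"
    using rep_agree[OF A a'(1)] rep_agree[OF B b'(1)] rep_agree[OF C c'(1)] rep_agree[OF D d'(1)]
    unfolding agree_def Blk_def
    by (auto intro!: wt_pr wt_add simp: wt_pw bounded_linear_fst bounded_linear_snd)
  moreover have "tico (Blk a' b' c' d')" using a' b' c' d' by (intro tico_Blk rep_tico)
  moreover have "?B a1 b1 c1 d1 (emb w' x) = emb w' (Blk a' b' c' d' x)" for x
    by (simp add: ae_map_emb bounded_linear_fst bounded_linear_snd ae_pair_emb emb_add[symmetric] Blk_def a' b' c' d')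
  ultimately show "\<exists>w' D' Q''. X = TIC_rel `` {(w', D')} \<and> tico Q'' \<and> (\<forall>x. D' (emb w' x) = emb w' (Q'' x)) \<and>
      agree (w' - w) (Blk a b c d) Q''"
    using X(1) by blast
qed

section \<open>Doubly coprime factorization\<close>

lemma agree_comp: "agree a Q Q' \<Longrightarrow> agree a P P' \<Longrightarrow> agree a (\<lambda>x. Q (P x)) (\<lambda>x. Q' (P' x))"
  by (simp add: agree_def)

lemma agree_diff: "agree a Q Q' \<Longrightarrow> agree a P P' \<Longrightarrow> agree a (\<lambda>x. Q x - P x) (\<lambda>x. Q' x - P' x)"
  unfolding agree_def using wt_add[OF _ wt_uminus] by fastforce

lemma agree_id: "agree a (\<lambda>x. x) (\<lambda>x. x)"
  by (simp add: agree_def)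

lemma rep_class_op: "tico Q \<Longrightarrow> rep w (TIC_rel `` {(w, op w Q)}) Q"
  by (simp add: rep_def)

text \<open>Identities are proved at whichever weight is convenient and moved to the other:
  \<open>D\<close> acts only at weight \<open>w\<close>, while injectivity of
  \<open>(M0, N0)\<close> holds at weight 0.\<close>

lemma agree_eq_transfer:
  assumes t: "tico Q" "tico P" "tico Q'" "tico P'" and a: "agree a Q Q'" "agree a P P'"
  shows "Q = P \<longleftrightarrow> Q' = P'"
proof
  note Q = rep_class_op[OF t(1), of 0] and Q' = rep_class_op[OF t(3), of a]
  show "Q' = P'" if "Q = P"
    using rep_eq_iff[OF Q t(3), of a] rep_eq_iff[OF Q t(4), of a] a that by (auto intro: rep_unique)
  show "Q = P" if "Q' = P'"
    using rep_eq_iff[OF Q' t(1), of 0] rep_eq_iff[OF Q' t(2), of 0] agree_sym[OF a(1)] agree_sym[OF a(2)] that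
    by (auto intro: rep_unique)
qed

lemma tico_diff:
  assumes "tico Q" "tico P" shows "tico (\<lambda>x. Q x - P x)"
  using tico_add[OF assms(1) tico_uminus[OF assms(2)]] by simp

text \<open>The digit 0 at the end of a name marks an operator at weight 0; its counterpart without
  it acts at weight \<open>w\<close>. That \<open>A2 - B2 D\<close> inverts \<open>M\<close> from
  the right is the Bezout identity; that it inverts \<open>M\<close> from the left rests on
  injectivity at weight 0.\<close>

lemma stable_right_factor:
  fixes D :: "'u::complex_hilbert l2 \<Rightarrow> 'y::complex_hilbert l2"
  assumes w: "0 \<le> w" and D: "tico D" and A0: "tico A0" and A: "tico A" and B0: "tico B0" and B: "tico B"
    and A1: "tico A1" and B1: "tico B1" and agA: "agree w A0 A" and agB: "agree w B0 B"
    and agA1: "agree w A1 (\<lambda>x. D (A x))" and agB1: "agree w B1 (\<lambda>x. D (B x))"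
    and bezout: "\<And>x. A x - B (D x) = x"
  obtains M0 M :: "'u l2 \<Rightarrow> 'u l2" and N0 :: "'u l2 \<Rightarrow> 'y l2" and A20 A2 :: "'u l2 \<Rightarrow> 'u l2"
    and B20 B2 :: "'y l2 \<Rightarrow> 'u l2" where
    "tico M0" "tico M" "agree w M0 M" "tico N0" "agree w N0 (\<lambda>x. D (M x))"
    "tico A20" "tico A2" "agree w A20 A2" "tico B20" "tico B2" "agree w B20 B2"
    "\<forall>x. M (A2 x) = A x" "\<forall>x. M (B2 x) = B x"
    "\<forall>x. M (A2 x - B2 (D x)) = x" "\<forall>x. A2 (M x) - B2 (D (M x)) = x"
proof -
  interpret F: stable_factorization w D A0 A A1 B0 B B1
    by (rule stable_factorization.intro;
        (rule w D A0 A A1 B0 B B1 bezout agA[unfolded agree_def, rule_format] agB[unfolded agree_def, rule_format]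
          agA1[unfolded agree_def, rule_format] agB1[unfolded agree_def, rule_format])?)
  obtain M0 :: "'u l2 \<Rightarrow> 'u l2" and N0 :: "'u l2 \<Rightarrow> 'y l2" and A20 :: "'u l2 \<Rightarrow> 'u l2"
    and B20 :: "'y l2 \<Rightarrow> 'u l2" where fact: "tico M0 \<and> tico N0 \<and> tico A20 \<and> tico B20 \<and>
      (\<forall>x. fut x = x \<longrightarrow> D (mul (ef w) (M0 x)) = mul (ef w) (N0 x)) \<and>
      (\<forall>x. M0 x = 0 \<longrightarrow> N0 x = 0 \<longrightarrow> x = 0) \<and> (\<forall>x. M0 (A20 x) = A0 x) \<and> (\<forall>y. M0 (B20 y) = B0 y)"
    using F.factorization by (elim exE) (rule that)
  have t0: "tico M0" "tico N0" "tico A20" "tico B20"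
    and La: "fut x = x \<Longrightarrow> D (mul (ef w) (M0 x)) = mul (ef w) (N0 x)"
    and inj: "M0 x = 0 \<Longrightarrow> N0 x = 0 \<Longrightarrow> x = 0"
    and MA0: "M0 (A20 x) = A0 x" and MB0: "M0 (B20 y) = B0 y" for x y
    using fact by simp_all
  obtain M where M: "tico M" "agree w M0 M" using tico_extension[OF t0(1) w] by (auto simp: agree_def)
  obtain N where N: "tico N" "agree w N0 N" using tico_extension[OF t0(2) w] by (auto simp: agree_def)
  obtain A2 where A2: "tico A2" "agree w A20 A2" using tico_extension[OF t0(3) w] by (auto simp: agree_def)
  obtain B2 where B2: "tico B2" "agree w B20 B2" using tico_extension[OF t0(4) w] by (auto simp: agree_def)
  \<comment> \<open>The factorization gives this only for inputs supported in the future;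
    translation invariance and density of shifted exponentials remove the restriction.\<close>
  have NDM: "N x = D (M x)" for x
  proof (rule l2_operator_eqI[OF tico_bounded_linear[OF N(1)] tico_bounded_linear[OF tico_compose[OF D M(1)]] F.lam])
    fix t and v :: 'u
    have f: "fut (E 1 v :: 'u l2) = E 1 v" by (simp add: fut_E)
    have e: "wt w (E 1 v) (E (w + 1) v)" using F.wt_La[OF f] w by (simp add: mul_ef_E)
    have "wt w (M0 (E 1 v)) (M (E (w + 1) v))" using M(2) e by (simp add: agree_def)
    then have 1: "M (E (w + 1) v) = mul (ef w) (M0 (E 1 v))"
      using F.wt_imp_La[OF tico_causal[OF t0(1) f]] by simp
    have "wt w (N0 (E 1 v)) (N (E (w + 1) v))" using N(2) e by (simp add: agree_def)
    then have "N (E (w + 1) v) = mul (ef w) (N0 (E 1 v))"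
      using F.wt_imp_La[OF tico_causal[OF t0(2) f]] by simp
    then have "N (E (w + 1) v) = D (M (E (w + 1) v))" by (simp add: 1 La[OF f])
    then show "N (sh t (E (w + 1) v)) = D (M (sh t (E (w + 1) v)))"
      by (simp add: tico_sh[OF N(1)] tico_sh[OF M(1)] tico_sh[OF D])
  qed
  have ND: "(\<lambda>x. D (M x)) = N" using NDM by auto
  have "(\<lambda>x. M (A2 x)) = A"
    using agree_eq_transfer[OF tico_compose[OF t0(1,3)] A0 tico_compose[OF M(1) A2(1)] A agree_comp[OF M(2) A2(2)] agA] MA0
    by auto
  then have MA: "M (A2 x) = A x" for x by metis
  have "(\<lambda>x. M (B2 x)) = B"
    using agree_eq_transfer[OF tico_compose[OF t0(1,4)] B0 tico_compose[OF M(1) B2(1)] B agree_comp[OF M(2) B2(2)] agB] MB0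
    by auto
  then have MB: "M (B2 x) = B x" for x by metis
  have MI: "M (A2 x - B2 (D x)) = x" for x
    by (simp add: linear_diff[OF tico_linear[OF M(1)]] MA MB bezout)
  \<comment> \<open>The candidate for the identity. At weight \<open>w\<close> both \<open>M\<close>
    and \<open>N\<close> absorb \<open>Z\<close>; moved to weight 0, this forces
    \<open>Z0 x = x\<close> because \<open>M0\<close> and \<open>N0\<close> have no common null
    vector.\<close>
  define Z0 where "Z0 x = A20 (M0 x) - B20 (N0 x)" for x
  define Z where "Z x = A2 (M x) - B2 (N x)" for x
  have Z0: "tico Z0" unfolding Z0_def[abs_def]
    by (rule tico_diff[OF tico_compose[OF t0(3,1)] tico_compose[OF t0(4,2)]])
  have Z: "tico Z" unfolding Z_def[abs_def]
    by (rule tico_diff[OF tico_compose[OF A2(1) M(1)] tico_compose[OF B2(1) N(1)]])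
  have agZ: "agree w Z0 Z" unfolding Z0_def[abs_def] Z_def[abs_def]
    by (rule agree_diff[OF agree_comp[OF A2(2) M(2)] agree_comp[OF B2(2) N(2)]])
  have MZ: "(\<lambda>x. M (Z x)) = M" using MI by (simp add: Z_def NDM)
  have NZ: "(\<lambda>x. N (Z x)) = N" by (rule ext) (use fun_cong[OF MZ] in \<open>simp add: NDM\<close>)
  have MZ0: "(\<lambda>x. M0 (Z0 x)) = M0"
    using agree_eq_transfer[OF tico_compose[OF t0(1) Z0] t0(1) tico_compose[OF M(1) Z] M(1) agree_comp[OF M(2) agZ] M(2)] MZ
    by simp
  have NZ0: "(\<lambda>x. N0 (Z0 x)) = N0"
    using agree_eq_transfer[OF tico_compose[OF t0(2) Z0] t0(2) tico_compose[OF N(1) Z] N(1) agree_comp[OF N(2) agZ] N(2)] NZ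
    by simp
  have "Z0 x = x" for x
  proof -
    have "M0 (Z0 x - x) = 0" "N0 (Z0 x - x) = 0"
      using fun_cong[OF MZ0, of x] fun_cong[OF NZ0, of x]
      by (simp_all add: linear_diff[OF tico_linear[OF t0(1)]] linear_diff[OF tico_linear[OF t0(2)]])
    then show ?thesis using inj[of "Z0 x - x"] by simp
  qed
  then have "Z0 = (\<lambda>x. x)" by auto
  then have "Z = (\<lambda>x. x)"
    using agree_eq_transfer[OF Z0 tico_id Z tico_id agZ agree_id] by simp
  then have IM: "A2 (M x) - B2 (D (M x)) = x" for x
    by (metis Z_def NDM)
  have aN: "agree w N0 (\<lambda>x. D (M x))" by (simp add: ND N)
  show thesis
    by (rule that[OF t0(1) M t0(2) aN t0(3) A2 t0(4) B2]) (simp_all only: MA MB MI IM simp_thms)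
qed

section \<open>Inverses of classes and the final assembly\<close>

lemma is_tic_inverse_iff:
  assumes A: "rep w A Q" and B: "rep w B P"
  shows "is_tic_inverse A B \<longleftrightarrow> (\<forall>x. Q (P x) = x) \<and> (\<forall>x. P (Q x) = x)"
proof -
  have "A \<odot> B = tic_one \<longleftrightarrow> (\<lambda>x. Q (P x)) = (\<lambda>x. x)"
    using rep_comp[OF A B] rep_one[of w] rep_unique rep_tic_eq by metis
  moreover have "B \<odot> A = tic_one \<longleftrightarrow> (\<lambda>x. P (Q x)) = (\<lambda>x. x)"
    using rep_comp[OF B A] rep_one[of w] rep_unique rep_tic_eq by metis
  ultimately show ?thesis unfolding is_tic_inverse_def by metis
qed

lemma tic_inverse_unique:
  assumes A: "A \<in> TIC_inf" and B: "B \<in> TIC_inf" "is_tic_inverse A B" and C: "C \<in> TIC_inf" "is_tic_inverse A C"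
  shows "B = C"
proof -
  obtain w1 Q1 w2 P1 w3 R1 where r: "rep w1 A Q1" "rep w2 B P1" "rep w3 C R1"
    using A B(1) C(1) unfolding TIC_inf_iff by blast
  define w where "w = max w1 (max w2 w3)"
  have le: "w1 \<le> w" "w2 \<le> w" "w3 \<le> w" by (simp_all add: w_def)
  obtain Q where Q: "rep w A Q" by (rule rep_up[OF r(1) le(1)])
  obtain P where P: "rep w B P" by (rule rep_up[OF r(2) le(2)])
  obtain R where R: "rep w C R" by (rule rep_up[OF r(3) le(3)])
  have "P x = R x" for x
    using B(2) C(2) unfolding is_tic_inverse_iff[OF Q P] is_tic_inverse_iff[OF Q R] by metis
  then have "P = R" by auto
  then show ?thesis using P R rep_tic_eq by blast
qed

lemma tic_inv_eqI:
  assumes "A \<in> TIC_inf" "B \<in> TIC_inf" "is_tic_inverse A B"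
  shows "tic_inv A = B"
  unfolding tic_inv_def by (rule the_equality) (use assms tic_inverse_unique in blast)+

lemma tic_inverseI:
  assumes "rep w A Q" "rep w B P" "\<And>x. Q (P x) = x" "\<And>x. P (Q x) = x"
  shows "tic_inv A = B" "A \<in> GTIC_inf" "is_tic_inverse A B"
proof -
  show i: "is_tic_inverse A B" using assms is_tic_inverse_iff by blast
  have "A \<in> TIC_inf" "B \<in> TIC_inf" using assms(1,2) by (auto simp: TIC_inf_iff)
  with i show "tic_inv A = B" "A \<in> GTIC_inf" using tic_inv_eqI[of A B] by (simp_all add: GTIC_inf_def) blast+
qed

definition stable_class :: "('u::complex_hilbert l2 \<Rightarrow> 'y::complex_hilbert l2) \<Rightarrow> ('u, 'y) tic" where
  "stable_class Q = TIC_rel `` {(0, op 0 Q)}"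

lemma rep_stable_class: "tico Q \<Longrightarrow> rep 0 (stable_class Q) Q"
  by (simp add: stable_class_def rep_class_op)

lemma stable_class_TIC: "tico Q \<Longrightarrow> stable_class Q \<in> TIC 0"
  using rep_stable_class TIC_iff by blast

lemma rep_stable_class_agree: "tico Q \<Longrightarrow> tico Q' \<Longrightarrow> agree w Q Q' \<Longrightarrow> rep w (stable_class Q) Q'"
  using rep_eq_iff[OF rep_stable_class, of Q Q' w] by simp

theorem lemma5p20:
  fixes D :: "('u::complex_hilbert, 'y::complex_hilbert) tic"
  assumes "D \<in> TIC_inf"
    and "\<exists>T :: ('y, 'u) tic. stabilizing_controller D T"
  shows "has_dcf D"
proof -
  obtain T :: "('y, 'u) tic" where st: "stabilizing_controller D T" using assms(2) by blast
  let ?S = "tic_block tic_one (tic_uminus T) (tic_uminus D) tic_one"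
  have T: "T \<in> TIC_inf" and S: "?S \<in> GTIC_inf" and F0: "tic_inv ?S \<in> TIC 0"
    using st by (simp_all add: stabilizing_controller_def)
  define F where "F = tic_inv ?S"
  obtain F' where "F' \<in> TIC_inf" "is_tic_inverse ?S F'" using S by (auto simp: GTIC_inf_def)
  then have inv: "is_tic_inverse ?S F" using tic_inv_eqI[of ?S F'] S by (simp add: F_def GTIC_inf_def)
  obtain QF where QF: "rep 0 F QF" using F0 by (auto simp: F_def TIC_iff)
  have tQF: "tico QF" by (rule rep_tico[OF QF])
  obtain wD D1 wT T1 where D1: "rep wD D D1" and T1: "rep wT T T1"
    using assms(1) T unfolding TIC_inf_iff by blast
  \<comment> \<open>Nonnegative, so that the stable blocks of the closed loop extend to this weight,
    and large enough for both \<open>D\<close> and \<open>T\<close> to act there.\<close>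
  define w where "w = max 0 (max wD wT)"
  have w: "0 \<le> w" "wD \<le> w" "wT \<le> w" by (simp_all add: w_def)
  obtain Dw where Dw: "rep w D Dw" by (rule rep_up[OF D1 w(2)])
  obtain Tw where Tw: "rep w T Tw" by (rule rep_up[OF T1 w(3)])
  note tD = rep_tico[OF Dw] and tT = rep_tico[OF Tw]
  let ?l = "pw (\<lambda>v :: 'u. (v, 0 :: 'y))" and ?r = "pw (\<lambda>v :: 'y. (0 :: 'u, v))"
  define A0 where "A0 x = pw fst (QF (?l x))" for x
  define B0 where "B0 y = pw fst (QF (?r y))" for y
  define C0 where "C0 x = pw snd (QF (?l x))" for x
  define E0 where "E0 y = pw snd (QF (?r y))" for y
  have t0: "tico A0" "tico B0" "tico C0" "tico E0"
    unfolding A0_def[abs_def] B0_def[abs_def] C0_def[abs_def] E0_def[abs_def]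
    by (rule tico_compose[OF tico_fst tico_compose[OF tQF tico_inl]] tico_compose[OF tico_fst tico_compose[OF tQF tico_inr]]
      tico_compose[OF tico_snd tico_compose[OF tQF tico_inl]] tico_compose[OF tico_snd tico_compose[OF tQF tico_inr]])+
  have QF_Blk: "QF = Blk A0 B0 C0 E0"
  proof
    fix p
    have "QF p = QF (?l (pw fst p)) + QF (?r (pw snd p))"
      using linear_add[OF tico_linear[OF tQF], of "?l (pw fst p)" "?r (pw snd p)"] pr_fst_snd[of p]
      by (simp add: pr_def)
    then have "pw fst (QF p) = A0 (pw fst p) + B0 (pw snd p)" "pw snd (QF p) = C0 (pw fst p) + E0 (pw snd p)"
      by (simp_all add: A0_def B0_def C0_def E0_def linear_add[OF tico_linear[OF tico_fst]] linear_add[OF tico_linear[OF tico_snd]])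
    moreover have "QF p = pr (pw fst (QF p)) (pw snd (QF p))" by simp
    ultimately show "QF p = Blk A0 B0 C0 E0 p" by (simp only: Blk_def)
  qed
  obtain A where A: "tico A" "agree w A0 A" using tico_extension[OF t0(1) w(1)] by (auto simp: agree_def)
  obtain B where B: "tico B" "agree w B0 B" using tico_extension[OF t0(2) w(1)] by (auto simp: agree_def)
  obtain C where C: "tico C" "agree w C0 C" using tico_extension[OF t0(3) w(1)] by (auto simp: agree_def)
  obtain E where E: "tico E" "agree w E0 E" using tico_extension[OF t0(4) w(1)] by (auto simp: agree_def)
  have rF: "rep w F (Blk A B C E)"
    unfolding rep_eq_iff[OF QF tico_Blk[OF A(1) B(1) C(1) E(1)]] QF_Blk
    using A(2) B(2) C(2) E(2) unfolding agree_def Blk_def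
    by (auto intro!: wt_pr wt_add simp: wt_pw bounded_linear_fst bounded_linear_snd)
  have rS: "rep w ?S (Blk (\<lambda>x. x) (\<lambda>y. - Tw y) (\<lambda>x. - Dw x) (\<lambda>y. y))"
    by (intro rep_block rep_one rep_uminus Dw Tw)
  have inv1: "pr ((A x + B y) - Tw (C x + E y)) (- Dw (A x + B y) + (C x + E y)) = pr x y"
    and inv2: "pr (A (x - Tw y) + B (y - Dw x)) (C (x - Tw y) + E (y - Dw x)) = pr x y" for x y
  proof -
    note i = inv[unfolded is_tic_inverse_iff[OF rS rF]]
    show "pr ((A x + B y) - Tw (C x + E y)) (- Dw (A x + B y) + (C x + E y)) = pr x y"
      using spec[OF conjunct1[OF i], of "pr x y"] by (simp add: Blk_pr)
    show "pr (A (x - Tw y) + B (y - Dw x)) (C (x - Tw y) + E (y - Dw x)) = pr x y"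
      using spec[OF conjunct2[OF i], of "pr x y"] by (simp add: Blk_pr)
  qed
  note z = linear_0[OF tico_linear[OF A(1)]] linear_0[OF tico_linear[OF B(1)]] linear_0[OF tico_linear[OF C(1)]]
    linear_0[OF tico_linear[OF E(1)]] linear_0[OF tico_linear[OF tD]] linear_0[OF tico_linear[OF tT]]
  note neg = linear_neg[OF tico_linear[OF A(1)]] linear_neg[OF tico_linear[OF B(1)]] linear_neg[OF tico_linear[OF C(1)]]
    linear_neg[OF tico_linear[OF E(1)]] linear_neg[OF tico_linear[OF tD]] linear_neg[OF tico_linear[OF tT]]
  have e1: "A x - Tw (C x) = x" "Dw (A x) = C x" for x
    using inv1[of x 0] by (auto simp: z pr_eq_iff)
  have e2: "B y = Tw (E y)" "E y - Dw (B y) = y" for y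
    using inv1[of 0 y] by (auto simp: z pr_eq_iff)
  have e3: "A x - B (Dw x) = x" "E (Dw x) = C x" for x
    using inv2[of x 0] by (auto simp: z neg pr_eq_iff)
  have e4: "A (Tw y) = B y" "E y - C (Tw y) = y" for y
    using inv2[of 0 y] by (auto simp: z neg pr_eq_iff)
  \<comment> \<open>By these four identities \<open>D\<close> and \<open>T\<close> map the relevant
    blocks to stable operators, so that the pairs lie in the graphs to be factored.\<close>
  have DA: "(\<lambda>x. Dw (A x)) = C" using e1 by auto
  have DB: "(\<lambda>y. Dw (B y)) = (\<lambda>y. E y - y)"
    by (rule ext) (use e2(2) in \<open>simp add: eq_diff_eq diff_eq_eq add.commute\<close>)
  have TE: "(\<lambda>y. Tw (E y)) = B" using e2 by auto
  have TC: "(\<lambda>x. Tw (C x)) = (\<lambda>x. A x - x)"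
    by (rule ext) (use e1(1) in \<open>simp add: eq_diff_eq diff_eq_eq add.commute\<close>)
  obtain M0 M :: "'u l2 \<Rightarrow> 'u l2" and N0 :: "'u l2 \<Rightarrow> 'y l2" and A20 A2 :: "'u l2 \<Rightarrow> 'u l2"
    and B20 B2 :: "'y l2 \<Rightarrow> 'u l2" where M: "tico M0" "tico M" "agree w M0 M" and N: "tico N0" "agree w N0 (\<lambda>x. Dw (M x))"
    and A2: "tico A20" "tico A2" "agree w A20 A2" and B2: "tico B20" "tico B2" "agree w B20 B2"
    and fM: "\<forall>x. M (A2 x) = A x" "\<forall>x. M (B2 x) = B x"
      "\<forall>x. M (A2 x - B2 (Dw x)) = x" "\<forall>x. A2 (M x) - B2 (Dw (M x)) = x"
    by (rule stable_right_factor[OF w(1) tD t0(1) A(1) t0(2) B(1) t0(3) tico_diff[OF t0(4) tico_id] A(2) B(2), unfolded DA DB,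
        OF C(2) agree_diff[OF E(2) agree_id] e3(1)]) (rule that)
  have MA: "M (A2 x) = A x" and MB: "M (B2 y) = B y" and MI: "M (A2 x - B2 (Dw x)) = x"
    and IM: "A2 (M x) - B2 (Dw (M x)) = x" for x y
    by (simp_all only: fM)
  \<comment> \<open>The same lemma with the roles exchanged: \<open>T\<close> for \<open>D\<close>,
    and \<open>E\<close>, \<open>C\<close> for \<open>A\<close>, \<open>B\<close>; the stable
    restrictions are now \<open>B\<close> and \<open>A - I\<close>.\<close>
  obtain X0 X :: "'y l2 \<Rightarrow> 'y l2" and Y0 :: "'y l2 \<Rightarrow> 'u l2" and E20 E2 :: "'y l2 \<Rightarrow> 'y l2"
    and C20 C2 :: "'u l2 \<Rightarrow> 'y l2" where X: "tico X0" "tico X" "agree w X0 X" and Y: "tico Y0" "agree w Y0 (\<lambda>x. Tw (X x))"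
    and E2: "tico E20" "tico E2" "agree w E20 E2" and C2: "tico C20" "tico C2" "agree w C20 C2"
    and fX: "\<forall>x. X (E2 x) = E x" "\<forall>x. X (C2 x) = C x"
      "\<forall>x. X (E2 x - C2 (Tw x)) = x" "\<forall>x. E2 (X x) - C2 (Tw (X x)) = x"
    by (rule stable_right_factor[OF w(1) tT t0(4) E(1) t0(3) C(1) t0(2) tico_diff[OF t0(1) tico_id] E(2) C(2), unfolded TE TC,
        OF B(2) agree_diff[OF A(2) agree_id] e4(2)]) (rule that)
  have XE: "X (E2 x) = E x" and XC: "X (C2 y) = C y" and IX: "E2 (X x) - C2 (Tw (X x)) = x" for x y
    by (simp_all only: fX)
  note lin = linear_add[OF tico_linear[OF M(2)]] linear_diff[OF tico_linear[OF M(2)]]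
    linear_add[OF tico_linear[OF X(2)]] linear_diff[OF tico_linear[OF X(2)]]
    linear_add[OF tico_linear[OF tD]] linear_diff[OF tico_linear[OF tD]]
    linear_add[OF tico_linear[OF tT]] linear_diff[OF tico_linear[OF tT]]
    linear_add[OF tico_linear[OF E(1)]] linear_diff[OF tico_linear[OF E(1)]]
    linear_add[OF tico_linear[OF A2(2)]] linear_add[OF tico_linear[OF B2(2)]]
    linear_add[OF tico_linear[OF C2(2)]] linear_add[OF tico_linear[OF E2(2)]]
  have M_inj: "x = y" if "M x = M y" for x y using IM that by metis
  have X_inj: "x = y" if "X x = X y" for x y using IX that by metis
  \<comment> \<open>The relations \<open>A T = B\<close> and \<open>E D = C\<close> may be divided
    by \<open>M\<close> and \<open>X\<close> on the left. They make the off-diagonal entries vanish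
    in the second product below.\<close>
  have A2T: "A2 (Tw z) = B2 z" for z by (rule M_inj) (simp add: MA MB e4)
  have E2D: "E2 (Dw z) = C2 z" for z by (rule X_inj) (simp add: XE XC e3)
  let ?M = "stable_class M0" and ?N = "stable_class N0" and ?Y = "stable_class Y0" and ?X = "stable_class X0"
    and ?Xt = "stable_class A20" and ?Yt = "stable_class B20" and ?Nt = "stable_class C20" and ?Mt = "stable_class E20"
  note tDM = tico_compose[OF tD M(2)] and tTX = tico_compose[OF tT X(2)]
  have rM: "rep w ?M M" and rN: "rep w ?N (\<lambda>x. Dw (M x))" and rY: "rep w ?Y (\<lambda>x. Tw (X x))" and rX: "rep w ?X X"
    and rXt: "rep w ?Xt A2" and rYt: "rep w ?Yt B2" and rNt: "rep w ?Nt C2" and rMt: "rep w ?Mt E2"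
    by (rule rep_stable_class_agree[OF M] rep_stable_class_agree[OF N(1) tDM N(2)]
      rep_stable_class_agree[OF Y(1) tTX Y(2)] rep_stable_class_agree[OF X] rep_stable_class_agree[OF A2]
      rep_stable_class_agree[OF B2] rep_stable_class_agree[OF C2] rep_stable_class_agree[OF E2])+
  define Mi where "Mi x = A2 x - B2 (Dw x)" for x
  \<comment> \<open>Since \<open>E\<close> is the inverse of \<open>I - D T\<close> and
    \<open>E = X E2\<close>, the inverse of \<open>E2\<close> is \<open>(I - D T) X\<close>; in
    general it is available only at weight \<open>w\<close>.\<close>
  define Ei where "Ei y = X y - Dw (Tw (X y))" for y
  have tMi: "tico Mi" unfolding Mi_def[abs_def] by (rule tico_diff[OF A2(2) tico_compose[OF B2(2) tD]])
  have tEi: "tico Ei" unfolding Ei_def[abs_def] by (rule tico_diff[OF X(2) tico_compose[OF tD tTX]])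
  have Mi: "M (Mi x) = x" "Mi (M x) = x" for x using MI IM by (simp_all add: Mi_def)
  have Ei1: "Ei (E2 y) = y" for y using e2 by (simp add: Ei_def XE)
  have Ei2: "E2 (Ei y) = y" for y
  proof (rule X_inj)
    have "X (E2 (Ei y)) = E (X y) - E (Dw (Tw (X y)))" by (simp add: XE Ei_def lin)
    also have "\<dots> = X y" by (simp add: e3 e4)
    finally show "X (E2 (Ei y)) = X y" .
  qed
  note iM = tic_inverseI[OF rM rep_class_op[OF tMi] Mi]
  note iMt = tic_inverseI[OF rMt rep_class_op[OF tEi] Ei2 Ei1]
  have DN: "D = ?N \<odot> tic_inv ?M"
    unfolding iM(1)
    by (rule rep_tic_eq[OF Dw]) (use rep_comp[OF rN rep_class_op[OF tMi]] in \<open>simp add: Mi\<close>)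
  have DNt: "D = tic_inv ?Mt \<odot> ?Nt"
    unfolding iMt(1)
  proof (rule rep_tic_eq[OF Dw])
    \<comment> \<open>The left factorization: \<open>(I - D T) X C2 = (I - D T) C\<close>, and
      \<open>T C = A - I\<close> together with \<open>D A = C\<close> reduces this to
      \<open>D\<close>.\<close>
    have "Ei (C2 x) = Dw x" for x
    proof -
      have "Ei (C2 x) = C x - Dw (A x - x)" using fun_cong[OF TC, of x] by (simp add: Ei_def XC)
      then show ?thesis by (simp add: lin e1)
    qed
    then show "rep w (TIC_rel `` {(w, op w Ei)} \<odot> ?Nt) Dw"
      using rep_comp[OF rep_class_op[OF tEi] rNt] by simp
  qed
  let ?O = "tic_block ?M ?Y ?N ?X" and ?P = "tic_block ?Xt (tic_uminus ?Yt) (tic_uminus ?Nt) ?Mt"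
  \<comment> \<open>\<open>?bO\<close> is \<open>[I, T; D, I]\<close> composed with the diagonal
    operator of \<open>M\<close> and \<open>X\<close>. It and \<open>?bP\<close> are multiplied at
    weight \<open>w\<close>, where \<open>D\<close> and \<open>T\<close> act, although both classes
    are stable.\<close>
  let ?bO = "Blk M (\<lambda>x. Tw (X x)) (\<lambda>x. Dw (M x)) X" and ?bP = "Blk A2 (\<lambda>y. - B2 y) (\<lambda>x. - C2 x) E2"
  note rsc = rep_stable_class
  have O0: "?O \<in> TIC 0"
    unfolding TIC_iff by (rule exI, rule rep_block[OF rsc[OF M(1)] rsc[OF Y(1)] rsc[OF N(1)] rsc[OF X(1)]])
  have P0: "?P \<in> TIC 0"
    unfolding TIC_iff
    by (rule exI, rule rep_block[OF rsc[OF A2(1)] rep_uminus[OF rsc[OF B2(1)]] rep_uminus[OF rsc[OF C2(1)]] rsc[OF E2(1)]])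
  have rO: "rep w ?O ?bO" by (rule rep_block[OF rM rY rN rX])
  have rP: "rep w ?P ?bP" by (rule rep_block[OF rXt rep_uminus[OF rYt] rep_uminus[OF rNt] rMt])
  have OP: "?bO (?bP p) = p" for p
  proof -
    obtain x y where p: "p = pr x y" by (metis pr_fst_snd)
    have "M (A2 x + - B2 y) + Tw (X (- C2 x + E2 y)) = (A x - Tw (C x)) + (Tw (E y) - B y)"
      by (simp add: lin MA MB XC XE flip: diff_conv_add_uminus)
    moreover have "Dw (M (A2 x + - B2 y)) + X (- C2 x + E2 y) = (Dw (A x) - C x) + (E y - Dw (B y))"
      by (simp add: lin MA MB XC XE flip: diff_conv_add_uminus)
    ultimately show ?thesis unfolding p Blk_pr by (simp add: e1 e2 flip: e2(1))
  qed
  have PO: "?bP (?bO p) = p" for p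
  proof -
    obtain x y where p: "p = pr x y" by (metis pr_fst_snd)
    have "A2 (M x + Tw (X y)) + - B2 (Dw (M x) + X y) = (A2 (M x) - B2 (Dw (M x))) + (A2 (Tw (X y)) - B2 (X y))"
      by (simp add: lin)
    moreover have "- C2 (M x + Tw (X y)) + E2 (Dw (M x) + X y) = (E2 (X y) - C2 (Tw (X y))) + (E2 (Dw (M x)) - C2 (M x))"
      by (simp add: lin)
    ultimately show ?thesis unfolding p Blk_pr by (simp add: IM IX A2T E2D)
  qed
  note iO = tic_inverseI[OF rO rP OP PO]
  note iP = tic_inverseI[OF rP rO PO OP]
  have "?O \<in> GTIC" "?P \<in> GTIC" using O0 P0 iO(3) iP(3) by (auto simp: GTIC_def)
  then show ?thesis
    unfolding has_dcf_def
    by (intro bexI[of _ ?M] bexI[of _ ?N] bexI[of _ ?Y] bexI[of _ ?X] bexI[of _ ?Mt] bexI[of _ ?Nt] bexI[of _ ?Yt] bexI[of _ ?Xt]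
        conjI DN DNt iM(2) iMt(2) iO(1) stable_class_TIC M N X Y A2 B2 C2 E2)
qed

end
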